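(* Let $G/K$ be a homogeneous space of a real Banach--Lie group $G$, and let $\mathcal J$ be the homogeneous almost complex structure on $G/K$ induced by $J\in\mathcal{AC}(G,K)$. Let $Z_+=\{v\in\mathfrak g^{\mathbb C}:(J^{\mathbb C}-i)v\in\mathfrak k^{\mathbb C}\}$. Then $\mathcal J$ is Nijenhuis (i.e. $\Omega_{\mathcal J}\equiv0$ holds) if and only if $[v,w]\in Z_+$ for all $v,w\in Z_+$.
   Context: Setting. $G$ is a real Banach--Lie group with Banach--Lie algebra $\mathfrak g$; $K$ is an immersed Banach--Lie subgroup of $G$ with Banach--Lie subalgebra $\mathfrak k\subset\mathfrak g$ (immersion: each differential is injective with closed range). $G/K=\{gK: g\in G\}$ is a homogeneous space of $G$, meaning that it has a Hausdorff Banach manifold structure such that the quotient map $\pi:G\to G/K$, $\pi(g)=gK$, is a submersion, i.e. its differential is surjective at every point (no splitting of kernels is required; $\mathfrak k$ need not be complemented in $\mathfrak g$). The base point is $p_0=\pi(1)$. For $g\in G$, $\alpha_g:G/K\to G/K$ is $\alpha_g(\pi(h))=\pi(gh)$. $f_*$ denotes the differential of $f$ and $f_{*m}$ the differential at $m$. $\mathrm{Ad}$ is the adjoint representation of $G$ on $\mathfrak g$; $\mathcal B(\mathfrak g)$ is the space of bounded linear operators on $\mathfrak g$. All vector bundle maps cover the identity. One has $\ker\pi_{*1}=\mathfrak k$. Admissible operators. $\mathcal A(G,K)=\{N\in\mathcal B(\mathfrak g): N\mathfrak k\subset\mathfrak k,\ \mathrm{Ran}(\mathrm{Ad}_kN-N\mathrm{Ad}_k)\subset\mathfrak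 k\ \ \forall k\in K\}$, and $\mathcal{AC}(G,K)=\{J\in\mathcal A(G,K): \mathrm{Ran}(J^2+1)\subset\mathfrak k\}$. Induced structure. The vector bundle map $\mathcal J:T(G/K)\to T(G/K)$ induced by $J\in\mathcal{AC}(G,K)$ is given by $\mathcal J_{p_0}\pi_{*1}v=\pi_{*1}Jv$ for $v\in\mathfrak g$, and $\mathcal J_p=(\alpha_g)_*\mathcal J_{p_0}(\alpha_g)_*^{-1}$ for $p=\pi(g)$ (this is well defined and smooth); it satisfies $\mathcal J^2=-1$, so it is an almost complex structure. Nijenhuis torsion. For vector fields $X,Y$ on $G/K$, $\Omega_{\mathcal J}(X,Y)=\mathcal J[\mathcal JX,Y]+\mathcal J[X,\mathcal JY]-[\mathcal JX,\mathcal JY]+[X,Y]$. Complexification. $\mathfrak g^{\mathbb C}=\mathfrak g\oplus i\mathfrak g$ with the complex bilinear extension of the bracket, $\mathfrak k^{\mathbb C}=\mathfrak k\oplus i\mathfrak k$, and $J^{\mathbb C}(a+ib)=Ja+iJb$. *)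

theory Defs
  imports
    "HOL-Analysis.Analysis"
    "HOL-Algebra.Left_Coset"
    "HOL-Library.Function_Algebras"
begin

section \<open>Smooth maps between Banach spaces\<close>

text \<open>
  \<open>D x [v\<^sub>1, \<dots>, v\<^sub>n]\<close> is the \<open>n\<close>-th Fr\'echet derivative of \<open>f\<close> at \<open>x\<close> applied to
  \<open>v\<^sub>1, \<dots>, v\<^sub>n\<close>.  Its type cannot depend on \<open>n\<close>, hence the list.  The first two conditions after
  \<open>D x [] = f x\<close> say that it is a bounded \<open>n\<close>-linear map for each \<open>n\<close>; the third says that
  \<open>D\<^sup>n f\<close> is Fr\'echet differentiable as a map into the bounded \<open>n\<close>-linear maps (with operator
  norm), with derivative \<open>D\<^sup>n\<^sup>+\<^sup>1 f\<close>.
\<close>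

definition smooth_on :: "'a::real_normed_vector set \<Rightarrow> ('a \<Rightarrow> 'b::real_normed_vector) \<Rightarrow> bool" where
  "smooth_on S f \<longleftrightarrow> open S \<and>
    (\<exists>D :: 'a \<Rightarrow> 'a list \<Rightarrow> 'b. \<forall>x\<in>S.
       D x [] = f x \<and>
       (\<forall>us vs. linear (\<lambda>w. D x (us @ w # vs))) \<and>
       (\<forall>n. \<exists>C. \<forall>vs. length vs = n \<longrightarrow> norm (D x vs) \<le> C * (\<Prod>v\<leftarrow>vs. norm v)) \<and>
       (\<forall>n. \<forall>e>0. \<exists>d>0. \<forall>y\<in>S. norm (y - x) < d \<longrightarrow>
          (\<forall>vs. length vs = n \<longrightarrow>
             norm (D y vs - D x vs - D x ((y - x) # vs))
               \<le> e * norm (y - x) * (\<Prod>v\<leftarrow>vs. norm v))))"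


section \<open>Banach manifolds\<close>

text \<open>
  A chart is its domain together with its coordinate map, whose values outside the domain are
  irrelevant.  All charts of a manifold take values in one Banach space \<open>'e\<close>; this is no
  restriction on the manifolds considered here, since all tangent spaces of a Lie group, and all
  tangent spaces of a homogeneous space, are isomorphic.
\<close>

type_synonym ('m, 'e) chart = "'m set \<times> ('m \<Rightarrow> 'e)"

abbreviation chart_dom :: "('m, 'e) chart \<Rightarrow> 'm set" where
  "chart_dom c \<equiv> fst c"

abbreviation chart_map :: "('m, 'e) chart \<Rightarrow> 'm \<Rightarrow> 'e" where
  "chart_map c \<equiv> snd c"

definition chart_inv :: "('m, 'e) chart \<Rightarrow> 'e \<Rightarrow> 'm" where
  "chart_inv c = inv_into (chart_dom c) (chart_map c)"

record ('m, 'e) mfd =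
  mfd_topology :: "'m topology"
  atlas :: "('m, 'e) chart set"

abbreviation pts :: "('m, 'e) mfd \<Rightarrow> 'm set" where
  "pts M \<equiv> topspace (mfd_topology M)"

definition charts_at :: "('m, 'e) mfd \<Rightarrow> 'm \<Rightarrow> ('m, 'e) chart set" where
  "charts_at M p = {c \<in> atlas M. p \<in> chart_dom c}"

definition banach_manifold :: "('m, 'e::banach) mfd \<Rightarrow> bool" where
  "banach_manifold M \<longleftrightarrow>
     Hausdorff_space (mfd_topology M) \<and>
     (\<Union>c\<in>atlas M. chart_dom c) = pts M \<and>
     (\<forall>c\<in>atlas M.
        openin (mfd_topology M) (chart_dom c) \<and>
        open (chart_map c ` chart_dom c) \<and>
        homeomorphic_map (subtopology (mfd_topology M) (chart_dom c))
          (top_of_set (chart_map c ` chart_dom c)) (chart_map c)) \<and>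
     (\<forall>c\<in>atlas M. \<forall>d\<in>atlas M.
        smooth_on (chart_map c ` (chart_dom c \<inter> chart_dom d)) (chart_map d \<circ> chart_inv c))"

definition prod_mfd :: "('m, 'e) mfd \<Rightarrow> ('n, 'f) mfd \<Rightarrow> ('m \<times> 'n, 'e \<times> 'f) mfd" where
  "prod_mfd M N =
     \<lparr>mfd_topology = prod_topology (mfd_topology M) (mfd_topology N),
      atlas = {(chart_dom c \<times> chart_dom d, map_prod (chart_map c) (chart_map d)) | c d.
                 c \<in> atlas M \<and> d \<in> atlas N}\<rparr>"

definition smooth_map ::
  "('m, 'e::banach) mfd \<Rightarrow> ('n, 'f::banach) mfd \<Rightarrow> ('m \<Rightarrow> 'n) \<Rightarrow> bool" where
  "smooth_map M N f \<longleftrightarrow>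
     continuous_map (mfd_topology M) (mfd_topology N) f \<and>
     (\<forall>c\<in>atlas M. \<forall>d\<in>atlas N.
        smooth_on (chart_map c ` (chart_dom c \<inter> f -` chart_dom d))
          (chart_map d \<circ> f \<circ> chart_inv c))"


section \<open>Tangent vectors, differentials, vector fields\<close>

text \<open>
  A tangent vector at \<open>p\<close> is the family of its coordinate vectors in all the charts around \<open>p\<close>,
  related by the differentials of the transition maps.  The vector space operations are the
  pointwise ones.  The value \<open>0\<close> at the other charts makes equality of tangent vectors equality
  of functions.
\<close>

type_synonym ('m, 'e) tvec = "('m, 'e) chart \<Rightarrow> 'e"

definition tspace :: "('m, 'e::banach) mfd \<Rightarrow> 'm \<Rightarrow> ('m, 'e) tvec set" where
  "tspace M p =
     {v. (\<forall>c. c \<notin> charts_at M p \<longrightarrow> v c = 0) \<and>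
         (\<forall>c\<in>charts_at M p. \<forall>d\<in>charts_at M p.
            v d = frechet_derivative (chart_map d \<circ> chart_inv c) (at (chart_map c p)) (v c))}"

text \<open>
  The chart at \<open>p\<close> used to compute the differential is immaterial when \<open>f\<close> is differentiable at
  \<open>p\<close> and \<open>v\<close> is a tangent vector there.
\<close>

definition differential ::
  "('m, 'e::banach) mfd \<Rightarrow> ('n, 'f::banach) mfd \<Rightarrow> ('m \<Rightarrow> 'n) \<Rightarrow> 'm \<Rightarrow>
   ('m, 'e) tvec \<Rightarrow> ('n, 'f) tvec" where
  "differential M N f p v =
     (\<lambda>d. if d \<in> charts_at N (f p)
          then let c = (SOME c. c \<in> charts_at M p) in
            frechet_derivative (chart_map d \<circ> f \<circ> chart_inv c) (at (chart_map c p)) (v c)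
          else 0)"

definition submersion ::
  "('m, 'e::banach) mfd \<Rightarrow> ('n, 'f::banach) mfd \<Rightarrow> ('m \<Rightarrow> 'n) \<Rightarrow> bool" where
  "submersion M N f \<longleftrightarrow> smooth_map M N f \<and>
     (\<forall>p\<in>pts M. differential M N f p ` tspace M p = tspace N (f p))"

definition immersion ::
  "('m, 'e::banach) mfd \<Rightarrow> ('n, 'f::banach) mfd \<Rightarrow> ('m \<Rightarrow> 'n) \<Rightarrow> bool" where
  "immersion M N f \<longleftrightarrow> smooth_map M N f \<and>
     (\<forall>p\<in>pts M. inj_on (differential M N f p) (tspace M p) \<and>
        (\<forall>d\<in>charts_at N (f p). closed ((\<lambda>v. v d) ` differential M N f p ` tspace M p)))"

text \<open>\<open>\<B>(T\<^sub>pM)\<close>; boundedness may be tested in any chart, as the charts induce equivalent norms.\<close>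

definition bounded_operator ::
  "('m, 'e::banach) mfd \<Rightarrow> 'm \<Rightarrow> (('m, 'e) tvec \<Rightarrow> ('m, 'e) tvec) \<Rightarrow> bool" where
  "bounded_operator M p N \<longleftrightarrow>
     (\<forall>v\<in>tspace M p. N v \<in> tspace M p) \<and>
     (\<forall>v\<in>tspace M p. \<forall>w\<in>tspace M p. N (v + w) = N v + N w) \<and>
     (\<forall>r. \<forall>v\<in>tspace M p. N (\<lambda>c. r *\<^sub>R v c) = (\<lambda>c. r *\<^sub>R N v c)) \<and>
     (\<forall>c\<in>charts_at M p. \<exists>C. \<forall>v\<in>tspace M p. norm (N v c) \<le> C * norm (v c))"

definition local_rep ::
  "('m, 'e) chart \<Rightarrow> ('m \<Rightarrow> ('m, 'e) tvec) \<Rightarrow> 'e \<Rightarrow> 'e" where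
  "local_rep c X = (\<lambda>x. X (chart_inv c x) c)"

definition vector_field :: "('m, 'e::banach) mfd \<Rightarrow> ('m \<Rightarrow> ('m, 'e) tvec) \<Rightarrow> bool" where
  "vector_field M X \<longleftrightarrow>
     (\<forall>p\<in>pts M. X p \<in> tspace M p) \<and>
     (\<forall>c\<in>atlas M. smooth_on (chart_map c ` chart_dom c) (local_rep c X))"

definition bracket ::
  "('m, 'e::banach) mfd \<Rightarrow> ('m \<Rightarrow> ('m, 'e) tvec) \<Rightarrow> ('m \<Rightarrow> ('m, 'e) tvec) \<Rightarrow>
   'm \<Rightarrow> ('m, 'e) tvec" where
  "bracket M X Y p =
     (\<lambda>c. if c \<in> charts_at M p
          then frechet_derivative (local_rep c Y) (at (chart_map c p)) (X p c)
             - frechet_derivative (local_rep c X) (at (chart_map c p)) (Y p c)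
          else 0)"

definition nijenhuis_torsion ::
  "('m, 'e::banach) mfd \<Rightarrow> ('m \<Rightarrow> ('m, 'e) tvec \<Rightarrow> ('m, 'e) tvec) \<Rightarrow>
   ('m \<Rightarrow> ('m, 'e) tvec) \<Rightarrow> ('m \<Rightarrow> ('m, 'e) tvec) \<Rightarrow> 'm \<Rightarrow> ('m, 'e) tvec" where
  "nijenhuis_torsion M \<J> X Y p =
     (let \<J>X = (\<lambda>q. \<J> q (X q)); \<J>Y = (\<lambda>q. \<J> q (Y q)) in
      \<J> p (bracket M \<J>X Y p) + \<J> p (bracket M X \<J>Y p) - bracket M \<J>X \<J>Y p + bracket M X Y p)"

definition is_nijenhuis ::
  "('m, 'e::banach) mfd \<Rightarrow> ('m \<Rightarrow> ('m, 'e) tvec \<Rightarrow> ('m, 'e) tvec) \<Rightarrow> bool" where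
  "is_nijenhuis M \<J> \<longleftrightarrow>
     (\<forall>X Y. vector_field M X \<longrightarrow> vector_field M Y \<longrightarrow>
        (\<forall>p\<in>pts M. nijenhuis_torsion M \<J> X Y p = 0))"


section \<open>Banach--Lie groups\<close>

definition banach_lie_group :: "'g monoid \<Rightarrow> ('g, 'a::banach) mfd \<Rightarrow> bool" where
  "banach_lie_group G M \<longleftrightarrow>
     group G \<and> banach_manifold M \<and> pts M = carrier G \<and>
     smooth_map (prod_mfd M M) M (\<lambda>(g, h). g \<otimes>\<^bsub>G\<^esub> h) \<and>
     smooth_map M M (\<lambda>g. inv\<^bsub>G\<^esub> g)"

definition lie_alg :: "'g monoid \<Rightarrow> ('g, 'a::banach) mfd \<Rightarrow> ('g, 'a) tvec set" where
  "lie_alg G M = tspace M \<one>\<^bsub>G\<^esub>"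

definition left_inv_field ::
  "'g monoid \<Rightarrow> ('g, 'a::banach) mfd \<Rightarrow> ('g, 'a) tvec \<Rightarrow> 'g \<Rightarrow> ('g, 'a) tvec" where
  "left_inv_field G M v g = differential M M (\<lambda>h. g \<otimes>\<^bsub>G\<^esub> h) \<one>\<^bsub>G\<^esub> v"

definition lie_bracket ::
  "'g monoid \<Rightarrow> ('g, 'a::banach) mfd \<Rightarrow> ('g, 'a) tvec \<Rightarrow> ('g, 'a) tvec \<Rightarrow> ('g, 'a) tvec" where
  "lie_bracket G M v w = bracket M (left_inv_field G M v) (left_inv_field G M w) \<one>\<^bsub>G\<^esub>"

definition Ad :: "'g monoid \<Rightarrow> ('g, 'a::banach) mfd \<Rightarrow> 'g \<Rightarrow> ('g, 'a) tvec \<Rightarrow> ('g, 'a) tvec" where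
  "Ad G M k = differential M M (\<lambda>h. k \<otimes>\<^bsub>G\<^esub> h \<otimes>\<^bsub>G\<^esub> inv\<^bsub>G\<^esub> k) \<one>\<^bsub>G\<^esub>"

text \<open>The topology and the manifold structure \<open>L\<close> of \<open>K\<close> need not be induced from \<open>G\<close>.\<close>

definition immersed_lie_subgroup ::
  "'g monoid \<Rightarrow> ('g, 'a::banach) mfd \<Rightarrow> 'g set \<Rightarrow> ('g, 'b::banach) mfd \<Rightarrow> bool" where
  "immersed_lie_subgroup G M K L \<longleftrightarrow>
     subgroup K G \<and> banach_lie_group (G\<lparr>carrier := K\<rparr>) L \<and> immersion L M (\<lambda>k. k)"

definition sub_lie_alg ::
  "'g monoid \<Rightarrow> ('g, 'a::banach) mfd \<Rightarrow> ('g, 'b::banach) mfd \<Rightarrow> ('g, 'a) tvec set" where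
  "sub_lie_alg G M L = differential L M (\<lambda>k. k) \<one>\<^bsub>G\<^esub> ` tspace L \<one>\<^bsub>G\<^esub>"


section \<open>Homogeneous spaces and induced almost complex structures\<close>

definition quot_map :: "'g monoid \<Rightarrow> 'g set \<Rightarrow> 'g \<Rightarrow> 'g set" where
  "quot_map G K g = g <#\<^bsub>G\<^esub> K"

text \<open>Translating a coset elementwise: \<open>g(hK) = (gh)K\<close>.\<close>

definition action :: "'g monoid \<Rightarrow> 'g \<Rightarrow> 'g set \<Rightarrow> 'g set" where
  "action G g p = g <#\<^bsub>G\<^esub> p"

text \<open>
  The last condition, that the kernel of the differential of the quotient map at \<open>1\<close> is the Lie
  algebra of \<open>K\<close>, does not follow from the others: it fails for \<open>G = \<real>\<^sup>2\<close> and \<open>K = \<real> \<times> 0\<close> with the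
  discrete topology.
\<close>

definition homogeneous_space ::
  "'g monoid \<Rightarrow> ('g, 'a::banach) mfd \<Rightarrow> 'g set \<Rightarrow> ('g, 'b::banach) mfd \<Rightarrow>
   ('g set, 'e::banach) mfd \<Rightarrow> bool" where
  "homogeneous_space G M K L Q \<longleftrightarrow>
     banach_lie_group G M \<and>
     immersed_lie_subgroup G M K L \<and>
     banach_manifold Q \<and> pts Q = lcosets\<^bsub>G\<^esub> K \<and>
     submersion M Q (quot_map G K) \<and>
     {v \<in> lie_alg G M. differential M Q (quot_map G K) \<one>\<^bsub>G\<^esub> v = 0} = sub_lie_alg G M L"

definition admissible ::
  "'g monoid \<Rightarrow> ('g, 'a::banach) mfd \<Rightarrow> 'g set \<Rightarrow> ('g, 'b::banach) mfd \<Rightarrow>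
   (('g, 'a) tvec \<Rightarrow> ('g, 'a) tvec) set" where
  "admissible G M K L =
     {N. bounded_operator M \<one>\<^bsub>G\<^esub> N \<and>
         N ` sub_lie_alg G M L \<subseteq> sub_lie_alg G M L \<and>
         (\<forall>k\<in>K. \<forall>v\<in>lie_alg G M. Ad G M k (N v) - N (Ad G M k v) \<in> sub_lie_alg G M L)}"

definition admissible_complex ::
  "'g monoid \<Rightarrow> ('g, 'a::banach) mfd \<Rightarrow> 'g set \<Rightarrow> ('g, 'b::banach) mfd \<Rightarrow>
   (('g, 'a) tvec \<Rightarrow> ('g, 'a) tvec) set" where
  "admissible_complex G M K L =
     {J \<in> admissible G M K L. \<forall>v\<in>lie_alg G M. J (J v) + v \<in> sub_lie_alg G M L}"

definition induced_base ::
  "'g monoid \<Rightarrow> ('g, 'a::banach) mfd \<Rightarrow> 'g set \<Rightarrow> ('g set, 'e::banach) mfd \<Rightarrow>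
   (('g, 'a) tvec \<Rightarrow> ('g, 'a) tvec) \<Rightarrow> ('g set, 'e) tvec \<Rightarrow> ('g set, 'e) tvec" where
  "induced_base G M K Q J u =
     (THE w. \<exists>v\<in>lie_alg G M.
        u = differential M Q (quot_map G K) \<one>\<^bsub>G\<^esub> v \<and>
        w = differential M Q (quot_map G K) \<one>\<^bsub>G\<^esub> (J v))"

definition induced_structure ::
  "'g monoid \<Rightarrow> ('g, 'a::banach) mfd \<Rightarrow> 'g set \<Rightarrow> ('g set, 'e::banach) mfd \<Rightarrow>
   (('g, 'a) tvec \<Rightarrow> ('g, 'a) tvec) \<Rightarrow> 'g set \<Rightarrow> ('g set, 'e) tvec \<Rightarrow> ('g set, 'e) tvec" where
  "induced_structure G M K Q J p u =
     (let p0 = quot_map G K \<one>\<^bsub>G\<^esub> in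
      THE w. \<exists>g\<in>carrier G. p = quot_map G K g \<and>
        (let d\<alpha> = differential Q Q (action G g) p0 in
         w = d\<alpha> (induced_base G M K Q J (inv_into (tspace Q p0) d\<alpha> u))))"


section \<open>Complexification\<close>

text \<open>The pair \<open>(a, b)\<close> stands for \<open>a + ib\<close>.\<close>

definition times_i :: "'v::uminus \<times> 'v \<Rightarrow> 'v \<times> 'v" where
  "times_i v = (- snd v, fst v)"

definition lie_bracket_C ::
  "'g monoid \<Rightarrow> ('g, 'a::banach) mfd \<Rightarrow> ('g, 'a) tvec \<times> ('g, 'a) tvec \<Rightarrow>
   ('g, 'a) tvec \<times> ('g, 'a) tvec \<Rightarrow> ('g, 'a) tvec \<times> ('g, 'a) tvec" where
  "lie_bracket_C G M v w =
     (lie_bracket G M (fst v) (fst w) - lie_bracket G M (snd v) (snd w),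
      lie_bracket G M (fst v) (snd w) + lie_bracket G M (snd v) (fst w))"

definition Z_plus ::
  "'g monoid \<Rightarrow> ('g, 'a::banach) mfd \<Rightarrow> ('g, 'b::banach) mfd \<Rightarrow>
   (('g, 'a) tvec \<Rightarrow> ('g, 'a) tvec) \<Rightarrow> (('g, 'a) tvec \<times> ('g, 'a) tvec) set" where
  "Z_plus G M L J =
     {v \<in> lie_alg G M \<times> lie_alg G M.
        map_prod J J v - times_i v \<in> sub_lie_alg G M L \<times> sub_lie_alg G M L}"

end

theory Submission
  imports Defs
begin

text \<open>
  Smooth fields on \<open>G/K\<close> need not lift to \<open>G\<close>, because \<open>\<kk>\<close> may be uncomplemented and the quotient
  map \<open>\<pi>\<close> then has no smooth local sections.  But the torsion at a point only depends on the values of the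
  fields there and on the first derivative of \<open>\<J>\<close>, and differentiating
  \<open>\<J>\<^bsub>\<pi>(g)\<^esub> \<pi>\<^sub>* \<lambda>\<^sub>v(g) = \<pi>\<^sub>* \<lambda>\<^bsub>Jv\<^esub>(g)\<close> along the left invariant fields \<open>\<lambda>\<^sub>w\<close> shows that its value on
  \<open>\<pi>\<^sub>*\<lambda>\<^sub>v\<close> and \<open>\<pi>\<^sub>*\<lambda>\<^sub>w\<close> is \<open>\<pi>\<^sub>*\<lambda>\<^sub>u\<close> with \<open>u = J[Jv,w] + J[v,Jw] - [Jv,Jw] + [v,w]\<close>.  So \<open>\<J>\<close> is Nijenhuis
  iff all these \<open>u\<close> lie in \<open>\<kk>\<close>, where for one direction the fundamental fields of the action of \<open>G\<close>
  provide enough smooth fields on \<open>G/K\<close>; the rest is linear algebra.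

  That \<open>\<J>\<close> and the fundamental fields are smooth amounts to: if \<open>\<gamma> \<circ> \<pi>\<close> is smooth for a
  submersion \<open>\<pi>\<close>, then so is \<open>\<gamma>\<close>.  Graves' theorem makes \<open>\<gamma>\<close> locally Lipschitz, hence differentiable,
  and \<open>(\<gamma>' \<circ> \<pi>) \<pi>' = (\<gamma> \<circ> \<pi>)'\<close> can be divided by the surjective \<open>\<pi>'\<close>, so that one can iterate.
\<close>

section \<open>Open mapping and local surjectivity\<close>

text \<open>A chart \<open>c0\<close> at the identity identifies the Lie algebra with the Banach
  space \<open>'a\<close>. There \<open>J\<close> becomes the operator \<open>J0\<close>, the
  bracket becomes \<open>frame_bracket\<close>, and \<kk> becomes \<open>\<kk>0\<close>, so the
  final equivalence concerns these three alone. Two obstacles shape the rest. In charts \<J> is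
  known only through the identity \<open>Jop d (\<pi> x) o proj_frame x = proj_frame x o J0\<close>,
  in which neither \<pi> nor the surjective operator \<open>proj_frame x\<close> has a usable right
  inverse. Hence two separate divisions: one by an operator-valued function, one by the map \<pi>.
  In both, preimages of controlled norm, supplied by the open mapping theorem and by Graves'
  theorem, take the place of linear or smooth sections. Secondly, an element of
  \<open>Z_plus\<close> has the form a - iJa only up to \<kk> + i\<kk>, so that brackets with \<kk>
  enter the linear algebra. They are controlled by [k,Ja] - J[k,a] \<in> \<kk>, the infinitesimal
  form of the condition on \<open>Ad\<close>.\<close>

text \<open>Each step halves the residual at a cost proportional to it, so the steps are dominated
  by a geometric series and converge to an exact solution. The open mapping theorem uses this with a
  linear \<open>f\<close>, Graves' theorem with a nonlinear one.\<close>

lemma approximate_root_iteration: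
  fixes f :: "'a::banach \<Rightarrow> 'b::real_normed_vector"
  assumes C: "0 \<le> C" and R: "2 * C * norm (y - f a) \<le> R"
    and cont: "continuous_on (cball a R) f"
    and step: "\<And>x. x \<in> cball a R \<Longrightarrow> norm (y - f x) \<le> norm (y - f a) \<Longrightarrow>
      \<exists>x'. norm (x' - x) \<le> C * norm (y - f x) \<and> norm (y - f x') \<le> norm (y - f x) / 2"
  obtains x where "f x = y" "norm (x - a) \<le> 2 * C * norm (y - f a)"
proof -
  define e where "e = norm (y - f a)"
  have e: "0 \<le> e" by (simp add: e_def)
  \<comment> \<open>The bound on \<open>x - a\<close> is the partial sum of C e / 2^i over i < n,
    which stays below 2 C e.\<close>
  define P where "P n x \<longleftrightarrow> norm (x - a) \<le> 2 * C * e * (1 - 1/2^n) \<and> norm (y - f x) \<le> e / 2^n" for n x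
  define S where "S n x x' \<longleftrightarrow> norm (x' - x) \<le> C * e * (1/2)^n" for n and x x' :: 'a
  have P_ball: "x \<in> cball a R" if "P n x" for n x
  proof -
    have "2 * C * e * (1 - 1/2^n) \<le> 2 * C * e * 1"
      by (intro mult_left_mono) (use C e in auto)
    then show ?thesis using that R
      by (auto simp: P_def e_def dist_norm norm_minus_commute)
  qed
  have "\<exists>F. \<forall>n. P n (F n) \<and> S n (F n) (F (Suc n))"
  proof (rule dependent_nat_choice)
    show "\<exists>x. P 0 x" by (intro exI[of _ a]) (simp add: P_def e_def)
  next
    fix x n assume Px: "P n x"
    have le: "norm (y - f x) \<le> e / 2^n" using Px by (simp add: P_def)
    have "e / 2^n \<le> e / 1" by (intro divide_left_mono) (use e in auto)
    with le have "norm (y - f x) \<le> norm (y - f a)" by (simp add: e_def)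
    from step[OF P_ball[OF Px] this] obtain x' where
      x': "norm (x' - x) \<le> C * norm (y - f x)" "norm (y - f x') \<le> norm (y - f x) / 2" by blast
    have S: "norm (x' - x) \<le> C * (e / 2^n)"
      using x'(1) mult_left_mono[OF le C] by linarith
    have "norm (x' - a) \<le> norm (x' - x) + norm (x - a)"
      by (metis norm_triangle_ineq diff_add_cancel add_diff_eq)
    also have "\<dots> \<le> C * (e / 2^n) + 2 * C * e * (1 - 1/2^n)"
      using S Px by (auto simp: P_def)
    also have "\<dots> = 2 * C * e * (1 - 1/2^Suc n)"
      by (simp add: field_simps)
    finally have "P (Suc n) x'" using x'(2) le by (auto simp: P_def)
    then show "\<exists>x'. P (Suc n) x' \<and> S n x x'"
      using S by (auto simp: S_def field_simps)
  qed
  then obtain X where X: "\<And>n. P n (X n)" "\<And>n. S n (X n) (X (Suc n))" by blast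
  have "summable (\<lambda>n. X (Suc n) - X n)"
  proof (rule summable_comparison_test')
    show "summable (\<lambda>n. C * e * (1/2::real)^n)" by (intro summable_mult summable_geometric) auto
    show "norm (X (Suc n) - X n) \<le> C * e * (1/2)^n" for n using X(2)[of n] by (simp add: S_def)
  qed
  then have "(\<lambda>n. \<Sum>i<n. X (Suc i) - X i) \<longlonglongrightarrow> (\<Sum>i. X (Suc i) - X i)"
    by (rule summable_LIMSEQ)
  then have "(\<lambda>n. X n - X 0) \<longlonglongrightarrow> (\<Sum>i. X (Suc i) - X i)"
    by (simp add: sum_lessThan_telescope)
  from tendsto_add[OF this tendsto_const[of "X 0"]] obtain x where lim: "X \<longlonglongrightarrow> x" by auto
  have inR: "X n \<in> cball a R" for n using P_ball X(1) by blast
  then have "x \<in> cball a R" using lim closed_sequentially[OF closed_cball] by blast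
  with lim inR cont have flim: "(\<lambda>n. f (X n)) \<longlonglongrightarrow> f x"
    by (auto simp: continuous_on_sequentially o_def)
  have "(\<lambda>n. e / 2^n) \<longlonglongrightarrow> 0"
    by (rule LIMSEQ_divide_realpow_zero) simp
  then have "(\<lambda>n. y - f (X n)) \<longlonglongrightarrow> 0"
    by (rule Lim_null_comparison[rotated]) (use X(1) in \<open>auto simp: P_def\<close>)
  moreover have "(\<lambda>n. y - f (X n)) \<longlonglongrightarrow> y - f x" by (intro tendsto_intros flim)
  ultimately have "y - f x = 0" by (rule LIMSEQ_unique[rotated])
  moreover have "norm (x - a) \<le> 2 * C * e"
  proof (rule LIMSEQ_le_const2)
    show "(\<lambda>n. norm (X n - a)) \<longlonglongrightarrow> norm (x - a)" by (intro tendsto_intros lim)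
    have "norm (X n - a) \<le> 2 * C * e" for n
    proof -
      have "2 * C * e * (1 - 1/2^n) \<le> 2 * C * e * 1"
        by (intro mult_left_mono) (use C e in auto)
      then show ?thesis using X(1)[of n] by (auto simp: P_def)
    qed
    then show "\<exists>N. \<forall>n\<ge>N. norm (X n - a) \<le> 2 * C * e" by blast
  qed
  ultimately show ?thesis using that[of x] by (simp add: e_def)
qed

text \<open>By Baire's theorem the closure of the image of some ball contains a ball. Differences of
  points of that image then solve \<open>T u = w\<close> up to half the norm of \<open>w\<close>,
  and the iteration above removes the error.\<close>

lemma open_mapping_bound:
  fixes T :: "'a::banach \<Rightarrow> 'b::banach"
  assumes T: "bounded_linear T" and surj: "surj T"
  obtains C where "C > 0" "\<And>w. \<exists>u. T u = w \<and> norm u \<le> C * norm w"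
proof -
  interpret bounded_linear T by fact
  define B where "B n = closure (T ` cball 0 (real n))" for n
  have "\<exists>n. interior (B n) \<noteq> {}"
  proof (rule ccontr)
    assume "\<not> ?thesis"
    then have empty: "interior (B n) = {}" for n by blast
    have "Met_TC.mtopology interior_of \<Union>(range B) = {}"
    proof (rule Met_TC.metric_Baire_category_alt)
      show "Met_TC.mcomplete TYPE('b)" using complete_UNIV by simp
    qed (use empty in \<open>auto simp: B_def\<close>)
    moreover have "\<Union>(range B) = UNIV"
    proof -
      have "w \<in> \<Union>(range B)" for w
      proof -
        obtain u where u: "w = T u" using surj by auto
        obtain n where "norm u \<le> real n" using real_arch_simple by blast
        then have "w \<in> B n" using u closure_subset[of "T ` cball 0 (real n)"] by (auto simp: B_def)
        then show ?thesis by blast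
      qed
      then show ?thesis by blast
    qed
    ultimately show False by simp
  qed
  then obtain n y r where r: "r > 0" and ball: "ball y r \<subseteq> B n"
    by (meson equals0I mem_interior)
  \<comment> \<open>Two vectors of norm at most \<open>n\<close> differ by at most
    \<open>2 n\<close>, and dividing by the scale \<open>s\<close> below gives the factor
    \<open>2 / r\<close> times \<open>norm w\<close>. The added 1 keeps the constant positive when
    \<open>n = 0\<close>.\<close>
  define C0 where "C0 = (2 * real n + 1) * (2 / r)"
  have C0: "C0 > 0" using r by (simp add: C0_def)
  have approx: "\<exists>u. norm u \<le> C0 * norm w \<and> norm (w - T u) \<le> norm w / 2" for w
  proof (cases "w = 0")
    case True then show ?thesis by (intro exI[of _ 0]) (simp add: zero)
  next
    case False
    \<comment> \<open>Scales \<open>w\<close> to length \<open>r / 2\<close>, so that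
      \<open>y\<close> and \<open>y + s w\<close> both lie in the ball. Approximating each within
      \<open>r / 8\<close> gives \<open>s w\<close> up to \<open>r / 4\<close>, which is half of its
      norm.\<close>
    define s where "s = (r / 2) / norm w"
    have s: "s > 0" using False r by (simp add: s_def)
    have "y + s *\<^sub>R w \<in> ball y r" "y \<in> ball y r" using r False by (auto simp: dist_norm s_def)
    then have "y + s *\<^sub>R w \<in> B n" "y \<in> B n" using ball by auto
    moreover have "r / 8 > 0" using r by simp
    ultimately obtain p q where pq: "p \<in> T ` cball 0 (real n)" "dist p (y + s *\<^sub>R w) < r / 8"
      "q \<in> T ` cball 0 (real n)" "dist q y < r / 8"
      unfolding B_def closure_approachable by meson
    then obtain u v where uv: "p = T u" "q = T v" "norm u \<le> n" "norm v \<le> n" by auto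
    define z where "z = (u - v) /\<^sub>R s"
    have "norm z = norm (u - v) / s" using s by (simp add: z_def divide_inverse)
    also have "\<dots> \<le> (2 * real n + 1) / s"
      using uv norm_triangle_ineq4[of u v] s by (intro divide_right_mono) auto
    also have "\<dots> = C0 * norm w" using r False by (simp add: s_def C0_def)
    finally have 1: "norm z \<le> C0 * norm w" .
    have "norm (s *\<^sub>R w - (p - q)) = norm ((y + s *\<^sub>R w - p) - (y - q))" by (simp add: algebra_simps)
    also have "\<dots> \<le> norm (y + s *\<^sub>R w - p) + norm (y - q)" by (rule norm_triangle_ineq4)
    also have "\<dots> \<le> r / 8 + r / 8" using pq by (simp add: dist_norm norm_minus_commute)
    finally have a: "norm (s *\<^sub>R w - (p - q)) \<le> s * norm w / 2" using False r by (simp add: s_def)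
    have "w - T z = (s *\<^sub>R w - (p - q)) /\<^sub>R s"
      using s by (simp add: z_def uv scaleR diff scaleR_diff_right)
    then have "norm (w - T z) = norm (s *\<^sub>R w - (p - q)) / s" using s by (simp add: divide_inverse)
    also have "\<dots> \<le> norm w / 2" using a s by (simp add: field_simps)
    finally show ?thesis using 1 by blast
  qed
  show ?thesis
  proof (rule that)
    show "2 * C0 > 0" using C0 by simp
    fix w
    show "\<exists>u. T u = w \<and> norm u \<le> 2 * C0 * norm w"
    proof (rule approximate_root_iteration[where f = T and y = w and a = 0 and C = C0 and R = "2 * C0 * norm (w - T 0)"])
      show "continuous_on (cball 0 (2 * C0 * norm (w - T 0))) T"
        by (simp add: linear_continuous_on T)
      fix x
      from approx[of "w - T x"] obtain u where
        "norm u \<le> C0 * norm (w - T x)" "norm (w - T x - T u) \<le> norm (w - T x) / 2" by blast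
      then show "\<exists>x'. norm (x' - x) \<le> C0 * norm (w - T x) \<and> norm (w - T x') \<le> norm (w - T x) / 2"
        by (intro exI[of _ "x + u"]) (simp add: add algebra_simps)
    qed (use C0 in \<open>auto simp: zero\<close>)
  qed
qed

lemma surjective_blinfun_lift:
  fixes T :: "'a::banach \<Rightarrow>\<^sub>L 'b::banach"
  assumes "surj (blinfun_apply T)"
  obtains C where "C > 0" "\<And>w. \<exists>u. T u = w \<and> norm u \<le> C * norm w"
  using open_mapping_bound[OF blinfun.bounded_linear_right assms] by blast

text \<open>The right inverse \<open>s\<close> of \<open>T\<close> is norm-controlled but in general
  not linear. As \<open>B\<close> vanishes on the kernel of \<open>T\<close>, \<open>B (s w)\<close>
  is independent of the choice of preimage, and this independence makes it linear in
  \<open>w\<close>.\<close>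

lemma blinfun_factor_surjective:
  fixes T :: "'a::banach \<Rightarrow>\<^sub>L 'b::banach" and B :: "'a \<Rightarrow> 'c::real_normed_vector"
  assumes surj: "surj (blinfun_apply T)" and B: "bounded_linear B"
    and ker: "\<And>u. T u = 0 \<Longrightarrow> B u = 0"
  obtains A :: "'b \<Rightarrow>\<^sub>L 'c" where "\<And>u. A (T u) = B u"
proof -
  interpret B: bounded_linear B by fact
  obtain C where C: "C > 0" "\<And>w. \<exists>u. T u = w \<and> norm u \<le> C * norm w"
    using surjective_blinfun_lift[OF surj] by blast
  from C(2) obtain s where s: "\<And>w. T (s w) = w" "\<And>w. norm (s w) \<le> C * norm w" by metis
  have eq: "B u = B v" if "T u = T v" for u v
    using ker[of "u - v"] that by (simp add: blinfun.diff_right B.diff)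
  have lin: "bounded_linear (\<lambda>w. B (s w))"
  proof (rule bounded_linear_intro)
    show "B (s (w + w')) = B (s w) + B (s w')" for w w'
      by (subst B.add[symmetric], rule eq) (simp add: s blinfun.add_right)
    show "B (s (r *\<^sub>R w)) = r *\<^sub>R B (s w)" for r w
      by (subst B.scaleR[symmetric], rule eq) (simp add: s blinfun.scaleR_right)
    fix w
    have "norm (B (s w)) \<le> onorm B * norm (s w)" by (rule onorm[OF B])
    also have "\<dots> \<le> onorm B * (C * norm w)" by (intro mult_left_mono s onorm_pos_le[OF B])
    finally show "norm (B (s w)) \<le> norm w * (onorm B * C)" by (simp add: mult_ac)
  qed
  show ?thesis
  proof (rule that)
    show "Blinfun (\<lambda>w. B (s w)) (T u) = B u" for u
      unfolding bounded_linear_Blinfun_apply[OF lin] by (rule eq) (rule s)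
  qed
qed

text \<open>The mean value inequality for \<open>f - P x0\<close>, whose derivative is small near
  \<open>x0\<close> by continuity of \<open>P\<close> at that point.\<close>

lemma strict_derivative_bound:
  fixes f :: "'a::real_normed_vector \<Rightarrow> 'b::real_normed_vector"
  assumes "open U" and x0: "x0 \<in> U"
    and f: "\<And>x. x \<in> U \<Longrightarrow> (f has_derivative blinfun_apply (P x)) (at x)"
    and P: "isCont P x0" and e: "e > 0"
  obtains d where "d > 0" "ball x0 d \<subseteq> U"
    "\<And>x y. x \<in> ball x0 d \<Longrightarrow> y \<in> ball x0 d \<Longrightarrow> norm (f y - f x - P x0 (y - x)) \<le> e * norm (y - x)"
proof -
  obtain d1 where d1: "d1 > 0" "ball x0 d1 \<subseteq> U" using assms open_contains_ball by blast
  obtain d2 where d2: "d2 > 0" "\<And>x. dist x x0 < d2 \<Longrightarrow> dist (P x) (P x0) < e"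
    using P e unfolding continuous_at_eps_delta by blast
  define d where "d = min d1 d2"
  have sub: "ball x0 d \<subseteq> U" using d1 by (auto simp: d_def)
  show ?thesis
  proof (rule that)
    show "d > 0" using d1 d2 by (simp add: d_def)
    fix x y assume xy: "x \<in> ball x0 d" "y \<in> ball x0 d"
    have "norm ((f y - P x0 y) - (f x - P x0 x)) \<le> e * norm (y - x)"
    proof (rule differentiable_bound[OF convex_ball _ _ xy(2,1)])
      fix z assume z: "z \<in> ball x0 d"
      have "((\<lambda>x. f x - P x0 x) has_derivative blinfun_apply (P z - P x0)) (at z)"
        by (rule derivative_eq_intros f subsetD[OF sub] z refl | simp add: fun_eq_iff blinfun.diff_left)+
      then show "((\<lambda>x. f x - P x0 x) has_derivative blinfun_apply (P z - P x0)) (at z within ball x0 d)"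
        by (rule has_derivative_at_withinI)
      have "norm (P z - P x0) \<le> e"
        using d2(2)[of z] z by (auto simp: d_def dist_norm norm_minus_commute less_imp_le)
      then show "onorm (blinfun_apply (P z - P x0)) \<le> e" by (simp add: norm_blinfun.rep_eq)
    qed
    then show "norm (f y - f x - P x0 (y - x)) \<le> e * norm (y - x)"
      by (simp add: blinfun.diff_right algebra_simps)
  qed (fact sub)
qed

text \<open>Graves' theorem: the kernel of the derivative need not be complemented.\<close>

lemma Graves_local_surjectivity:
  fixes f :: "'a::banach \<Rightarrow> 'b::banach"
  assumes U: "open U" and x0: "x0 \<in> U"
    and f: "\<And>x. x \<in> U \<Longrightarrow> (f has_derivative blinfun_apply (P x)) (at x)"
    and P: "isCont P x0" and surj: "surj (blinfun_apply (P x0))"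
  obtains C r where "C > 0" "r > 0" "ball x0 r \<subseteq> U"
    "\<And>x y. x \<in> ball x0 r \<Longrightarrow> y \<in> ball (f x0) r \<Longrightarrow> \<exists>x'\<in>U. f x' = y \<and> norm (x' - x) \<le> C * norm (y - f x)"
proof -
  obtain C where C: "C > 0" "\<And>w. \<exists>u. P x0 u = w \<and> norm u \<le> C * norm w"
    using surjective_blinfun_lift[OF surj] by blast
  \<comment> \<open>A correction \<open>u\<close> with \<open>P x0 u\<close> equal to the residual
    has norm at most \<open>C\<close> times the residual. An error of \<open>1 / (2 * C)\<close>
    times \<open>norm u\<close> is thus at most half of the residual.\<close>
  obtain d where d: "d > 0" "ball x0 d \<subseteq> U"
    "\<And>x y. x \<in> ball x0 d \<Longrightarrow> y \<in> ball x0 d \<Longrightarrow> norm (f y - f x - P x0 (y - x)) \<le> 1 / (2 * C) * norm (y - x)"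
    using strict_derivative_bound[OF U x0 f P, of "1 / (2 * C)"] C(1) by auto
  define K where "K = 1 / (2 * C) + norm (P x0) + 1"
  have K: "K > 0" using C(1) by (simp add: K_def add_pos_nonneg)
  \<comment> \<open>The initial residual \<open>e\<close> is at most \<open>(1 + K) * r\<close>, so
    this choice gives \<open>4 * C * e \<le> d / 2\<close>. Iterates stay within
    \<open>2 * C * e\<close> of \<open>x\<close> and a further step adds at most
    \<open>C * e\<close>, so everything remains in \<open>ball x0 d\<close>.\<close>
  define r where "r = min (d / 2) (d / (8 * C * (1 + K)))"
  have r: "r > 0" using d C K by (simp add: r_def)
  have r8: "8 * C * (1 + K) * r \<le> d"
  proof -
    have pos: "8 * C * (1 + K) > 0" using C K by simp
    have "8 * C * (1 + K) * r \<le> 8 * C * (1 + K) * (d / (8 * C * (1 + K)))"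
      using pos by (intro mult_left_mono) (auto simp: r_def)
    also have "\<dots> = d" using C K by simp
    finally show ?thesis .
  qed
  have lip: "norm (f x - f x0) \<le> K * norm (x - x0)" if "x \<in> ball x0 d" for x
  proof -
    have "norm (f x - f x0 - P x0 (x - x0)) \<le> 1 / (2 * C) * norm (x - x0)"
      using d that by auto
    moreover have "norm (P x0 (x - x0)) \<le> norm (P x0) * norm (x - x0)" by (rule norm_blinfun)
    moreover have "norm (f x - f x0) \<le> norm (f x - f x0 - P x0 (x - x0)) + norm (P x0 (x - x0))"
      by (metis norm_triangle_ineq diff_add_cancel)
    ultimately show ?thesis by (simp add: K_def algebra_simps) (use norm_ge_zero[of "x - x0"] in linarith)
  qed
  have rd: "r \<le> d / 2" by (simp add: r_def)
  show ?thesis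
  proof (rule that)
    show "2 * C > 0" "r > 0" using C r by auto
    show "ball x0 r \<subseteq> U" using d rd by (force simp: subset_iff)
    fix x y assume x: "x \<in> ball x0 r" and y: "y \<in> ball (f x0) r"
    have xd: "x \<in> ball x0 d" using x rd d by auto
    define e where "e = norm (y - f x)"
    have "e \<le> norm (y - f x0) + norm (f x - f x0)"
      using norm_triangle_ineq4[of "y - f x0" "f x - f x0"] by (simp add: e_def)
    also have "\<dots> \<le> r + K * r"
    proof -
      have "norm (x - x0) \<le> r" using x by (simp add: dist_norm norm_minus_commute)
      then have "norm (f x - f x0) \<le> K * r"
        using lip[OF xd] K by (meson less_imp_le mult_left_mono order_trans)
      then show ?thesis using y by (simp add: dist_norm norm_minus_commute)
    qed
    finally have e: "e \<le> (1 + K) * r" by (simp add: algebra_simps)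
    have "4 * C * e \<le> 4 * C * ((1 + K) * r)" using e C by (intro mult_left_mono) auto
    also have "\<dots> \<le> d / 2" using r8 by (simp add: algebra_simps)
    finally have Ce: "4 * C * e \<le> d / 2" .
    have Ce0: "0 \<le> C * e" using C by (simp add: e_def)
    have inball: "z \<in> ball x0 d" if "norm (z - x) \<le> 3 * C * e" for z
    proof -
      have "norm (z - x0) \<le> norm (z - x) + norm (x - x0)"
        by (metis norm_triangle_ineq diff_add_cancel add_diff_eq)
      moreover have "norm (x - x0) < d / 2" using x rd by (auto simp: dist_norm norm_minus_commute)
      ultimately show ?thesis using that Ce Ce0 by (auto simp: dist_norm norm_minus_commute)
    qed
    show "\<exists>x'\<in>U. f x' = y \<and> norm (x' - x) \<le> 2 * C * norm (y - f x)"
    proof (rule approximate_root_iteration[where f = f and y = y and a = x and C = C and R = "2 * C * e"])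
      have "z \<in> U" if "z \<in> cball x (2 * C * e)" for z
        using inball[of z] d(2) that Ce0 by (auto simp: dist_norm norm_minus_commute)
      then show "continuous_on (cball x (2 * C * e)) f"
        by (meson continuous_at_imp_continuous_on f has_derivative_continuous)
    next
      fix z assume z: "z \<in> cball x (2 * C * e)" "norm (y - f z) \<le> norm (y - f x)"
      obtain u where u: "P x0 u = y - f z" "norm u \<le> C * norm (y - f z)" using C(2) by blast
      have "norm u \<le> C * e"
        using order_trans[OF u(2) mult_left_mono[OF z(2)]] C by (simp add: e_def)
      moreover have "norm (z - x) \<le> 2 * C * e" using z(1) by (simp add: dist_norm norm_minus_commute)
      moreover have "z + u - x = (z - x) + u" by simp
      ultimately have "norm (z + u - x) \<le> 3 * C * e"
        using norm_triangle_ineq[of "z - x" u] by (simp only:)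
      then have "z + u \<in> ball x0 d" by (rule inball)
      moreover have "z \<in> ball x0 d"
        by (rule inball) (use \<open>norm (z - x) \<le> 2 * C * e\<close> Ce0 in linarith)
      ultimately have "norm (f (z + u) - f z - P x0 (z + u - z)) \<le> 1 / (2 * C) * norm (z + u - z)"
        by (intro d(3))
      then have "norm (y - f (z + u)) \<le> 1 / (2 * C) * norm u"
        by (simp add: u norm_minus_commute)
      also have "\<dots> \<le> 1 / (2 * C) * (C * norm (y - f z))" using u C by (intro mult_left_mono) auto
      finally have "norm (y - f (z + u)) \<le> norm (y - f z) / 2" using C by simp
      then show "\<exists>z'. norm (z' - z) \<le> C * norm (y - f z) \<and> norm (y - f z') \<le> norm (y - f z) / 2"
        using u by (intro exI[of _ "z + u"]) auto
    next
      fix x' assume x': "f x' = y" "norm (x' - x) \<le> 2 * C * norm (y - f x)"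
      then have "x' \<in> U" using inball[of x'] d(2) Ce0 by (auto simp: e_def)
      with x' show ?thesis by auto
    qed (use C in \<open>auto simp: e_def\<close>)
  qed
qed

section \<open>Symmetry of the second derivative at a point\<close>

text \<open>The second difference is the increment over \<open>[0, t]\<close>, in the
  \<open>v\<close> direction, of a first difference in the \<open>u\<close> direction. Its
  derivative is a difference of two values of \<open>P\<close>, which the derivative of
  \<open>P\<close> at the single point \<open>x0\<close> controls.\<close>

lemma second_difference_estimate:
  fixes f :: "'a::real_normed_vector \<Rightarrow> 'b::real_normed_vector"
  assumes "open U" and x0: "x0 \<in> U"
    and f: "\<And>x. x \<in> U \<Longrightarrow> (f has_derivative blinfun_apply (P x)) (at x)"
    and P: "(P has_derivative P') (at x0)" and e: "e > 0"
  obtains d where "d > 0"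
    "\<And>t. 0 < t \<Longrightarrow> t < d \<Longrightarrow>
      norm (f (x0 + t *\<^sub>R u + t *\<^sub>R v) - f (x0 + t *\<^sub>R u) - f (x0 + t *\<^sub>R v) + f x0 - t^2 *\<^sub>R P' u v) \<le> e * t^2"
proof -
  interpret P': bounded_linear P' using P by (rule has_derivative_bounded_linear)
  \<comment> \<open>Chosen such that the final constant \<open>e' * (2 * m * norm v)\<close> is at
    most \<open>e' * N = e\<close>.\<close>
  define N where "N = (norm u + norm v + 1) * 2 * (norm v + 1)"
  have N: "N > 0" unfolding N_def by (intro mult_pos_pos) (auto intro: add_nonneg_pos)
  define e' where "e' = e / N"
  have e': "e' > 0" using e N by (simp add: e'_def)
  obtain d1 where d1: "d1 > 0" "ball x0 d1 \<subseteq> U" using assms open_contains_ball by blast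
  obtain d2 where d2: "d2 > 0"
    "\<And>y. norm (y - x0) < d2 \<Longrightarrow> norm (P y - P x0 - P' (y - x0)) \<le> e' * norm (y - x0)"
    using P e' unfolding has_derivative_at_alt by blast
  define m where "m = norm u + norm v + 1"
  have m: "m > 0" unfolding m_def by (auto intro: add_nonneg_pos)
  define d where "d = min d1 d2 / m"
  show ?thesis
  proof (rule that)
    show "d > 0" using d1 d2 m by (simp add: d_def)
    fix t :: real assume t: "0 < t" "t < d"
    have tm: "t * m < d1" "t * m < d2" using t m by (auto simp: d_def field_simps min_less_iff_conj)
    have near: "norm (s *\<^sub>R u + r *\<^sub>R v) \<le> t * m" if "0 \<le> s" "s \<le> t" "0 \<le> r" "r \<le> t" for s r
    proof -
      have "norm (s *\<^sub>R u + r *\<^sub>R v) \<le> s * norm u + r * norm v"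
        using norm_triangle_ineq[of "s *\<^sub>R u" "r *\<^sub>R v"] that by simp
      also have "\<dots> \<le> t * norm u + t * norm v" using that by (intro add_mono mult_right_mono) auto
      finally show ?thesis using t by (simp add: m_def algebra_simps)
    qed
    have inU: "x0 + s *\<^sub>R u + r *\<^sub>R v \<in> U" if "0 \<le> s" "s \<le> t" "0 \<le> r" "r \<le> t" for s r
      using near[OF that] tm d1(2) by (auto simp: dist_norm subset_iff norm_minus_commute add.assoc)
    have est: "norm (P (x0 + s *\<^sub>R u + r *\<^sub>R v) - P x0 - P' (s *\<^sub>R u + r *\<^sub>R v)) \<le> e' * (t * m)"
      if "0 \<le> s" "s \<le> t" "0 \<le> r" "r \<le> t" for s r
    proof -
      have "norm (P (x0 + s *\<^sub>R u + r *\<^sub>R v) - P x0 - P' (s *\<^sub>R u + r *\<^sub>R v)) \<le> e' * norm (s *\<^sub>R u + r *\<^sub>R v)"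
        using d2(2)[of "x0 + s *\<^sub>R u + r *\<^sub>R v"] near[OF that] tm by (simp add: add.assoc)
      also have "\<dots> \<le> e' * (t * m)" using e' near[OF that] by (intro mult_left_mono) auto
      finally show ?thesis .
    qed
    \<comment> \<open>Subtracting \<open>r P'(t u) v\<close> removes the main term, so
      \<open>g\<close> has a small derivative, and \<open>g t - g 0\<close> is exactly the second
      difference minus \<open>t^2 P' u v\<close>. The summand \<open>0 *\<^sub>R u\<close> lets
      \<open>D\<close> and \<open>est\<close> cover both terms, with \<open>s = t\<close> and
      \<open>s = 0\<close>.\<close>
    define g where "g r = f (x0 + t *\<^sub>R u + r *\<^sub>R v) - f (x0 + 0 *\<^sub>R u + r *\<^sub>R v) - r *\<^sub>R P' (t *\<^sub>R u) v" for r
    have "norm (g t - g 0) \<le> (2 * (e' * (t * m)) * norm v) * norm (t - 0)"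
    proof (rule differentiable_bound[where S = "{0..t}"])
      fix r assume r: "r \<in> {0..t}"
      let ?g' = "\<lambda>s. s *\<^sub>R (P (x0 + t *\<^sub>R u + r *\<^sub>R v) v - P (x0 + 0 *\<^sub>R u + r *\<^sub>R v) v - P' (t *\<^sub>R u) v)"
      have D: "((\<lambda>r. f (x0 + s *\<^sub>R u + r *\<^sub>R v)) has_derivative (\<lambda>h. P (x0 + s *\<^sub>R u + r *\<^sub>R v) (h *\<^sub>R v))) (at r)"
        if "0 \<le> s" "s \<le> t" for s
        by (rule has_derivative_compose[where f = "\<lambda>r. x0 + s *\<^sub>R u + r *\<^sub>R v" and f' = "\<lambda>h. h *\<^sub>R v", OF _ f[OF inU]])
           (use that r in \<open>auto intro!: derivative_eq_intros\<close>)
      have "(g has_derivative (\<lambda>h. P (x0 + t *\<^sub>R u + r *\<^sub>R v) (h *\<^sub>R v)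
          - P (x0 + 0 *\<^sub>R u + r *\<^sub>R v) (h *\<^sub>R v) - h *\<^sub>R P' (t *\<^sub>R u) v)) (at r)"
        unfolding g_def
        by (intro has_derivative_diff D has_derivative_scaleR_left has_derivative_ident) (use t in auto)
      then show "(g has_derivative ?g') (at r within {0..t})"
        by (simp add: blinfun.scaleR_right scaleR_diff_right has_derivative_at_withinI)
      let ?A = "P (x0 + t *\<^sub>R u + r *\<^sub>R v) - P x0 - P' (t *\<^sub>R u + r *\<^sub>R v)"
      let ?B = "P (x0 + 0 *\<^sub>R u + r *\<^sub>R v) - P x0 - P' (0 *\<^sub>R u + r *\<^sub>R v)"
      have "norm (?A - ?B) \<le> norm ?A + norm ?B" by (rule norm_triangle_ineq4)
      also have "\<dots> \<le> 2 * (e' * (t * m))" using est[of t r] est[of 0 r] r t by auto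
      finally have AB: "norm (?A - ?B) \<le> 2 * (e' * (t * m))" .
      have "P (x0 + t *\<^sub>R u + r *\<^sub>R v) v - P (x0 + 0 *\<^sub>R u + r *\<^sub>R v) v - P' (t *\<^sub>R u) v = (?A - ?B) v"
        by (simp add: blinfun.diff_left P'.add P'.zero blinfun.add_left)
      then have "norm (P (x0 + t *\<^sub>R u + r *\<^sub>R v) v - P (x0 + 0 *\<^sub>R u + r *\<^sub>R v) v - P' (t *\<^sub>R u) v) \<le> 2 * (e' * (t * m)) * norm v"
        using norm_blinfun[of "?A - ?B" v] mult_right_mono[OF AB norm_ge_zero[of v]] by simp
      note bound = this
      show "onorm ?g' \<le> 2 * (e' * (t * m)) * norm v"
      proof (rule onorm_bound)
        show "0 \<le> 2 * (e' * (t * m)) * norm v" using e' t m by simp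
        show "norm (?g' s) \<le> 2 * (e' * (t * m)) * norm v * norm s" for s
          using mult_left_mono[OF bound, of "\<bar>s\<bar>"] by (simp add: mult_ac)
      qed
    qed (use t in auto)
    also have "\<dots> = e' * (2 * m * norm v) * t^2" using t by (simp add: power2_eq_square)
    also have "\<dots> \<le> e * t^2"
    proof (rule mult_right_mono)
      have "e' * (2 * m * norm v) \<le> e' * N" using e' m unfolding N_def m_def
        by (intro mult_left_mono) (auto simp: algebra_simps)
      also have "\<dots> = e" using N by (simp add: e'_def)
      finally show "e' * (2 * m * norm v) \<le> e" .
    qed simp
    finally show "norm (f (x0 + t *\<^sub>R u + t *\<^sub>R v) - f (x0 + t *\<^sub>R u) - f (x0 + t *\<^sub>R v) + f x0 - t^2 *\<^sub>R P' u v) \<le> e * t^2"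
      by (simp add: g_def P'.scaleR blinfun.scaleR_left power2_eq_square algebra_simps)
  qed
qed

text \<open>The second difference is symmetric in \<open>u\<close> and \<open>v\<close>, and both
  sides are its limit after division by \<open>t^2\<close>.\<close>

lemma symmetric_second_derivative:
  fixes f :: "'a::real_normed_vector \<Rightarrow> 'b::real_normed_vector"
  assumes "open U" "x0 \<in> U"
    and "\<And>x. x \<in> U \<Longrightarrow> (f has_derivative blinfun_apply (P x)) (at x)"
    and "(P has_derivative P') (at x0)"
  shows "blinfun_apply (P' u) v = blinfun_apply (P' v) u"
proof -
  have "norm (P' u v - P' v u) \<le> 2 * e" if e: "e > 0" for e
  proof -
    obtain d1 where d1: "d1 > 0" "\<And>t. 0 < t \<Longrightarrow> t < d1 \<Longrightarrow>
      norm (f (x0 + t *\<^sub>R u + t *\<^sub>R v) - f (x0 + t *\<^sub>R u) - f (x0 + t *\<^sub>R v) + f x0 - t^2 *\<^sub>R P' u v) \<le> e * t^2"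
      using second_difference_estimate[OF assms e] by blast
    obtain d2 where d2: "d2 > 0" "\<And>t. 0 < t \<Longrightarrow> t < d2 \<Longrightarrow>
      norm (f (x0 + t *\<^sub>R v + t *\<^sub>R u) - f (x0 + t *\<^sub>R v) - f (x0 + t *\<^sub>R u) + f x0 - t^2 *\<^sub>R P' v u) \<le> e * t^2"
      using second_difference_estimate[OF assms e] by blast
    define t where "t = min d1 d2 / 2"
    have t: "0 < t" "t < d1" "t < d2" using d1(1) d2(1) by (auto simp: t_def min_def)
    let ?D = "f (x0 + t *\<^sub>R u + t *\<^sub>R v) - f (x0 + t *\<^sub>R u) - f (x0 + t *\<^sub>R v) + f x0"
    have "norm (?D - t^2 *\<^sub>R P' v u) \<le> e * t^2"
      using d2(2)[OF t(1,3)] by (simp add: algebra_simps)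
    from order_trans[OF norm_triangle_ineq4 add_mono[OF this d1(2)[OF t(1,2)]]]
    have "norm ((?D - t^2 *\<^sub>R P' v u) - (?D - t^2 *\<^sub>R P' u v)) \<le> e * t^2 + e * t^2" .
    then have "norm (t^2 *\<^sub>R (P' u v - P' v u)) \<le> 2 * e * t^2" by (simp add: algebra_simps)
    then show ?thesis using t by simp
  qed
  note bound = this
  have "norm (P' u v - P' v u) \<le> 0"
  proof (rule field_le_epsilon)
    fix e :: real assume "e > 0"
    then show "norm (P' u v - P' v u) \<le> 0 + e" using bound[of "e / 2"] by simp
  qed
  then show ?thesis by simp
qed

section \<open>Families with locally uniform bounds on derivatives\<close>

text \<open>
  \<open>equi_diff n U F\<close> says that the members of \<open>F\<close> are \<open>n\<close> times differentiable with locally uniform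
  bounds.  Passing from \<open>F\<close> to the family of its derivatives in unit directions keeps the type of the
  functions, which allows inductions over the order of differentiability that the types of the higher
  derivatives would otherwise prevent.
\<close>

abbreviation dir_deriv :: "('a::real_normed_vector \<Rightarrow> 'b::real_normed_vector) \<Rightarrow> 'a \<Rightarrow> 'a \<Rightarrow> 'b" where
  "dir_deriv f d x \<equiv> frechet_derivative f (at x) d"

definition locally_equibounded ::
  "'a::real_normed_vector set \<Rightarrow> ('a \<Rightarrow> 'b::real_normed_vector) set \<Rightarrow> bool" where
  "locally_equibounded U F \<longleftrightarrow> (\<forall>x\<in>U. \<exists>r>0. \<exists>C. \<forall>y\<in>ball x r \<inter> U. \<forall>f\<in>F. norm (f y) \<le> C)"

definition unit_derivs ::
  "('a::real_normed_vector \<Rightarrow> 'b::real_normed_vector) set \<Rightarrow> ('a \<Rightarrow> 'b) set" where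
  "unit_derivs F = {dir_deriv f d | f d. f \<in> F \<and> norm d \<le> 1}"

primrec equi_diff ::
  "nat \<Rightarrow> 'a::real_normed_vector set \<Rightarrow> ('a \<Rightarrow> 'b::real_normed_vector) set \<Rightarrow> bool" where
  "equi_diff 0 U F \<longleftrightarrow> locally_equibounded U F"
| "equi_diff (Suc n) U F \<longleftrightarrow> locally_equibounded U F \<and>
     (\<forall>f\<in>F. \<forall>x\<in>U. f differentiable (at x)) \<and> equi_diff n U (unit_derivs F)"

text \<open>Sums and products of whole families. Leibniz' rule places the unit-direction derivatives
  of a product family in a sum of two product families, so the inductions over the order remain
  within such sets.\<close>

definition pointwise2 :: "('a \<Rightarrow> 'b \<Rightarrow> 'c) \<Rightarrow> ('x \<Rightarrow> 'a) set \<Rightarrow> ('x \<Rightarrow> 'b) set \<Rightarrow> ('x \<Rightarrow> 'c) set" where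
  "pointwise2 p F G = {\<lambda>x. p (f x) (g x) | f g. f \<in> F \<and> g \<in> G}"

lemma pointwise2I: "f \<in> F \<Longrightarrow> g \<in> G \<Longrightarrow> (\<lambda>x. p (f x) (g x)) \<in> pointwise2 p F G"
  by (auto simp: pointwise2_def)

lemma pointwise2E:
  assumes "h \<in> pointwise2 p F G"
  obtains f g where "h = (\<lambda>x. p (f x) (g x))" "f \<in> F" "g \<in> G"
  using assms by (auto simp: pointwise2_def)

lemma unit_derivsI: "f \<in> F \<Longrightarrow> norm d \<le> 1 \<Longrightarrow> dir_deriv f d \<in> unit_derivs F"
  by (auto simp: unit_derivs_def)

lemma unit_derivsE:
  assumes "h \<in> unit_derivs F"
  obtains f d where "h = dir_deriv f d" "f \<in> F" "norm d \<le> 1"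
  using assms by (auto simp: unit_derivs_def)

lemma has_derivative_dir_deriv:
  "f differentiable (at x) \<Longrightarrow> (f has_derivative (\<lambda>d. dir_deriv f d x)) (at x)"
  using frechet_derivative_works by metis

lemma dir_deriv_eq: "(f has_derivative f') (at x) \<Longrightarrow> dir_deriv f d x = f' d"
  using frechet_derivative_at by metis

lemma dir_deriv_cong:
  assumes "f differentiable (at x)" "open U" "x \<in> U" "\<And>y. y \<in> U \<Longrightarrow> f y = g y"
  shows "dir_deriv g d x = dir_deriv f d x" "g differentiable (at x)"
proof -
  have "(g has_derivative (\<lambda>d. dir_deriv f d x)) (at x)"
    by (rule has_derivative_transform_within_open[OF has_derivative_dir_deriv]) (use assms in auto)
  then show "dir_deriv g d x = dir_deriv f d x" "g differentiable (at x)"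
    by (auto simp: dir_deriv_eq differentiable_def)
qed

lemma equi_diff_locally_equibounded: "equi_diff n U F \<Longrightarrow> locally_equibounded U F"
  by (cases n) auto

lemma locally_equibounded_mono:
  assumes G: "locally_equibounded U G" and FG: "\<And>f. f \<in> F \<Longrightarrow> \<exists>g\<in>G. \<forall>x\<in>U. f x = g x"
    and V: "V \<subseteq> U"
  shows "locally_equibounded V F"
  unfolding locally_equibounded_def
proof
  fix x assume "x \<in> V"
  then obtain r C where r: "r > 0" "\<forall>y\<in>ball x r \<inter> U. \<forall>f\<in>G. norm (f y) \<le> C"
    using G V unfolding locally_equibounded_def by blast
  have "norm (f y) \<le> C" if "y \<in> ball x r \<inter> V" "f \<in> F" for f y
  proof -
    obtain g where "g \<in> G" "\<forall>x\<in>U. f x = g x" using FG \<open>f \<in> F\<close> by blast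
    then show ?thesis using r(2) V \<open>y \<in> ball x r \<inter> V\<close> by auto
  qed
  then show "\<exists>r>0. \<exists>C. \<forall>y\<in>ball x r \<inter> V. \<forall>f\<in>F. norm (f y) \<le> C" using r(1) by blast
qed

text \<open>Agreement on \<open>U\<close> passes to derivatives because \<open>U\<close> is open.
  This lets a family of derivatives be replaced by explicit formulas that are valid on
  \<open>U\<close> alone.\<close>

lemma equi_diff_mono:
  assumes "equi_diff n U G" "open U" "\<And>f. f \<in> F \<Longrightarrow> \<exists>g\<in>G. \<forall>x\<in>U. f x = g x"
  shows "equi_diff n U F"
  using assms(1,3)
proof (induction n arbitrary: F G)
  case 0
  then show ?case using locally_equibounded_mono[of U G F U] by simp
next
  case (Suc n)
  have G: "\<And>g x. g \<in> G \<Longrightarrow> x \<in> U \<Longrightarrow> g differentiable (at x)" using Suc.prems by auto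
  have "f differentiable (at x)" if f: "f \<in> F" and x: "x \<in> U" for f x
  proof -
    obtain g where g: "g \<in> G" "\<forall>x\<in>U. f x = g x" using Suc.prems(2)[OF f] by blast
    show ?thesis by (rule dir_deriv_cong(2)[OF G[OF g(1) x] assms(2) x]) (use g in simp)
  qed
  moreover have "equi_diff n U (unit_derivs F)"
  proof (rule Suc.IH)
    show "equi_diff n U (unit_derivs G)" using Suc.prems by simp
    fix f' assume "f' \<in> unit_derivs F"
    then obtain f d where f: "f' = dir_deriv f d" "f \<in> F" "norm d \<le> 1" by (auto simp: unit_derivs_def)
    obtain g where g: "g \<in> G" "\<forall>x\<in>U. f x = g x" using Suc.prems(2)[OF f(2)] by blast
    have "dir_deriv f d x = dir_deriv g d x" if x: "x \<in> U" for x
      by (rule dir_deriv_cong(1)[OF G[OF g(1) x] assms(2) x]) (use g in simp)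
    then show "\<exists>g'\<in>unit_derivs G. \<forall>x\<in>U. f' x = g' x" using f g by (auto simp: unit_derivs_def)
  qed
  moreover have "locally_equibounded U F"
    by (rule locally_equibounded_mono[of U G]) (use Suc.prems in auto)
  ultimately show ?case by simp
qed

lemma equi_diff_subset: "equi_diff n U G \<Longrightarrow> open U \<Longrightarrow> F \<subseteq> G \<Longrightarrow> equi_diff n U F"
  by (rule equi_diff_mono) auto

lemma equi_diff_Suc_imp: "equi_diff (Suc n) U F \<Longrightarrow> equi_diff n U F"
  by (induction n arbitrary: F) auto

lemma equi_diff_le: "equi_diff n U F \<Longrightarrow> m \<le> n \<Longrightarrow> equi_diff m U F"
  by (induction n) (auto simp: le_Suc_eq dest: equi_diff_Suc_imp simp del: equi_diff.simps)

lemma locally_equibounded_local: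
  assumes "\<And>x. x \<in> U \<Longrightarrow> \<exists>V. open V \<and> x \<in> V \<and> locally_equibounded V F"
  shows "locally_equibounded U F"
  unfolding locally_equibounded_def
proof
  fix x assume "x \<in> U"
  then obtain V where V: "open V" "x \<in> V" "locally_equibounded V F" using assms by blast
  then obtain r C where r: "r > 0" "\<forall>y\<in>ball x r \<inter> V. \<forall>f\<in>F. norm (f y) \<le> C"
    unfolding locally_equibounded_def by blast
  obtain r' where r': "r' > 0" "ball x r' \<subseteq> V" using V open_contains_ball by blast
  show "\<exists>r>0. \<exists>C. \<forall>y\<in>ball x r \<inter> U. \<forall>f\<in>F. norm (f y) \<le> C"
    by (rule exI[of _ "min r r'"]) (use r r' in \<open>auto intro!: exI[of _ C] simp: subset_iff\<close>)
qed

lemma equi_diff_local: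
  assumes "\<And>x. x \<in> U \<Longrightarrow> \<exists>V. open V \<and> x \<in> V \<and> equi_diff n V F"
  shows "equi_diff n U F"
  using assms
proof (induction n arbitrary: F)
  case 0 then show ?case using locally_equibounded_local by auto
next
  case (Suc n)
  have "locally_equibounded U F" by (rule locally_equibounded_local) (use Suc.prems in force)
  moreover have "equi_diff n U (unit_derivs F)" by (rule Suc.IH) (use Suc.prems in force)
  moreover have "\<forall>f\<in>F. \<forall>x\<in>U. f differentiable (at x)" using Suc.prems by force
  ultimately show ?case by simp
qed

lemma equi_diff_subdomain:
  assumes "equi_diff n U F" "V \<subseteq> U" shows "equi_diff n V F"
  using assms(1)
proof (induction n arbitrary: F)
  case 0 then show ?case using locally_equibounded_mono[OF _ _ assms(2), of F F] by auto
next
  case (Suc n)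
  then have "locally_equibounded V F" using locally_equibounded_mono[OF _ _ assms(2), of F F] by auto
  with Suc show ?case using assms(2) by auto
qed

lemma locally_equiboundedE:
  assumes "locally_equibounded U F" "open U" "x \<in> U"
  obtains r C where "r > 0" "C \<ge> 0" "ball x r \<subseteq> U" "\<And>f y. f \<in> F \<Longrightarrow> y \<in> ball x r \<Longrightarrow> norm (f y) \<le> C"
proof -
  obtain r C where r: "r > 0" "\<forall>y\<in>ball x r \<inter> U. \<forall>f\<in>F. norm (f y) \<le> C"
    using assms unfolding locally_equibounded_def by blast
  obtain r' where r': "r' > 0" "ball x r' \<subseteq> U" using assms open_contains_ball by blast
  show ?thesis
    by (rule that[of "min r r'" "max C 0"]) (use r r' in \<open>auto simp: subset_iff le_max_iff_disj\<close>)
qed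

lemma equi_diff_zero: "equi_diff n U {\<lambda>x. 0}"
proof (induction n)
  case 0 show ?case by (auto simp: locally_equibounded_def intro!: exI[of _ 1])
next
  case (Suc n)
  have "unit_derivs {\<lambda>x. 0} = {\<lambda>x::'a. 0::'b}"
    by (auto simp: unit_derivs_def intro!: exI[of _ 0])
  with Suc show ?case by (auto simp: locally_equibounded_def intro!: exI[of _ 1])
qed

lemma equi_diff_const:
  assumes "open U" shows "equi_diff n U {\<lambda>x. c | c. norm c \<le> B}"
proof -
  have leb: "locally_equibounded U {\<lambda>x. c | c. norm c \<le> B}"
    unfolding locally_equibounded_def
  proof
    fix x assume "x \<in> U"
    show "\<exists>r>0. \<exists>C. \<forall>y\<in>ball x r \<inter> U. \<forall>f\<in>{\<lambda>x. c | c. norm c \<le> B}. norm (f y) \<le> C"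
      by (rule exI[of _ 1]) (auto intro!: exI[of _ B])
  qed
  show ?thesis
  proof (cases n)
    case (Suc m)
    have "equi_diff m U (unit_derivs {\<lambda>x::'a. c::'b | c. norm c \<le> B})"
      by (rule equi_diff_mono[OF equi_diff_zero assms]) (auto simp: unit_derivs_def)
    with Suc leb show ?thesis by auto
  qed (use leb in simp)
qed

text \<open>The induction step shared by sums and bilinear products: \<open>H\<close> is the family
  in which the rule of differentiation places the derivatives.\<close>

lemma equi_diff_pointwise2I:
  assumes "open U"
    and leb: "locally_equibounded U (pointwise2 p F G)"
    and D: "\<And>f g x. f \<in> F \<Longrightarrow> g \<in> G \<Longrightarrow> x \<in> U \<Longrightarrow>
      ((\<lambda>x. p (f x) (g x)) has_derivative D f g x) (at x)"
    and H: "equi_diff n U H"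
    and DH: "\<And>f g d. f \<in> F \<Longrightarrow> g \<in> G \<Longrightarrow> norm d \<le> 1 \<Longrightarrow> (\<lambda>x. D f g x d) \<in> H"
  shows "equi_diff (Suc n) U (pointwise2 p F G)"
proof -
  have "equi_diff n U (unit_derivs (pointwise2 p F G))"
  proof (rule equi_diff_mono[OF H \<open>open U\<close>])
    fix h assume "h \<in> unit_derivs (pointwise2 p F G)"
    then obtain k d where k: "h = dir_deriv k d" "k \<in> pointwise2 p F G" "norm d \<le> 1"
      by (rule unit_derivsE)
    from k(2) obtain f g where fg: "k = (\<lambda>x. p (f x) (g x))" "f \<in> F" "g \<in> G" by (rule pointwise2E)
    have "\<forall>x\<in>U. h x = D f g x d" using dir_deriv_eq[OF D[OF fg(2,3)]] k fg by simp
    with DH[OF fg(2,3) k(3)] show "\<exists>g\<in>H. \<forall>x\<in>U. h x = g x"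
      by (intro bexI[of _ "\<lambda>x. D f g x d"]) auto
  qed
  moreover have "f differentiable (at x)" if f: "f \<in> pointwise2 p F G" and x: "x \<in> U" for f x
    using f D x by (elim pointwise2E) (auto simp: differentiable_def)
  ultimately show ?thesis using leb by simp
qed

lemma equi_diff_add:
  assumes "open U" "equi_diff n U F" "equi_diff n U G"
  shows "equi_diff n U (pointwise2 (+) F G)"
  using assms(2,3)
proof (induction n arbitrary: F G)
  have leb: "locally_equibounded U (pointwise2 (+) F G)"
    if F: "locally_equibounded U F" and G: "locally_equibounded U G" for F G :: "('a \<Rightarrow> 'b) set"
    unfolding locally_equibounded_def
  proof
    fix x assume x: "x \<in> U"
    obtain r C where r: "r > 0" "\<And>f y. f \<in> F \<Longrightarrow> y \<in> ball x r \<Longrightarrow> norm (f y) \<le> C"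
      using locally_equiboundedE[OF F assms(1) x] by metis
    obtain r' C' where r': "r' > 0" "\<And>f y. f \<in> G \<Longrightarrow> y \<in> ball x r' \<Longrightarrow> norm (f y) \<le> C'"
      using locally_equiboundedE[OF G assms(1) x] by metis
    show "\<exists>r>0. \<exists>C. \<forall>y\<in>ball x r \<inter> U. \<forall>h\<in>pointwise2 (+) F G. norm (h y) \<le> C"
      by (rule exI[of _ "min r r'"])
         (use r r' in \<open>auto intro!: exI[of _ "C + C'"] norm_triangle_le add_mono elim!: pointwise2E\<close>)
  qed
  {
    case 0
    then show ?case using leb by simp
  next
    case (Suc n)
    have F: "\<And>f x. f \<in> F \<Longrightarrow> x \<in> U \<Longrightarrow> f differentiable (at x)"
      and G: "\<And>f x. f \<in> G \<Longrightarrow> x \<in> U \<Longrightarrow> f differentiable (at x)" using Suc.prems by auto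
    show ?case
    proof (rule equi_diff_pointwise2I[OF assms(1)])
      show "locally_equibounded U (pointwise2 (+) F G)" using leb Suc.prems by simp
      show "((\<lambda>x. f x + g x) has_derivative (\<lambda>d. dir_deriv f d x + dir_deriv g d x)) (at x)"
        if "f \<in> F" "g \<in> G" "x \<in> U" for f g x
        by (intro has_derivative_add has_derivative_dir_deriv F G that)
      show "equi_diff n U (pointwise2 (+) (unit_derivs F) (unit_derivs G))"
        by (rule Suc.IH) (use Suc.prems in auto)
    qed (intro pointwise2I unit_derivsI)
  }
qed

lemma (in bounded_bilinear) equi_diff_prod:
  assumes "open U" "equi_diff n U F" "equi_diff n U G"
  shows "equi_diff n U (pointwise2 prod F G)"
  using assms(2,3)
proof (induction n arbitrary: F G)
  obtain K where K: "K > 0" "\<And>a b. norm (prod a b) \<le> norm a * norm b * K" using pos_bounded by blast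
  have leb: "locally_equibounded U (pointwise2 prod F G)"
    if F: "locally_equibounded U F" and G: "locally_equibounded U G"
    for F :: "('d::real_normed_vector \<Rightarrow> 'a) set" and G :: "('d \<Rightarrow> 'b) set" and U
    unfolding locally_equibounded_def
  proof
    fix x assume x: "x \<in> U"
    obtain r C where r: "r > 0" "\<forall>y\<in>ball x r \<inter> U. \<forall>f\<in>F. norm (f y) \<le> C"
      using F x unfolding locally_equibounded_def by blast
    obtain r' C' where r': "r' > 0" "\<forall>y\<in>ball x r' \<inter> U. \<forall>f\<in>G. norm (f y) \<le> C'"
      using G x unfolding locally_equibounded_def by blast
    have "norm (prod (f y) (g y)) \<le> C * C' * K"
      if "y \<in> ball x (min r r') \<inter> U" "f \<in> F" "g \<in> G" for f g y
    proof -
      have "norm (f y) \<le> C" "norm (g y) \<le> C'" using r r' that by auto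
      then have "norm (f y) * norm (g y) * K \<le> C * C' * K"
        using K(1) by (intro mult_right_mono mult_mono) (auto intro: order_trans[OF norm_ge_zero])
      then show ?thesis using K(2) order_trans by blast
    qed
    then show "\<exists>r>0. \<exists>C. \<forall>y\<in>ball x r \<inter> U. \<forall>h\<in>pointwise2 prod F G. norm (h y) \<le> C"
      using r(1) r'(1)
      by (intro exI[of _ "min r r'"] conjI exI[of _ "C * C' * K"]) (auto elim!: pointwise2E)
  qed
  {
    case 0
    then show ?case using leb by simp
  next
    case (Suc n)
    have F: "\<And>f x. f \<in> F \<Longrightarrow> x \<in> U \<Longrightarrow> f differentiable (at x)"
      and G: "\<And>f x. f \<in> G \<Longrightarrow> x \<in> U \<Longrightarrow> f differentiable (at x)" using Suc.prems by auto
    have 1: "equi_diff n U (pointwise2 prod F (unit_derivs G))"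
      and 2: "equi_diff n U (pointwise2 prod (unit_derivs F) G)"
      by (rule Suc.IH; use Suc.prems equi_diff_Suc_imp in force)+
    show ?case
    proof (rule equi_diff_pointwise2I[OF assms(1) _ _ equi_diff_add[OF assms(1) 1 2]])
      show "locally_equibounded U (pointwise2 prod F G)" using leb Suc.prems by simp
      show "((\<lambda>x. prod (f x) (g x)) has_derivative
          (\<lambda>d. prod (f x) (dir_deriv g d x) + prod (dir_deriv f d x) (g x))) (at x)"
        if "f \<in> F" "g \<in> G" "x \<in> U" for f g x
        by (intro FDERIV has_derivative_dir_deriv F G that)
    qed (intro pointwise2I[of _ _ _ _ "(+)"] pointwise2I[of _ _ _ _ prod] unit_derivsI)
  }
qed

lemma norm_scaleR_sgn: "norm x *\<^sub>R sgn x = (x :: 'a::real_normed_vector)"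
  by (cases "x = 0") (simp_all add: sgn_div_norm)

lemma linear_unit_bound:
  assumes "linear g" "\<And>d. norm d \<le> 1 \<Longrightarrow> norm (g d) \<le> C"
  shows "norm (g h) \<le> C * norm h"
proof -
  have "g h = norm h *\<^sub>R g (sgn h)"
    by (simp add: linear_scale[OF assms(1), symmetric] norm_scaleR_sgn)
  moreover have "norm (g (sgn h)) \<le> C" by (rule assms(2)) (simp add: norm_sgn)
  ultimately show ?thesis
    using mult_left_mono[of "norm (g (sgn h))" C "norm h"] by (simp add: mult.commute[of C])
qed

lemma linear_dir_deriv: "f differentiable (at x) \<Longrightarrow> linear (\<lambda>d. dir_deriv f d x)"
  by (rule has_derivative_linear[OF has_derivative_dir_deriv])

lemma dir_deriv_scaled_sgn:
  assumes "f differentiable (at x)"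
  shows "dir_deriv f d x = norm d *\<^sub>R dir_deriv f (sgn d) x"
  by (simp add: linear_scale[OF linear_dir_deriv[OF assms], symmetric] norm_scaleR_sgn)

lemma has_derivative_quadratic:
  assumes "bounded_linear f'" "r > 0"
    and q: "\<And>y. y \<in> ball x r \<Longrightarrow> norm (f y - f x - f' (y - x)) \<le> C * (norm (y - x))\<^sup>2"
  shows "(f has_derivative f') (at x)"
  unfolding has_derivative_at_alt
proof (intro conjI allI impI)
  fix e :: real assume e: "e > 0"
  define d where "d = min r (e / (\<bar>C\<bar> + 1))"
  have "norm (f y - f x - f' (y - x)) \<le> e * norm (y - x)" if "norm (y - x) < d" for y
  proof -
    have "norm (f y - f x - f' (y - x)) \<le> C * (norm (y - x))\<^sup>2"
      by (rule q) (use that in \<open>simp add: d_def dist_norm norm_minus_commute\<close>)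
    also have "\<dots> \<le> (\<bar>C\<bar> + 1) * (norm (y - x))\<^sup>2" by (intro mult_right_mono) auto
    also have "\<dots> = ((\<bar>C\<bar> + 1) * norm (y - x)) * norm (y - x)" by (simp add: power2_eq_square)
    also have "(\<bar>C\<bar> + 1) * norm (y - x) \<le> e"
      using that by (simp add: d_def pos_less_divide_eq mult.commute less_imp_le)
    finally show ?thesis by (simp add: mult_right_mono)
  qed
  moreover have "d > 0" using e assms(2) by (simp add: d_def)
  ultimately show "\<exists>d>0. \<forall>y. norm (y - x) < d \<longrightarrow> norm (f y - f x - f' (y - x)) \<le> e * norm (y - x)" by blast
qed (fact assms)

text \<open>A derivative in direction \<open>d\<close> is \<open>norm d\<close> times the one in
  direction \<open>sgn d\<close>, hence a product of a bounded constant and a member of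
  \<open>unit_derivs F\<close>.\<close>

lemma equi_diff_scaled_derivs:
  assumes "open U" "equi_diff (Suc n) U F"
  shows "equi_diff n U {dir_deriv f d | f d. f \<in> F \<and> norm d \<le> B}"
proof (rule equi_diff_mono[OF _ assms(1)])
  let ?H = "pointwise2 (*\<^sub>R) {\<lambda>x. c | c. norm c \<le> B} (unit_derivs F)"
  show "equi_diff n U ?H"
    by (rule bounded_bilinear.equi_diff_prod[OF bounded_bilinear_scaleR assms(1) equi_diff_const[OF assms(1)]])
       (use assms in simp)
  fix h assume "h \<in> {dir_deriv f d | f d. f \<in> F \<and> norm d \<le> B}"
  then obtain f d where h: "h = dir_deriv f d" "f \<in> F" "norm d \<le> B" by blast
  have "\<forall>x\<in>U. h x = norm d *\<^sub>R dir_deriv f (sgn d) x"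
    using h assms by (auto intro: dir_deriv_scaled_sgn)
  moreover have "(\<lambda>x. norm d *\<^sub>R dir_deriv f (sgn d) x) \<in> ?H"
    by (intro pointwise2I unit_derivsI) (use h in \<open>auto simp: norm_sgn\<close>)
  ultimately show "\<exists>g\<in>?H. \<forall>x\<in>U. h x = g x" by (intro bexI[of _ "\<lambda>x. norm d *\<^sub>R dir_deriv f (sgn d) x"])
qed

lemma equi_diff_dir_deriv:
  assumes "open U" "equi_diff (Suc n) U {f}"
  shows "equi_diff n U {dir_deriv f d}"
  by (rule equi_diff_subset[OF equi_diff_scaled_derivs[OF assms, of "norm d"] assms(1)]) auto

text \<open>Serves to restrict the multiplication of the group to slices such as x \<mapsto> (x, e).
  Since \<open>T\<close> may stretch unit directions up to its norm, the induction passes through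
  \<open>equi_diff_scaled_derivs\<close>.\<close>

lemma equi_diff_affine:
  fixes F :: "('b::real_normed_vector \<Rightarrow> 'c::real_normed_vector) set" and T :: "'a::real_normed_vector \<Rightarrow> 'b"
  assumes "open U" "bounded_linear T" "open V" "\<And>x. x \<in> V \<Longrightarrow> a + T x \<in> U" "equi_diff n U F"
  shows "equi_diff n V ((\<lambda>f x. f (a + T x)) ` F)"
  using assms(5)
proof (induction n arbitrary: F)
  interpret T: bounded_linear T by fact
  obtain K where K: "K > 0" "\<And>x. norm (T x) \<le> norm x * K" using T.pos_bounded by blast
  have leb: "locally_equibounded V ((\<lambda>f x. f (a + T x)) ` F)"
    if F: "locally_equibounded U F" for F :: "('b \<Rightarrow> 'c) set"
    unfolding locally_equibounded_def
  proof
    fix x assume "x \<in> V"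
    then obtain r C where r: "r > 0" "\<And>f y. f \<in> F \<Longrightarrow> y \<in> ball (a + T x) r \<Longrightarrow> norm (f y) \<le> C"
      using locally_equiboundedE[OF F assms(1) assms(4)] by metis
    have "a + T y \<in> ball (a + T x) r" if "y \<in> ball x (r / K)" for y
    proof -
      have "norm (T (x - y)) \<le> norm (x - y) * K" by (rule K)
      also have "\<dots> < r" using that K(1) by (simp add: dist_norm pos_less_divide_eq)
      finally show ?thesis by (simp add: dist_norm T.diff)
    qed
    with r show "\<exists>r>0. \<exists>C. \<forall>y\<in>ball x r \<inter> V. \<forall>f\<in>(\<lambda>f x. f (a + T x)) ` F. norm (f y) \<le> C"
      using K(1) by (intro exI[of _ "r / K"] conjI exI[of _ C]) auto
  qed
  {
    case 0
    then show ?case using leb by simp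
  next
    case (Suc n)
    have D: "((\<lambda>x. f (a + T x)) has_derivative (\<lambda>d. dir_deriv f (T d) (a + T x))) (at x)"
      if "f \<in> F" "x \<in> V" for f x
    proof -
      have "f differentiable (at (a + T x))" using Suc.prems that assms(4) by simp
      then have "(f has_derivative (\<lambda>d. dir_deriv f d (a + T x))) (at (a + T x))"
        by (rule has_derivative_dir_deriv)
      moreover have "((\<lambda>x. a + T x) has_derivative T) (at x)"
        using has_derivative_add[OF has_derivative_const[of a] T.has_derivative[OF has_derivative_ident]] by simp
      ultimately show ?thesis by (rule has_derivative_compose[rotated])
    qed
    have "equi_diff n V (unit_derivs ((\<lambda>f x. f (a + T x)) ` F))"
    proof (rule equi_diff_mono[OF Suc.IH assms(3)])
      show "equi_diff n U {dir_deriv f d | f d. f \<in> F \<and> norm d \<le> K}"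
        by (rule equi_diff_scaled_derivs[OF assms(1) Suc.prems])
      fix h assume "h \<in> unit_derivs ((\<lambda>f x. f (a + T x)) ` F)"
      then obtain f d where h: "h = dir_deriv (\<lambda>x. f (a + T x)) d" "f \<in> F" "norm d \<le> 1"
        by (auto simp: unit_derivs_def)
      have "norm (T d) \<le> K" using order_trans[OF K(2)[of d] mult_right_mono[OF h(3), of K]] K(1) by simp
      then have "(\<lambda>x. dir_deriv f (T d) (a + T x)) \<in>
          (\<lambda>f x. f (a + T x)) ` {dir_deriv f d | f d. f \<in> F \<and> norm d \<le> K}"
        using h by (intro image_eqI[where x = "dir_deriv f (T d)"]) auto
      moreover have "\<forall>x\<in>V. h x = dir_deriv f (T d) (a + T x)" using D h dir_deriv_eq by blast
      ultimately show "\<exists>g\<in>(\<lambda>f x. f (a + T x)) ` {dir_deriv f d | f d. f \<in> F \<and> norm d \<le> K}. \<forall>x\<in>V. h x = g x"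
        by (intro bexI[of _ "\<lambda>x. dir_deriv f (T d) (a + T x)"])
    qed
    then show ?case using leb[of F] Suc.prems D by (auto simp: differentiable_def)
  }
qed

lemma equi_lipschitz:
  assumes "open U" "x \<in> U" "equi_diff (Suc 0) U F"
  obtains r C where "r > 0" "C \<ge> 0" "ball x r \<subseteq> U"
    "\<And>f y d. f \<in> F \<Longrightarrow> y \<in> ball x r \<Longrightarrow> norm (dir_deriv f d y) \<le> C * norm d"
    "\<And>f y z. f \<in> F \<Longrightarrow> y \<in> ball x r \<Longrightarrow> z \<in> ball x r \<Longrightarrow> norm (f y - f z) \<le> C * norm (y - z)"
proof -
  have "locally_equibounded U (unit_derivs F)" using assms by simp
  then obtain r C where r: "r > 0" "C \<ge> 0" "ball x r \<subseteq> U"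
    "\<And>f y. f \<in> unit_derivs F \<Longrightarrow> y \<in> ball x r \<Longrightarrow> norm (f y) \<le> C"
    using locally_equiboundedE[OF _ assms(1,2)] by metis
  have diff: "f differentiable (at y)" if "f \<in> F" "y \<in> ball x r" for f y
    using assms that r(3) by auto
  have bound: "norm (dir_deriv f d y) \<le> C * norm d" if "f \<in> F" "y \<in> ball x r" for f y d
    by (rule linear_unit_bound[OF linear_dir_deriv[OF diff[OF that]]])
       (use r(4)[OF unit_derivsI] that in auto)
  show ?thesis
  proof (rule that[OF r(1-3) bound])
    fix f y z assume f: "f \<in> F" and yz: "y \<in> ball x r" "z \<in> ball x r"
    show "norm (f y - f z) \<le> C * norm (y - z)"
    proof (rule differentiable_bound[OF convex_ball _ _ yz])
      fix w assume w: "w \<in> ball x r"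
      show "(f has_derivative (\<lambda>d. dir_deriv f d w)) (at w within ball x r)"
        by (rule has_derivative_at_withinI[OF has_derivative_dir_deriv[OF diff[OF f w]]])
      show "onorm (\<lambda>d. dir_deriv f d w) \<le> C"
        by (rule onorm_bound[OF r(2)]) (rule bound[OF f w])
    qed
  qed
qed

text \<open>A bounded second derivative makes the first one Lipschitz, and the mean value inequality
  applied to \<open>f\<close> minus its derivative at \<open>x\<close> gives the quadratic bound,
  uniformly over the family.\<close>

lemma equi_quadratic_remainder:
  assumes "open U" "x \<in> U" "equi_diff (Suc (Suc 0)) U F"
  obtains r C where "r > 0" "C \<ge> 0" "ball x r \<subseteq> U"
    "\<And>f y. f \<in> F \<Longrightarrow> y \<in> ball x r \<Longrightarrow> norm (f y - f x - dir_deriv f (y - x) x) \<le> C * (norm (y - x))\<^sup>2"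
proof -
  have "equi_diff (Suc 0) U (unit_derivs F)" using assms by simp
  from equi_lipschitz[OF assms(1,2) this] obtain r C where r: "r > 0" "C \<ge> 0" "ball x r \<subseteq> U"
    "\<And>f y z. f \<in> unit_derivs F \<Longrightarrow> y \<in> ball x r \<Longrightarrow> z \<in> ball x r \<Longrightarrow> norm (f y - f z) \<le> C * norm (y - z)"
    by metis
  show ?thesis
  proof (rule that[OF r(1-3)])
    fix f y assume f: "f \<in> F" and y: "y \<in> ball x r"
    have diff: "f differentiable (at z)" if "z \<in> ball x r" for z
      using assms f that r(3) by auto
    \<comment> \<open>The second ball is what bounds \<open>norm (z - x)\<close> by
      \<open>norm (y - x)\<close> on a convex set containing both end points.\<close>
    let ?S = "ball x r \<inter> cball x (norm (y - x))"
    let ?f0 = "\<lambda>d. dir_deriv f d x"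
    have x: "x \<in> ball x r" using r by simp
    have bl0: "bounded_linear ?f0" by (rule has_derivative_bounded_linear[OF has_derivative_dir_deriv[OF diff[OF x]]])
    have "norm ((f y - ?f0 y) - (f x - ?f0 x)) \<le> (C * norm (y - x)) * norm (y - x)"
    proof (rule differentiable_bound[where S = ?S])
      show "convex ?S" by (intro convex_Int convex_ball convex_cball)
      fix z assume z: "z \<in> ?S"
      then have zb: "z \<in> ball x r" by simp
      have "((\<lambda>z. f z - ?f0 z) has_derivative (\<lambda>d. dir_deriv f d z - ?f0 d)) (at z)"
        by (intro has_derivative_diff has_derivative_dir_deriv diff zb bounded_linear.has_derivative[OF bl0]
            has_derivative_ident)
      then show "((\<lambda>z. f z - ?f0 z) has_derivative (\<lambda>d. dir_deriv f d z - ?f0 d)) (at z within ?S)"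
        by (rule has_derivative_at_withinI)
      show "onorm (\<lambda>d. dir_deriv f d z - ?f0 d) \<le> C * norm (y - x)"
      proof (rule onorm_bound)
        fix d
        show "norm (dir_deriv f d z - ?f0 d) \<le> C * norm (y - x) * norm d"
        proof (rule linear_unit_bound)
          show "linear (\<lambda>d. dir_deriv f d z - ?f0 d)"
            by (intro linear_compose_sub linear_dir_deriv diff zb x)
          fix d :: 'a assume "norm d \<le> 1"
          then have "norm (dir_deriv f d z - ?f0 d) \<le> C * norm (z - x)"
            by (intro r(4) unit_derivsI f zb x)
          also have "\<dots> \<le> C * norm (y - x)"
            using z r(2) by (intro mult_left_mono) (auto simp: dist_norm norm_minus_commute)
          finally show "norm (dir_deriv f d z - ?f0 d) \<le> C * norm (y - x)" .
        qed
      qed (use r(2) in simp)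
    qed (use y x in \<open>auto simp: dist_norm norm_minus_commute\<close>)
    moreover have "(f y - ?f0 y) - (f x - ?f0 x) = f y - f x - dir_deriv f (y - x) x"
      using linear_diff[OF bounded_linear.linear[OF bl0], of y x] by simp
    ultimately show "norm (f y - f x - dir_deriv f (y - x) x) \<le> C * (norm (y - x))\<^sup>2"
      by (simp add: power2_eq_square)
  qed
qed

text \<open>To be used at points of differentiability: elsewhere \<open>Blinfun\<close> is given a
  map that need not be bounded linear.\<close>

definition bderiv :: "('a::real_normed_vector \<Rightarrow> 'b::real_normed_vector) \<Rightarrow> 'a \<Rightarrow> 'a \<Rightarrow>\<^sub>L 'b" where
  "bderiv f x = Blinfun (\<lambda>d. dir_deriv f d x)"

lemma bderiv_apply: "f differentiable (at x) \<Longrightarrow> blinfun_apply (bderiv f x) d = dir_deriv f d x"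
  unfolding bderiv_def
  by (simp add: bounded_linear_Blinfun_apply[OF has_derivative_bounded_linear[OF has_derivative_dir_deriv]])

lemma has_derivative_bderiv: "f differentiable (at x) \<Longrightarrow> (f has_derivative blinfun_apply (bderiv f x)) (at x)"
  using has_derivative_dir_deriv bderiv_apply[of f x] by (metis ext)

text \<open>Uniform quadratic remainders of the derivatives in unit directions amount to
  differentiability in operator norm. The derivative is again of the form \<open>bderiv\<close> of a
  directional derivative, which is what lets \<open>equi_diff_bderiv\<close> proceed by induction on
  families.\<close>

lemma bderiv_has_derivative:
  assumes U: "open U" and x: "x \<in> U" and f: "equi_diff (Suc (Suc (Suc 0))) U {f}"
  shows "(bderiv f has_derivative (\<lambda>e. bderiv (dir_deriv f e) x)) (at x)"
proof -
  let ?g = "\<lambda>d. dir_deriv f d"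
  have diff: "f differentiable (at z)" if "z \<in> U" for z using f that by simp
  have diff2: "?g d differentiable (at z)" if "z \<in> U" for z d
    using equi_diff_dir_deriv[OF U f, of d] that by simp
  have F: "equi_diff (Suc (Suc 0)) U (unit_derivs {f})" using f by simp
  obtain r C where r: "r > 0" "C \<ge> 0" "ball x r \<subseteq> U"
    "\<And>f' y. f' \<in> unit_derivs {f} \<Longrightarrow> y \<in> ball x r \<Longrightarrow>
      norm (f' y - f' x - dir_deriv f' (y - x) x) \<le> C * (norm (y - x))\<^sup>2"
    using equi_quadratic_remainder[OF U x F] by metis
  obtain r' C' where r': "r' > 0" "C' \<ge> 0"
    "\<And>f' y d. f' \<in> unit_derivs {f} \<Longrightarrow> y \<in> ball x r' \<Longrightarrow> norm (dir_deriv f' d y) \<le> C' * norm d"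
    using equi_lipschitz[OF U x equi_diff_Suc_imp[OF F]] by metis
  have lin: "linear (\<lambda>d. dir_deriv (?g d) e x)" for e
  proof (rule linearI)
    fix d d' :: 'a and c :: real
    have "((\<lambda>z. ?g d z + ?g d' z) has_derivative (\<lambda>e. dir_deriv (?g d) e x + dir_deriv (?g d') e x)) (at x)"
      by (intro has_derivative_add has_derivative_dir_deriv diff2 x)
    then have "(?g (d + d') has_derivative (\<lambda>e. dir_deriv (?g d) e x + dir_deriv (?g d') e x)) (at x)"
      by (rule has_derivative_transform_within_open[OF _ U x])
         (simp add: linear_add[OF linear_dir_deriv[OF diff]])
    then show "dir_deriv (?g (d + d')) e x = dir_deriv (?g d) e x + dir_deriv (?g d') e x"
      by (rule dir_deriv_eq)
    have "((\<lambda>z. c *\<^sub>R ?g d z) has_derivative (\<lambda>e. c *\<^sub>R dir_deriv (?g d) e x)) (at x)"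
      by (intro has_derivative_scaleR_right has_derivative_dir_deriv diff2 x)
    then have "(?g (c *\<^sub>R d) has_derivative (\<lambda>e. c *\<^sub>R dir_deriv (?g d) e x)) (at x)"
      by (rule has_derivative_transform_within_open[OF _ U x])
         (simp add: linear_scale[OF linear_dir_deriv[OF diff]])
    then show "dir_deriv (?g (c *\<^sub>R d)) e x = c *\<^sub>R dir_deriv (?g d) e x"
      by (rule dir_deriv_eq)
  qed
  have bound: "norm (dir_deriv (?g d) e x) \<le> C' * norm e * norm d" for d e
    by (rule linear_unit_bound[OF lin]) (use r'(1) in \<open>auto intro!: r'(3) unit_derivsI\<close>)
  define P' where "P' e = Blinfun (\<lambda>d. dir_deriv (?g d) e x)" for e
  have P'_apply: "P' e d = dir_deriv (?g d) e x" for e d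
  proof -
    have "bounded_linear (\<lambda>d. dir_deriv (?g d) e x)"
      by (rule bounded_linear_intro[where K = "C' * norm e"])
         (use bound[of _ e] in \<open>auto simp: linear_add[OF lin] linear_scale[OF lin] mult_ac\<close>)
    then show ?thesis by (simp add: P'_def bounded_linear_Blinfun_apply)
  qed
  have P': "bounded_linear P'"
  proof (rule bounded_linear_intro)
    show "P' (e + e') = P' e + P' e'" for e e'
      by (rule blinfun_eqI) (simp add: P'_apply linear_add[OF linear_dir_deriv[OF diff2[OF x]]] blinfun.add_left)
    show "P' (c *\<^sub>R e) = c *\<^sub>R P' e" for c e
      by (rule blinfun_eqI) (simp add: P'_apply linear_scale[OF linear_dir_deriv[OF diff2[OF x]]] blinfun.scaleR_left)
    show "norm (P' e) \<le> norm e * C'" for e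
      by (rule norm_blinfun_bound) (use bound[of _ e] r'(2) in \<open>auto simp: P'_apply mult_ac\<close>)
  qed
  have D: "(bderiv f has_derivative P') (at x)"
  proof (rule has_derivative_quadratic[OF P' r(1)])
    fix y assume y: "y \<in> ball x r"
    then have yU: "y \<in> U" using r(3) by blast
    show "norm (bderiv f y - bderiv f x - P' (y - x)) \<le> C * (norm (y - x))\<^sup>2"
    proof (rule norm_blinfun_bound)
      fix d
      show "norm (blinfun_apply (bderiv f y - bderiv f x - P' (y - x)) d) \<le> C * (norm (y - x))\<^sup>2 * norm d"
      proof (rule linear_unit_bound[OF bounded_linear.linear[OF blinfun.bounded_linear_right]])
        fix d :: 'a assume "norm d \<le> 1"
        then have "norm (?g d y - ?g d x - dir_deriv (?g d) (y - x) x) \<le> C * (norm (y - x))\<^sup>2"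
          by (intro r(4) unit_derivsI y) auto
        then show "norm (blinfun_apply (bderiv f y - bderiv f x - P' (y - x)) d) \<le> C * (norm (y - x))\<^sup>2"
          by (simp add: blinfun.diff_left bderiv_apply[OF diff[OF yU]] bderiv_apply[OF diff[OF x]] P'_apply)
      qed
    qed (use r(2) in simp)
  qed
  \<comment> \<open>By construction \<open>P' e d\<close> differentiates first along
    \<open>d\<close> and then along \<open>e\<close>; symmetry of the second derivative exchanges
    the two.\<close>
  have "P' = (\<lambda>e. bderiv (?g e) x)"
  proof (rule ext, rule blinfun_eqI)
    fix e d
    have "P' e d = P' d e"
      by (rule symmetric_second_derivative[OF U x has_derivative_bderiv[OF diff] D])
    then show "P' e d = bderiv (?g e) x d"
      by (simp add: P'_apply bderiv_apply[OF diff2[OF x]])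
  qed
  with D show ?thesis by simp
qed

text \<open>The unit-direction derivatives of \<open>bderiv\<close>
  F\<open>are the operators\<close>bderiv \<open>unit_derivs F\<close>, so the induction hypothesis
  applies to \<open>unit_derivs F\<close>. The loss of orders is harmless, as the lemma is applied
  to families that are controlled to every order.\<close>

lemma equi_diff_bderiv:
  assumes "open U" "equi_diff (Suc (Suc (Suc n))) U F"
  shows "equi_diff n U (bderiv ` F)"
  using assms(2)
proof (induction n arbitrary: F)
  have leb: "locally_equibounded U (bderiv ` F)" if F: "equi_diff (Suc 0) U F" for F :: "('a \<Rightarrow> 'b) set"
    unfolding locally_equibounded_def
  proof
    fix x assume x: "x \<in> U"
    obtain r C where r: "r > 0" "C \<ge> 0" "ball x r \<subseteq> U"
      "\<And>f y d. f \<in> F \<Longrightarrow> y \<in> ball x r \<Longrightarrow> norm (dir_deriv f d y) \<le> C * norm d"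
      using equi_lipschitz[OF assms(1) x F] by metis
    have "norm (bderiv f y) \<le> C" if "f \<in> F" "y \<in> ball x r" for f y
    proof (rule norm_blinfun_bound[OF r(2)])
      have "f differentiable (at y)" using F that r(3) by auto
      then show "norm (blinfun_apply (bderiv f y) d) \<le> C * norm d" for d
        using r(4)[OF that] by (simp add: bderiv_apply)
    qed
    with r(1) show "\<exists>r>0. \<exists>C. \<forall>y\<in>ball x r \<inter> U. \<forall>f\<in>bderiv ` F. norm (f y) \<le> C"
      by (intro exI[of _ r] conjI exI[of _ C]) auto
  qed
  {
    case 0
    then have "locally_equibounded U (bderiv ` F)" by (intro leb equi_diff_le[OF 0]) simp
    then show ?case by simp
  next
    case (Suc n)
    have D: "(bderiv f has_derivative (\<lambda>e. bderiv (dir_deriv f e) x)) (at x)" if "f \<in> F" "x \<in> U" for f x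
    proof (rule bderiv_has_derivative[OF assms(1) that(2)])
      have "equi_diff (Suc (Suc (Suc 0))) U F" by (rule equi_diff_le[OF Suc.prems]) simp
      then show "equi_diff (Suc (Suc (Suc 0))) U {f}"
        by (rule equi_diff_subset[OF _ assms(1)]) (use that in simp)
    qed
    have "equi_diff n U (unit_derivs (bderiv ` F))"
    proof (rule equi_diff_mono[OF Suc.IH[of "unit_derivs F"] assms(1)])
      show "equi_diff (Suc (Suc (Suc n))) U (unit_derivs F)" using Suc.prems by simp
      fix h assume "h \<in> unit_derivs (bderiv ` F)"
      then obtain f d where h: "h = dir_deriv (bderiv f) d" "f \<in> F" "norm d \<le> 1"
        by (auto simp: unit_derivs_def)
      have "\<forall>x\<in>U. h x = bderiv (dir_deriv f d) x" using D h dir_deriv_eq by blast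
      moreover have "bderiv (dir_deriv f d) \<in> bderiv ` unit_derivs F"
        using h by (intro imageI unit_derivsI)
      ultimately show "\<exists>g\<in>bderiv ` unit_derivs F. \<forall>x\<in>U. h x = g x" by blast
    qed
    moreover have "locally_equibounded U (bderiv ` F)" by (intro leb equi_diff_le[OF Suc.prems]) simp
    ultimately show ?case using D by (auto simp: differentiable_def)
  }
qed

section \<open>Division by a surjective operator\<close>

text \<open>Where the second factor vanishes, the derivative of the first would be multiplied by
  zero, so continuity of \<open>f\<close> replaces it. The case of interest is
  \<open>h y o\<^sub>L (P y - P x)\<close> with \<open>h\<close> not yet known to be
  differentiable.\<close>

lemma has_derivative_prod_vanishing:
  assumes "bounded_bilinear p" and f: "isCont f x" and g: "(g has_derivative g') (at x)" "g x = 0"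
  shows "((\<lambda>y. p (f y) (g y)) has_derivative (\<lambda>h. p (f x) (g' h))) (at x)"
proof -
  interpret bounded_bilinear p by fact
  have g': "bounded_linear g'" using g(1) by (rule has_derivative_bounded_linear)
  obtain K where K: "K > 0" "\<And>a b. norm (p a b) \<le> norm a * norm b * K" using pos_bounded by blast
  obtain N where N: "N > 0" "\<And>h. norm (g' h) \<le> norm h * N"
    using bounded_linear.pos_bounded[OF g'] by blast
  show ?thesis
    unfolding has_derivative_at_alt
  proof (intro conjI allI impI)
    show "bounded_linear (\<lambda>h. p (f x) (g' h))" by (rule bounded_linear_compose[OF bounded_linear_right g'])
    fix e :: real assume e: "e > 0"
    \<comment> \<open>Half of the error goes to the remainder of \<open>g\<close>, multiplied by a
      bound for \<open>f\<close> near \<open>x\<close>, the other half to the oscillation of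
      \<open>f\<close>, multiplied by the bound \<open>N\<close> of \<open>g'\<close>. The 1 in
      \<open>e2\<close> yields that bound for \<open>f\<close>.\<close>
    define e1 where "e1 = e / (2 * K * (norm (f x) + 1))"
    define e2 where "e2 = min 1 (e / (2 * K * N))"
    have pos: "norm (f x) + 1 > 0" by (rule add_nonneg_pos) auto
    have e1: "e1 > 0" unfolding e1_def by (intro divide_pos_pos mult_pos_pos e K(1) pos) simp
    have e2: "e2 > 0" unfolding e2_def using e K(1) N(1) by simp
    obtain d1 where d1: "d1 > 0" "\<And>y. norm (y - x) < d1 \<Longrightarrow> norm (g y - g x - g' (y - x)) \<le> e1 * norm (y - x)"
      using g(1) e1 unfolding has_derivative_at_alt by blast
    obtain d2 where d2: "d2 > 0" "\<And>y. dist y x < d2 \<Longrightarrow> dist (f y) (f x) < e2"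
      using f e2 unfolding continuous_at_eps_delta by blast
    have "norm (p (f y) (g y) - p (f x) (g x) - p (f x) (g' (y - x))) \<le> e * norm (y - x)"
      if y: "norm (y - x) < min d1 d2" for y
    proof -
      have fy: "norm (f y - f x) \<le> e2" using d2(2)[of y] y by (simp add: dist_norm less_imp_le)
      then have fy1: "norm (f y) \<le> norm (f x) + 1"
        using norm_triangle_ineq2[of "f y" "f x"] by (simp add: e2_def)
      have gy: "norm (g y - g' (y - x)) \<le> e1 * norm (y - x)" using d1(2)[of y] y g(2) by simp
      have "p (f y) (g y) - p (f x) (g x) - p (f x) (g' (y - x))
          = p (f y) (g y - g' (y - x)) + p (f y - f x) (g' (y - x))"
        by (simp add: g(2) zero_right diff_left diff_right)
      also have "norm \<dots> \<le> norm (f y) * norm (g y - g' (y - x)) * K + norm (f y - f x) * norm (g' (y - x)) * K"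
        by (intro norm_triangle_le add_mono K)
      also have "\<dots> \<le> (norm (f x) + 1) * (e1 * norm (y - x)) * K + (e / (2 * K * N)) * (norm (y - x) * N) * K"
        using K(1) N(1) fy fy1 gy N(2)[of "y - x"] e1 e pos
        by (intro add_mono mult_right_mono mult_mono) (auto simp: e2_def)
      also have "\<dots> = e * norm (y - x)"
      proof -
        have "(norm (f x) + 1) * e1 * K = e / 2" using K(1) pos by (simp add: e1_def)
        moreover have "e / (2 * K * N) * N * K = e / 2" using K(1) N(1) by simp
        ultimately have "((norm (f x) + 1) * e1 * K + e / (2 * K * N) * N * K) * norm (y - x) = e * norm (y - x)"
          by (simp only: field_sum_of_halves)
        then show ?thesis by (simp only: distrib_right distrib_left mult_ac)
      qed
      finally show ?thesis .
    qed
    then show "\<exists>d>0. \<forall>y. norm (y - x) < d \<longrightarrow>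
        norm (p (f y) (g y) - p (f x) (g x) - p (f x) (g' (y - x))) \<le> e * norm (y - x)"
      using d1(1) d2(1) by (intro exI[of _ "min d1 d2"]) auto
  qed
qed

text \<open>Precomposition with a surjective operator is bounded below, since every \<open>w\<close>
  has a preimage of controlled norm.\<close>

lemma blinfun_norm_le_compose:
  assumes "C \<ge> 0" "\<And>w. \<exists>u. blinfun_apply T u = w \<and> norm u \<le> C * norm w"
  shows "norm X \<le> C * norm (X o\<^sub>L T)"
proof (rule norm_blinfun_bound)
  fix w
  obtain u where u: "T u = w" "norm u \<le> C * norm w" using assms by blast
  have "norm (X w) \<le> norm (X o\<^sub>L T) * norm u" using norm_blinfun[of "X o\<^sub>L T" u] u by simp
  also have "\<dots> \<le> norm (X o\<^sub>L T) * (C * norm w)" by (intro mult_left_mono u) simp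
  finally show "norm (X w) \<le> C * norm (X o\<^sub>L T) * norm w" by (simp add: mult_ac)
qed (use assms in simp)

text \<open>If \<open>h\<close> is bounded near \<open>x\<close> and \<open>h \<circ> P\<close> is differentiable, then so is \<open>h\<close>: write
  \<open>h(y) \<circ> P(x) = (h \<circ> P)(y) - h(y) \<circ> (P(y) - P(x))\<close>, and use that precomposition with the
  surjective \<open>P(x)\<close> is an isomorphism onto the operators vanishing on its kernel.\<close>

lemma division_differentiable:
  fixes P :: "'a::real_normed_vector \<Rightarrow> 'b::banach \<Rightarrow>\<^sub>L 'c::banach"
    and h :: "'a \<Rightarrow> 'c \<Rightarrow>\<^sub>L 'd::real_normed_vector"
  assumes surj: "surj (blinfun_apply (P x))" and P: "P differentiable (at x)"
    and k: "(\<lambda>y. h y o\<^sub>L P y) differentiable (at x)"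
    and r: "r > 0" and h: "\<And>y. y \<in> ball x r \<Longrightarrow> norm (h y) \<le> B"
  shows "h differentiable (at x)"
proof -
  obtain C where C: "C > 0" "\<And>w. \<exists>u. P x u = w \<and> norm u \<le> C * norm w"
    using surjective_blinfun_lift[OF surj] by blast
  have C_le: "norm X \<le> C * norm (X o\<^sub>L P x)" for X :: "'c \<Rightarrow>\<^sub>L 'd"
    by (rule blinfun_norm_le_compose) (use C in auto)
  define q where "q y = h y o\<^sub>L P x" for y
  have q_eq: "q = (\<lambda>y. (h y o\<^sub>L P y) - (h y o\<^sub>L (P y - P x)))"
    by (simp add: fun_eq_iff q_def bounded_bilinear.diff_right[OF bounded_bilinear_blinfun_compose])
  have Pc: "isCont P x" using P by (simp add: differentiable_imp_continuous_within)
  have kc: "isCont (\<lambda>y. h y o\<^sub>L P y) x" using k by (rule differentiable_imp_continuous_within)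
  have "((\<lambda>y. h y o\<^sub>L (P y - P x)) \<longlongrightarrow> 0) (at x)"
  proof (rule Lim_null_comparison)
    show "\<forall>\<^sub>F y in at x. norm (h y o\<^sub>L (P y - P x)) \<le> B * norm (P y - P x)"
      unfolding eventually_at
    proof (intro exI[of _ r] conjI ballI impI r)
      fix y assume "y \<noteq> x \<and> dist y x < r"
      then have "norm (h y) \<le> B" by (intro h) (simp add: dist_commute)
      then show "norm (h y o\<^sub>L (P y - P x)) \<le> B * norm (P y - P x)"
        by (meson norm_blinfun_compose order_trans mult_right_mono norm_ge_zero)
    qed
    have "((\<lambda>y. B * norm (P y - P x)) \<longlongrightarrow> B * norm (P x - P x)) (at x)"
      by (intro tendsto_intros Pc[unfolded isCont_def])
    then show "((\<lambda>y. B * norm (P y - P x)) \<longlongrightarrow> 0) (at x)" by simp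
  qed
  from tendsto_diff[OF kc[unfolded isCont_def] this] have qc: "(q \<longlongrightarrow> q x) (at x)"
    by (simp add: q_eq q_def)
  \<comment> \<open>\<open>h\<close> was only assumed bounded. Continuity of \<open>q\<close> at
    \<open>x\<close> gives that of \<open>h\<close> through the lower bound \<open>C_le\<close>, and
    only then does the product rule for vanishing factors apply to \<open>q\<close>.\<close>
  have "((\<lambda>y. h y - h x) \<longlongrightarrow> 0) (at x)"
  proof (rule Lim_null_comparison)
    show "\<forall>\<^sub>F y in at x. norm (h y - h x) \<le> C * norm (q y - q x)"
      using C_le[of "h _ - h x"]
      by (simp add: q_def bounded_bilinear.diff_left[OF bounded_bilinear_blinfun_compose])
    have "((\<lambda>y. C * norm (q y - q x)) \<longlongrightarrow> C * norm (q x - q x)) (at x)" by (intro tendsto_intros qc)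
    then show "((\<lambda>y. C * norm (q y - q x)) \<longlongrightarrow> 0) (at x)" by simp
  qed
  then have hc: "isCont h x" by (simp add: isCont_def LIM_zero_iff)
  have DP: "((\<lambda>y. P y - P x) has_derivative (\<lambda>e. dir_deriv P e x)) (at x)"
    using has_derivative_diff[OF has_derivative_dir_deriv[OF P] has_derivative_const[of "P x"]] by simp
  have "\<exists>q'. (q has_derivative q') (at x)"
    unfolding q_eq
    by (rule exI, rule has_derivative_diff[OF has_derivative_dir_deriv[OF k]
        has_derivative_prod_vanishing[OF bounded_bilinear_blinfun_compose hc DP]]) simp
  then obtain q' where q': "(q has_derivative q') (at x)" by blast
  \<comment> \<open>All \<open>q y\<close> vanish on the kernel of \<open>P x\<close>, hence so does
    \<open>q' e\<close>, which therefore factors through \<open>P x\<close>. The factor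
    \<open>A e\<close> is the candidate for the derivative of \<open>h\<close> along
    \<open>e\<close>.\<close>
  have "\<exists>A. A o\<^sub>L P x = q' e" for e
  proof -
    have "q' e u = 0" if "P x u = 0" for u
    proof -
      have "((\<lambda>y. q y u) has_derivative (\<lambda>e. q' e u)) (at x)"
        by (rule bounded_linear.has_derivative[OF blinfun.bounded_linear_left q'])
      moreover have "(\<lambda>y. q y u) = (\<lambda>y. 0)" by (simp add: q_def that)
      ultimately have "((\<lambda>y. 0) has_derivative (\<lambda>e. q' e u)) (at x)" by simp
      from has_derivative_unique[OF this has_derivative_const] show ?thesis by metis
    qed
    then obtain A where "\<And>u. blinfun_apply A (P x u) = q' e u"
      using blinfun_factor_surjective[OF surj blinfun.bounded_linear_right] by metis
    then show ?thesis by (intro exI[of _ A] blinfun_eqI) simp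
  qed
  then obtain A where A: "\<And>e. A e o\<^sub>L P x = q' e" by metis
  have inj: "X = Y" if "X o\<^sub>L P x = Y o\<^sub>L P x" for X Y :: "'c \<Rightarrow>\<^sub>L 'd"
    using C_le[of "X - Y"] that by (simp add: bounded_bilinear.diff_left[OF bounded_bilinear_blinfun_compose])
  interpret q': bounded_linear q' using q' by (rule has_derivative_bounded_linear)
  obtain N where N: "N > 0" "\<And>e. norm (q' e) \<le> norm e * N" using q'.pos_bounded by blast
  have "(h has_derivative A) (at x)"
    unfolding has_derivative_at_alt
  proof (intro conjI allI impI)
    show "bounded_linear A"
    proof (rule bounded_linear_intro)
      show "A (e + e') = A e + A e'" for e e'
        by (rule inj) (simp add: A q'.add bounded_bilinear.add_left[OF bounded_bilinear_blinfun_compose])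
      show "A (c *\<^sub>R e) = c *\<^sub>R A e" for c e
        by (rule inj) (simp add: A q'.scaleR bounded_bilinear.scaleR_left[OF bounded_bilinear_blinfun_compose])
      fix e
      have "norm (A e) \<le> C * norm (q' e)" using C_le[of "A e"] by (simp add: A)
      also have "\<dots> \<le> C * (norm e * N)" by (intro mult_left_mono N) (use C in simp)
      finally show "norm (A e) \<le> norm e * (C * N)" by (simp add: mult_ac)
    qed
    fix e :: real assume e: "e > 0"
    then have "e / C > 0" using C by simp
    then obtain d where d: "d > 0" "\<And>y. norm (y - x) < d \<Longrightarrow> norm (q y - q x - q' (y - x)) \<le> e / C * norm (y - x)"
      using q' unfolding has_derivative_at_alt by blast
    have "norm (h y - h x - A (y - x)) \<le> e * norm (y - x)" if "norm (y - x) < d" for y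
    proof -
      have "norm (h y - h x - A (y - x)) \<le> C * norm (q y - q x - q' (y - x))"
        using C_le[of "h y - h x - A (y - x)"]
        by (simp add: q_def A bounded_bilinear.diff_left[OF bounded_bilinear_blinfun_compose])
      also have "\<dots> \<le> C * (e / C * norm (y - x))" by (intro mult_left_mono d that) (use C in simp)
      finally show ?thesis using C by simp
    qed
    with d(1) show "\<exists>d>0. \<forall>y. norm (y - x) < d \<longrightarrow> norm (h y - h x - A (y - x)) \<le> e * norm (y - x)" by blast
  qed
  then show ?thesis by (auto simp: differentiable_def)
qed

text \<open>An absorption argument: near \<open>x\<close> one has norm (h y) \<le> C (B + norm (h y)
  / (2 C)), and the last term can be moved to the left-hand side.\<close>

lemma division_locally_equibounded:
  fixes P :: "'a::real_normed_vector \<Rightarrow> 'b::banach \<Rightarrow>\<^sub>L 'c::banach"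
    and H :: "('a \<Rightarrow> 'c \<Rightarrow>\<^sub>L 'd::real_normed_vector) set"
  assumes U: "open U" and P: "\<And>x. x \<in> U \<Longrightarrow> isCont P x"
    and surj: "\<And>x. x \<in> U \<Longrightarrow> surj (blinfun_apply (P x))"
    and k: "locally_equibounded U ((\<lambda>h x. h x o\<^sub>L P x) ` H)"
  shows "locally_equibounded U H"
  unfolding locally_equibounded_def
proof
  fix x assume x: "x \<in> U"
  obtain C where C: "C > 0" "\<And>w. \<exists>u. P x u = w \<and> norm u \<le> C * norm w"
    using surjective_blinfun_lift[OF surj[OF x]] by blast
  obtain r B where r: "r > 0" "\<And>h y. h \<in> (\<lambda>h x. h x o\<^sub>L P x) ` H \<Longrightarrow> y \<in> ball x r \<Longrightarrow> norm (h y) \<le> B"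
    by (rule locally_equiboundedE[OF k U x]) blast
  have "1 / (2 * C) > 0" using C(1) by simp
  then obtain d where d: "d > 0" "\<And>y. dist y x < d \<Longrightarrow> dist (P y) (P x) < 1 / (2 * C)"
    using P[OF x] unfolding continuous_at_eps_delta by blast
  have "norm (h y) \<le> 2 * C * B" if h: "h \<in> H" and y: "y \<in> ball x (min r d)" for h y
  proof -
    have "norm (h y) \<le> C * norm (h y o\<^sub>L P x)"
      by (rule blinfun_norm_le_compose) (use C in auto)
    also have "h y o\<^sub>L P x = (h y o\<^sub>L P y) - (h y o\<^sub>L (P y - P x))"
      by (simp add: bounded_bilinear.diff_right[OF bounded_bilinear_blinfun_compose])
    also have "norm \<dots> \<le> norm (h y o\<^sub>L P y) + norm (h y o\<^sub>L (P y - P x))" by (rule norm_triangle_ineq4)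
    also have "\<dots> \<le> B + norm (h y) * (1 / (2 * C))"
    proof (rule add_mono)
      show "norm (h y o\<^sub>L P y) \<le> B" using r(2)[OF imageI[OF h], of y] y by simp
      have "norm (P y - P x) \<le> 1 / (2 * C)" using d(2)[of y] y by (simp add: dist_norm norm_minus_commute)
      then show "norm (h y o\<^sub>L (P y - P x)) \<le> norm (h y) * (1 / (2 * C))"
        by (meson norm_blinfun_compose order_trans mult_left_mono norm_ge_zero)
    qed
    finally show ?thesis using C(1) by (simp add: field_simps)
  qed
  then show "\<exists>r>0. \<exists>C. \<forall>y\<in>ball x r \<inter> U. \<forall>f\<in>H. norm (f y) \<le> C"
    using r(1) d(1) by (intro exI[of _ "min r d"] conjI exI[of _ "2 * C * B"]) auto
qed

text \<open>The rule h' o P = (h o P)' - h o P' exhibits the family of derivatives as a quotient of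
  one order less. Its right-hand side contains \<open>h\<close> itself, so the induction hypothesis
  is used twice: for \<open>H\<close> and for \<open>unit_derivs H\<close>.\<close>

lemma division_equi_diff:
  fixes P :: "'a::real_normed_vector \<Rightarrow> 'b::banach \<Rightarrow>\<^sub>L 'c::banach"
    and H :: "('a \<Rightarrow> 'c \<Rightarrow>\<^sub>L 'd::real_normed_vector) set"
  assumes U: "open U" and P: "\<And>n. equi_diff n U {P}"
    and surj: "\<And>x. x \<in> U \<Longrightarrow> surj (blinfun_apply (P x))"
    and k: "equi_diff n U ((\<lambda>h x. h x o\<^sub>L P x) ` H)"
  shows "equi_diff n U H"
  using k
proof (induction n arbitrary: H)
  have Pd: "P differentiable (at x)" if "x \<in> U" for x using P[of "Suc 0"] that by simp
  then have Pc: "isCont P x" if "x \<in> U" for x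
    using that by (simp add: differentiable_imp_continuous_within)
  note leb = division_locally_equibounded[OF U Pc surj]
  {
    case 0
    then show ?case using leb by simp
  next
    case (Suc n)
    have H: "locally_equibounded U H" by (rule leb) (use Suc.prems in simp_all)
    have diff: "h differentiable (at x)" if h: "h \<in> H" and x: "x \<in> U" for h x
    proof -
      obtain r B where r: "r > 0" "\<And>y. y \<in> ball x r \<Longrightarrow> norm (h y) \<le> B"
        using locally_equiboundedE[OF H U x] h by metis
      show ?thesis
        by (rule division_differentiable[OF surj[OF x] Pd[OF x] _ r]) (use Suc.prems h x in auto)
    qed
    have IH: "equi_diff n U H" by (rule Suc.IH) (rule equi_diff_Suc_imp[OF Suc.prems])
    let ?K = "(\<lambda>h x. h x o\<^sub>L P x) ` H"
    \<comment> \<open>The constant family of scalars of norm at most 1 contains -1, which turns the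
      difference in the product rule into a sum.\<close>
    let ?Q = "pointwise2 (+) (unit_derivs ?K) (pointwise2 (*\<^sub>R) {\<lambda>x. c | c. norm c \<le> 1}
      (pointwise2 (o\<^sub>L) H (unit_derivs {P})))"
    have "equi_diff n U (unit_derivs H)"
    proof (rule Suc.IH, rule equi_diff_mono[OF _ U])
      show "equi_diff n U ?Q"
        by (intro equi_diff_add U bounded_bilinear.equi_diff_prod[OF bounded_bilinear_scaleR] equi_diff_const
          bounded_bilinear.equi_diff_prod[OF bounded_bilinear_blinfun_compose] IH)
          (use Suc.prems P[of "Suc n"] in simp_all)
      fix f assume "f \<in> (\<lambda>h x. h x o\<^sub>L P x) ` unit_derivs H"
      then obtain h d where f: "f = (\<lambda>x. dir_deriv h d x o\<^sub>L P x)" "h \<in> H" "norm d \<le> 1"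
        by (auto simp: unit_derivs_def)
      define g where "g = (\<lambda>x. dir_deriv (\<lambda>x. h x o\<^sub>L P x) d x + (-1) *\<^sub>R (h x o\<^sub>L dir_deriv P d x))"
      have "g \<in> ?Q"
        unfolding g_def using f
        by (intro pointwise2I[of _ _ _ _ "(+)"] pointwise2I[of _ _ _ _ "(*\<^sub>R)"] pointwise2I[of _ _ _ _ "(o\<^sub>L)"]
          unit_derivsI imageI) auto
      moreover have "f x = g x" if x: "x \<in> U" for x
      proof -
        have "((\<lambda>x. h x o\<^sub>L P x) has_derivative (\<lambda>d. (h x o\<^sub>L dir_deriv P d x) + (dir_deriv h d x o\<^sub>L P x))) (at x)"
          by (intro bounded_bilinear.FDERIV[OF bounded_bilinear_blinfun_compose] has_derivative_dir_deriv diff f Pd x)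
        then show ?thesis by (simp add: f g_def dir_deriv_eq)
      qed
      ultimately show "\<exists>g\<in>?Q. \<forall>x\<in>U. f x = g x" by blast
    qed
    with H diff show ?case by simp
  }
qed

section \<open>Quotients by submersions\<close>

text \<open>Graves' theorem lifts \<open>y'\<close> to a point \<open>x'\<close> near
  \<open>x0\<close> and then \<open>y\<close> to a point \<open>x\<close> with norm (x - x') \<le> C
  norm (y - y'), so the Lipschitz bound upstairs descends with the factor \<open>C\<close>.\<close>

lemma quotient_lipschitz:
  fixes \<pi> :: "'a::banach \<Rightarrow> 'b::banach" and \<gamma> :: "'b \<Rightarrow> 'c::real_normed_vector"
  assumes U: "open U" and x0: "x0 \<in> U"
    and \<pi>: "\<And>x. x \<in> U \<Longrightarrow> (\<pi> has_derivative blinfun_apply (P x)) (at x)"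
    and P: "isCont P x0" and surj: "surj (blinfun_apply (P x0))"
    and \<rho>: "\<rho> > 0" and L: "L \<ge> 0"
    and lip: "\<And>x x'. x \<in> ball x0 \<rho> \<Longrightarrow> x' \<in> ball x0 \<rho> \<Longrightarrow> norm (\<gamma> (\<pi> x) - \<gamma> (\<pi> x')) \<le> L * norm (x - x')"
  obtains s M where "s > 0" "M \<ge> 0" "\<And>y y'. y \<in> ball (\<pi> x0) s \<Longrightarrow> y' \<in> ball (\<pi> x0) s \<Longrightarrow>
    norm (\<gamma> y - \<gamma> y') \<le> M * norm (y - y')"
proof -
  obtain C r where C: "C > 0" and r: "r > 0" "ball x0 r \<subseteq> U"
    "\<And>x y. x \<in> ball x0 r \<Longrightarrow> y \<in> ball (\<pi> x0) r \<Longrightarrow> \<exists>x'\<in>U. \<pi> x' = y \<and> norm (x' - x) \<le> C * norm (y - \<pi> x)"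
    using Graves_local_surjectivity[OF U x0 \<pi> P surj] by blast
  \<comment> \<open>The first lift moves by less than a quarter of \<open>min r \<rho>\<close> and
    the second by at most a half more, so both lifts remain in the balls where Graves' theorem and
    \<open>lip\<close> apply.\<close>
  define s where "s = min r (min r \<rho> / (4 * C))"
  have s: "s > 0" "s \<le> r" "C * s \<le> min r \<rho> / 4"
    using r(1) \<rho> C by (auto simp: s_def min_def field_simps)
  show ?thesis
  proof (rule that)
    show "s > 0" "L * C \<ge> 0" using s L C by auto
    fix y y' assume y: "y \<in> ball (\<pi> x0) s" "y' \<in> ball (\<pi> x0) s"
    have y_r: "y \<in> ball (\<pi> x0) r" "y' \<in> ball (\<pi> x0) r" using y s by auto
    obtain x' where x': "\<pi> x' = y'" "norm (x' - x0) \<le> C * norm (y' - \<pi> x0)"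
      using r(3)[of x0 y'] y_r r(1) by auto
    have "C * norm (y' - \<pi> x0) < C * s"
      using y C by (intro mult_strict_left_mono) (auto simp: dist_norm norm_minus_commute)
    then have x'_near: "norm (x' - x0) < min r \<rho> / 4" using x'(2) s(3) by linarith
    then have "x' \<in> ball x0 r" using r(1) \<rho> by (auto simp: dist_norm norm_minus_commute)
    then obtain x where x: "\<pi> x = y" "norm (x - x') \<le> C * norm (y - y')"
      using r(3)[of x' y] y_r x' by auto
    have "norm (y - y') \<le> norm (y - \<pi> x0) + norm (y' - \<pi> x0)"
      using norm_triangle_ineq4[of "y - \<pi> x0" "y' - \<pi> x0"] by simp
    also have "\<dots> \<le> 2 * s" using y by (auto simp: dist_norm norm_minus_commute)
    finally have "C * norm (y - y') \<le> C * (2 * s)" using C by (intro mult_left_mono) auto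
    then have "norm (x - x') \<le> min r \<rho> / 2" using x(2) s(3) by (simp add: algebra_simps)
    moreover have "norm (x - x0) \<le> norm (x - x') + norm (x' - x0)"
      using norm_triangle_ineq[of "x - x'" "x' - x0"] by simp
    ultimately have "x \<in> ball x0 \<rho>" "x' \<in> ball x0 \<rho>"
      using x'_near \<rho> r(1) by (auto simp: dist_norm norm_minus_commute)
    from lip[OF this] have "norm (\<gamma> y - \<gamma> y') \<le> L * norm (x - x')" by (simp add: x x')
    also have "\<dots> \<le> L * (C * norm (y - y'))" by (intro mult_left_mono x L)
    finally show "norm (\<gamma> y - \<gamma> y') \<le> L * C * norm (y - y')" by (simp add: mult_ac)
  qed
qed

text \<open>No differentiable local section of the submersion \<open>\<pi>\<close> is available, but \<open>\<gamma>\<close> is locally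
  Lipschitz, so its increment along \<open>P u\<close> agrees up to \<open>o(u)\<close> with that of \<open>\<gamma> \<circ> \<pi>\<close> along \<open>u\<close>.\<close>

lemma quotient_differentiable:
  fixes \<pi> :: "'a::banach \<Rightarrow> 'b::banach" and \<gamma> :: "'b \<Rightarrow> 'c::real_normed_vector"
  assumes \<pi>: "(\<pi> has_derivative blinfun_apply P) (at x0)" and surj: "surj (blinfun_apply P)"
    and F: "((\<lambda>x. \<gamma> (\<pi> x)) has_derivative F') (at x0)"
    and s: "s > 0" and M: "M \<ge> 0" and lip: "\<And>y y'. y \<in> ball (\<pi> x0) s \<Longrightarrow> y' \<in> ball (\<pi> x0) s \<Longrightarrow>
      norm (\<gamma> y - \<gamma> y') \<le> M * norm (y - y')"
  shows "\<gamma> differentiable (at (\<pi> x0))"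
proof -
  interpret F': bounded_linear F' using F by (rule has_derivative_bounded_linear)
  have est: "\<exists>d>0. \<forall>u. norm u < d \<longrightarrow> norm (\<gamma> (\<pi> x0 + P u) - \<gamma> (\<pi> x0) - F' u) \<le> e * norm u"
    if e: "e > 0" for e
  proof -
    \<comment> \<open>The bound 1 keeps \<open>\<pi> (x0 + u)\<close> in the ball where \<gamma> is
      Lipschitz; the other bound makes the Lipschitz error at most \<open>e / 2\<close>. The summand
      1 in \<open>M + 1\<close> guards against \<open>M = 0\<close>.\<close>
    define e1 where "e1 = min 1 (e / (2 * (M + 1)))"
    have e1: "e1 > 0" using e M by (simp add: e1_def add_nonneg_pos)
    obtain d1 where d1: "d1 > 0"
      "\<And>y. norm (y - x0) < d1 \<Longrightarrow> norm (\<pi> y - \<pi> x0 - P (y - x0)) \<le> e1 * norm (y - x0)"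
      using \<pi> e1 unfolding has_derivative_at_alt by blast
    have "e / 2 > 0" using e by simp
    then obtain d2 where d2: "d2 > 0"
      "\<And>y. norm (y - x0) < d2 \<Longrightarrow> norm (\<gamma> (\<pi> y) - \<gamma> (\<pi> x0) - F' (y - x0)) \<le> e / 2 * norm (y - x0)"
      using F unfolding has_derivative_at_alt by blast
    have N: "norm P + 2 > 0" by (rule add_nonneg_pos) auto
    define d where "d = min (min d1 d2) (s / (norm P + 2))"
    have "norm (\<gamma> (\<pi> x0 + P u) - \<gamma> (\<pi> x0) - F' u) \<le> e * norm u" if u: "norm u < d" for u
    proof -
      have "(norm P + 2) * norm u < s"
        using u N by (simp add: d_def pos_less_divide_eq mult.commute)
      then have us: "norm P * norm u + norm u + norm u < s" by (simp add: algebra_simps)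
      have Pu: "norm (P u) \<le> norm P * norm u" by (rule norm_blinfun)
      have R: "norm (\<pi> (x0 + u) - \<pi> x0 - P u) \<le> e1 * norm u" using d1(2)[of "x0 + u"] u by (simp add: d_def)
      also have "\<dots> \<le> 1 * norm u" by (intro mult_right_mono) (auto simp: e1_def)
      finally have R1: "norm (\<pi> (x0 + u) - \<pi> x0 - P u) \<le> norm u" by simp
      have "norm (\<pi> (x0 + u) - \<pi> x0) \<le> norm (\<pi> (x0 + u) - \<pi> x0 - P u) + norm (P u)"
        using norm_triangle_ineq[of "\<pi> (x0 + u) - \<pi> x0 - P u" "P u"] by simp
      then have "norm (\<pi> (x0 + u) - \<pi> x0) < s" "norm (P u) < s"
        using R1 Pu us norm_ge_zero[of u] by linarith+
      then have "\<pi> x0 + P u \<in> ball (\<pi> x0) s" "\<pi> (x0 + u) \<in> ball (\<pi> x0) s"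
        by (auto simp: dist_norm norm_minus_commute)
      from lip[OF this] have "norm (\<gamma> (\<pi> x0 + P u) - \<gamma> (\<pi> (x0 + u))) \<le> M * norm (\<pi> (x0 + u) - \<pi> x0 - P u)"
        by (simp add: norm_minus_commute diff_diff_eq)
      also have "\<dots> \<le> M * (e1 * norm u)" by (intro mult_left_mono R M)
      also have "\<dots> \<le> (M + 1) * (e / (2 * (M + 1)) * norm u)"
        using M e by (intro mult_mono mult_right_mono) (auto simp: e1_def)
      also have "\<dots> = e / 2 * norm u" using M by (simp add: field_simps)
      finally have 1: "norm (\<gamma> (\<pi> x0 + P u) - \<gamma> (\<pi> (x0 + u))) \<le> e / 2 * norm u" .
      have 2: "norm (\<gamma> (\<pi> (x0 + u)) - \<gamma> (\<pi> x0) - F' u) \<le> e / 2 * norm u"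
        using d2(2)[of "x0 + u"] u by (simp add: d_def)
      have "\<gamma> (\<pi> x0 + P u) - \<gamma> (\<pi> x0) - F' u
          = (\<gamma> (\<pi> x0 + P u) - \<gamma> (\<pi> (x0 + u))) + (\<gamma> (\<pi> (x0 + u)) - \<gamma> (\<pi> x0) - F' u)" by simp
      also have "norm \<dots> \<le> e / 2 * norm u + e / 2 * norm u"
        by (intro norm_triangle_le add_mono 1 2)
      finally show ?thesis by simp
    qed
    moreover have "d > 0" using d1(1) d2(1) s N by (simp add: d_def)
    ultimately show ?thesis by blast
  qed
  \<comment> \<open>If \<open>P u = 0\<close>, the increment of \<gamma> along
    \<open>P (t u)\<close> is zero, so \<open>est\<close> bounds \<open>F' (t u)\<close> by an
    arbitrarily small multiple of \<open>norm (t u)\<close>.\<close>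
  have ker: "F' u = 0" if u: "P u = 0" for u
  proof (rule ccontr)
    assume nz: "F' u \<noteq> 0"
    then have u0: "u \<noteq> 0" using F'.zero by auto
    define e where "e = norm (F' u) / (2 * norm u)"
    have "e > 0" using nz u0 by (simp add: e_def)
    then obtain d where d: "d > 0"
      "\<And>u. norm u < d \<Longrightarrow> norm (\<gamma> (\<pi> x0 + P u) - \<gamma> (\<pi> x0) - F' u) \<le> e * norm u"
      using est by blast
    define t where "t = d / (2 * norm u)"
    have t: "t > 0" "norm (t *\<^sub>R u) < d" using d(1) u0 by (auto simp: t_def)
    from d(2)[OF t(2)] have "t * norm (F' u) \<le> e * (t * norm u)"
      using t(1) by (simp add: blinfun.scaleR_right u F'.scaleR)
    also have "\<dots> = t * norm (F' u) / 2" using u0 by (simp add: e_def)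
    finally show False using t(1) nz by simp
  qed
  obtain A where A: "\<And>u. blinfun_apply A (P u) = F' u"
    using blinfun_factor_surjective[OF surj F'.bounded_linear_axioms ker] by blast
  obtain C where C: "C > 0" "\<And>w. \<exists>u. P u = w \<and> norm u \<le> C * norm w"
    using surjective_blinfun_lift[OF surj] by blast
  have "(\<gamma> has_derivative blinfun_apply A) (at (\<pi> x0))"
    unfolding has_derivative_at_alt
  proof (intro conjI allI impI blinfun.bounded_linear_right)
    fix e :: real assume "e > 0"
    then have "e / C > 0" using C by simp
    then obtain d where d: "d > 0"
      "\<And>u. norm u < d \<Longrightarrow> norm (\<gamma> (\<pi> x0 + P u) - \<gamma> (\<pi> x0) - F' u) \<le> e / C * norm u"
      using est by blast
    have "norm (\<gamma> y - \<gamma> (\<pi> x0) - A (y - \<pi> x0)) \<le> e * norm (y - \<pi> x0)" if y: "norm (y - \<pi> x0) < d / C" for y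
    proof -
      obtain u where u: "P u = y - \<pi> x0" "norm u \<le> C * norm (y - \<pi> x0)" using C(2) by blast
      have "C * norm (y - \<pi> x0) < d" using y C(1) by (simp add: pos_less_divide_eq mult.commute)
      then have "norm (\<gamma> (\<pi> x0 + P u) - \<gamma> (\<pi> x0) - F' u) \<le> e / C * norm u" using d(2) u(2) by simp
      also have "\<dots> \<le> e / C * (C * norm (y - \<pi> x0))" using \<open>e / C > 0\<close> by (intro mult_left_mono u) simp
      finally show ?thesis using C(1) by (simp add: A[symmetric] u(1))
    qed
    then show "\<exists>d>0. \<forall>y. norm (y - \<pi> x0) < d \<longrightarrow> norm (\<gamma> y - \<gamma> (\<pi> x0) - A (y - \<pi> x0)) \<le> e * norm (y - \<pi> x0)"
      using d(1) C(1) by (intro exI[of _ "d / C"]) auto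
  qed
  then show ?thesis by (auto simp: differentiable_def)
qed

locale smooth_submersion =
  fixes U :: "'a::banach set" and \<pi> :: "'a \<Rightarrow> 'b::banach"
  assumes U: "open U" and smooth: "\<And>n. equi_diff n U {\<pi>}"
    and surj: "\<And>x. x \<in> U \<Longrightarrow> surj (blinfun_apply (bderiv \<pi> x))"
begin

lemma differentiable: "x \<in> U \<Longrightarrow> \<pi> differentiable (at x)"
  using smooth[of "Suc 0"] by simp

lemma derivative: "x \<in> U \<Longrightarrow> (\<pi> has_derivative blinfun_apply (bderiv \<pi> x)) (at x)"
  by (rule has_derivative_bderiv[OF differentiable])

lemma bderiv_differentiable: "x \<in> U \<Longrightarrow> bderiv \<pi> differentiable (at x)"
  using bderiv_has_derivative[OF U _ smooth] by (auto simp: differentiable_def)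

lemma Graves:
  assumes "x0 \<in> U"
  obtains C r where "C > 0" "r > 0" "ball x0 r \<subseteq> U"
    "\<And>x y. x \<in> ball x0 r \<Longrightarrow> y \<in> ball (\<pi> x0) r \<Longrightarrow> \<exists>x'\<in>U. \<pi> x' = y \<and> norm (x' - x) \<le> C * norm (y - \<pi> x)"
  using Graves_local_surjectivity[OF U assms derivative
      differentiable_imp_continuous_within[OF bderiv_differentiable[OF assms]] surj[OF assms]] by blast

lemma open_image: "open (\<pi> ` U)"
proof (unfold open_contains_ball, intro ballI)
  fix y assume "y \<in> \<pi> ` U"
  then obtain x where x: "x \<in> U" "y = \<pi> x" by blast
  obtain C r where C: "C > 0" "r > 0"
    "\<And>x' y. x' \<in> ball x r \<Longrightarrow> y \<in> ball (\<pi> x) r \<Longrightarrow> \<exists>z\<in>U. \<pi> z = y \<and> norm (z - x') \<le> C * norm (y - \<pi> x')"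
    by (rule Graves[OF x(1)]) blast
  have "z \<in> \<pi> ` U" if z: "z \<in> ball y r" for z
  proof -
    have "\<exists>w\<in>U. \<pi> w = z \<and> norm (w - x) \<le> C * norm (z - \<pi> x)"
      by (rule C(3)) (use z C(2) x in auto)
    then show ?thesis by blast
  qed
  then show "\<exists>e>0. ball y e \<subseteq> \<pi> ` U" using C(2) by (intro exI[of _ r]) blast
qed

text \<open>Points close to \<open>\<pi> x\<close> have preimages close to \<open>x\<close>, so a
  bound near \<open>x\<close> descends.\<close>

lemma quotient_locally_equibounded:
  assumes "locally_equibounded U ((\<lambda>\<gamma> x. \<gamma> (\<pi> x)) ` \<Gamma>)"
  shows "locally_equibounded (\<pi> ` U) \<Gamma>"
  unfolding locally_equibounded_def
proof
  fix y assume "y \<in> \<pi> ` U"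
  then obtain x where x: "x \<in> U" "y = \<pi> x" by blast
  obtain C r where C: "C > 0" "r > 0"
    "\<And>x' y. x' \<in> ball x r \<Longrightarrow> y \<in> ball (\<pi> x) r \<Longrightarrow> \<exists>z\<in>U. \<pi> z = y \<and> norm (z - x') \<le> C * norm (y - \<pi> x')"
    by (rule Graves[OF x(1)]) blast
  obtain \<rho> B where \<rho>: "\<rho> > 0"
    "\<And>f y. f \<in> (\<lambda>\<gamma> x. \<gamma> (\<pi> x)) ` \<Gamma> \<Longrightarrow> y \<in> ball x \<rho> \<Longrightarrow> norm (f y) \<le> B"
    by (rule locally_equiboundedE[OF assms U x(1)]) blast
  have "norm (\<gamma> z) \<le> B" if z: "z \<in> ball y (min r (\<rho> / C))" and \<gamma>: "\<gamma> \<in> \<Gamma>" for z \<gamma>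
  proof -
    obtain w where w: "\<pi> w = z" "norm (w - x) \<le> C * norm (z - \<pi> x)"
      using C(3)[of x z] C(2) z by (auto simp: x)
    have "C * norm (z - \<pi> x) < \<rho>"
      using z C(1) by (simp add: x dist_norm norm_minus_commute pos_less_divide_eq mult.commute)
    then have "w \<in> ball x \<rho>" using w(2) by (simp add: dist_norm norm_minus_commute)
    from \<rho>(2)[OF imageI[OF \<gamma>] this] show ?thesis by (simp add: w)
  qed
  then show "\<exists>r>0. \<exists>C. \<forall>z\<in>ball y r \<inter> \<pi> ` U. \<forall>f\<in>\<Gamma>. norm (f z) \<le> C"
    using C(1,2) \<rho>(1) by (intro exI[of _ "min r (\<rho> / C)"] conjI exI[of _ B]) auto
qed

text \<open>Asks for one derivative at one point and a Lipschitz bound. This suits the translations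
  of the quotient, where the bound comes from composing two Lipschitz maps.\<close>

lemma quotient_differentiable_at_lipschitz:
  assumes x: "x \<in> U" and F: "(\<lambda>x. \<gamma> (\<pi> x)) differentiable (at x)" and \<rho>: "\<rho> > 0" "B \<ge> 0"
    and lip: "\<And>y z. y \<in> ball x \<rho> \<Longrightarrow> z \<in> ball x \<rho> \<Longrightarrow> norm (\<gamma> (\<pi> y) - \<gamma> (\<pi> z)) \<le> B * norm (y - z)"
  shows "\<gamma> differentiable (at (\<pi> x))"
proof -
  obtain s C where s: "s > 0" "C \<ge> 0" "\<And>y y'. y \<in> ball (\<pi> x) s \<Longrightarrow> y' \<in> ball (\<pi> x) s \<Longrightarrow>
    norm (\<gamma> y - \<gamma> y') \<le> C * norm (y - y')"
    using quotient_lipschitz[OF U x derivative differentiable_imp_continuous_within[OF bderiv_differentiable[OF x]]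
        surj[OF x] \<rho> lip] by blast
  from quotient_differentiable[OF derivative[OF x] surj[OF x] has_derivative_dir_deriv[OF F] s]
  show ?thesis .
qed

lemma quotient_differentiable_at:
  assumes x: "x \<in> U" and \<gamma>: "equi_diff (Suc 0) U {\<lambda>x. \<gamma> (\<pi> x)}"
  shows "\<gamma> differentiable (at (\<pi> x))"
proof -
  obtain \<rho> L where \<rho>: "\<rho> > 0" "L \<ge> 0"
    and lip: "\<And>f y z. f \<in> {\<lambda>x. \<gamma> (\<pi> x)} \<Longrightarrow> y \<in> ball x \<rho> \<Longrightarrow> z \<in> ball x \<rho> \<Longrightarrow> norm (f y - f z) \<le> L * norm (y - z)"
    by (rule equi_lipschitz[OF U x \<gamma>]) blast
  show ?thesis
    by (rule quotient_differentiable_at_lipschitz[OF x _ \<rho> lip[OF singletonI]]) (use \<gamma> x in simp_all)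
qed

text \<open>Every order is assumed upstairs even for a fixed \<open>n\<close> below, because forming
  \<open>bderiv\<close> loses orders at each stage of the induction. The derivatives of \<Gamma> in
  unit directions, pulled back by \<pi>, are the quotient operators in \<open>?H\<close> evaluated
  at unit vectors.\<close>

lemma quotient_equi_diff:
  fixes \<Gamma> :: "('b \<Rightarrow> 'c::real_normed_vector) set"
  assumes "\<And>n. equi_diff n U ((\<lambda>\<gamma> x. \<gamma> (\<pi> x)) ` \<Gamma>)"
  shows "equi_diff n (\<pi> ` U) \<Gamma>"
  using assms
proof (induction n arbitrary: \<Gamma>)
  case 0
  have "locally_equibounded U ((\<lambda>\<gamma> x. \<gamma> (\<pi> x)) ` \<Gamma>)" using 0[of 0] by simp
  then show ?case using quotient_locally_equibounded by simp
next
  case (Suc n)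
  have diff: "\<gamma> differentiable (at (\<pi> x))" if "\<gamma> \<in> \<Gamma>" "x \<in> U" for \<gamma> x
    by (rule quotient_differentiable_at[OF that(2) equi_diff_subset[OF Suc.prems U]]) (use that in auto)
  let ?H = "(\<lambda>\<gamma> x. bderiv \<gamma> (\<pi> x)) ` \<Gamma>"
  have H: "equi_diff m U ?H" for m
  proof (rule division_equi_diff[OF U _ surj])
    have "equi_diff k U (bderiv ` {\<pi>})" for k by (rule equi_diff_bderiv[OF U smooth])
    then show "equi_diff k U {bderiv \<pi>}" for k by simp
    show "equi_diff m U ((\<lambda>h x. h x o\<^sub>L bderiv \<pi> x) ` ?H)"
    proof (rule equi_diff_mono[OF equi_diff_bderiv[OF U Suc.prems] U])
      fix f assume "f \<in> (\<lambda>h x. h x o\<^sub>L bderiv \<pi> x) ` ?H"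
      then obtain \<gamma> where \<gamma>: "\<gamma> \<in> \<Gamma>" "f = (\<lambda>x. bderiv \<gamma> (\<pi> x) o\<^sub>L bderiv \<pi> x)" by blast
      have "f x = bderiv (\<lambda>x. \<gamma> (\<pi> x)) x" if x: "x \<in> U" for x
      proof (rule blinfun_eqI)
        fix d
        have D: "((\<lambda>x. \<gamma> (\<pi> x)) has_derivative (\<lambda>d. bderiv \<gamma> (\<pi> x) (bderiv \<pi> x d))) (at x)"
          by (rule has_derivative_compose[OF derivative[OF x] has_derivative_bderiv[OF diff[OF \<gamma>(1) x]]])
        then have "(\<lambda>x. \<gamma> (\<pi> x)) differentiable (at x)" by (auto simp: differentiable_def)
        then show "f x d = bderiv (\<lambda>x. \<gamma> (\<pi> x)) x d" by (simp add: bderiv_apply dir_deriv_eq[OF D] \<gamma>(2))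
      qed
      then show "\<exists>g\<in>bderiv ` (\<lambda>\<gamma> x. \<gamma> (\<pi> x)) ` \<Gamma>. \<forall>x\<in>U. f x = g x" using \<gamma>(1) by blast
    qed
  qed
  have "equi_diff n (\<pi> ` U) (unit_derivs \<Gamma>)"
  proof (rule Suc.IH)
    fix m
    show "equi_diff m U ((\<lambda>\<gamma> x. \<gamma> (\<pi> x)) ` unit_derivs \<Gamma>)"
    proof (rule equi_diff_mono[OF bounded_bilinear.equi_diff_prod[OF bounded_bilinear_blinfun_apply U H
            equi_diff_const[OF U, of _ 1]] U])
      fix f assume "f \<in> (\<lambda>\<gamma> x. \<gamma> (\<pi> x)) ` unit_derivs \<Gamma>"
      then obtain \<gamma> d where \<gamma>: "\<gamma> \<in> \<Gamma>" "norm d \<le> 1" "f = (\<lambda>x. dir_deriv \<gamma> d (\<pi> x))"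
        by (auto simp: unit_derivs_def)
      have "(\<lambda>x. blinfun_apply (bderiv \<gamma> (\<pi> x)) d) \<in> pointwise2 blinfun_apply ?H {\<lambda>x. c | c. norm c \<le> 1}"
        using \<gamma> by (intro pointwise2I) auto
      moreover have "\<forall>x\<in>U. f x = blinfun_apply (bderiv \<gamma> (\<pi> x)) d"
        using diff[OF \<gamma>(1)] by (simp add: \<gamma>(3) bderiv_apply)
      ultimately show "\<exists>g\<in>pointwise2 blinfun_apply ?H {\<lambda>x. c | c. norm c \<le> 1}. \<forall>x\<in>U. f x = g x"
        by (intro bexI[of _ "\<lambda>x. blinfun_apply (bderiv \<gamma> (\<pi> x)) d"])
    qed
  qed
  moreover have "locally_equibounded (\<pi> ` U) \<Gamma>"
    using quotient_locally_equibounded Suc.prems[of 0] by simp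
  ultimately show ?case using diff by auto
qed

end

section \<open>Smoothness and iterated derivatives\<close>

lemma prod_list_norm_nonneg: "0 \<le> (\<Prod>v\<leftarrow>vs. norm v)"
  by (induction vs) auto

lemma prod_list_norm_le_1: "(\<And>v. v \<in> set vs \<Longrightarrow> norm v \<le> 1) \<Longrightarrow> (\<Prod>v\<leftarrow>vs. norm v) \<le> 1"
  by (induction vs) (auto intro!: mult_le_one prod_list_norm_nonneg)

text \<open>\<open>F m\<close> collects the \<open>m\<close>-th derivatives at unit vectors.
  Differentiating adds one vector at the head of the list, so on \<open>S\<close> the derivatives of
  \<open>F m\<close> in unit directions belong to \<open>F (Suc m)\<close>, and \<open>F 0\<close>
  is the function itself.\<close>

lemma smooth_on_imp_equi_diff:
  assumes "smooth_on S f"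
  shows "equi_diff n S {f}"
proof -
  have S: "open S" using assms by (simp add: smooth_on_def)
  from assms obtain D where D: "\<forall>x\<in>S. D x [] = f x \<and>
       (\<forall>us vs. linear (\<lambda>w. D x (us @ w # vs))) \<and>
       (\<forall>n. \<exists>C. \<forall>vs. length vs = n \<longrightarrow> norm (D x vs) \<le> C * (\<Prod>v\<leftarrow>vs. norm v)) \<and>
       (\<forall>n. \<forall>e>0. \<exists>d>0. \<forall>y\<in>S. norm (y - x) < d \<longrightarrow>
          (\<forall>vs. length vs = n \<longrightarrow>
             norm (D y vs - D x vs - D x ((y - x) # vs)) \<le> e * norm (y - x) * (\<Prod>v\<leftarrow>vs. norm v)))"
    unfolding smooth_on_def by (elim conjE exE) (rule that)
  have D0: "D x [] = f x" and lin: "linear (\<lambda>w. D x (us @ w # vs))" if "x \<in> S" for x us vs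
    using bspec[OF D that] by auto
  have bnd: "\<exists>C. \<forall>vs. length vs = n \<longrightarrow> norm (D x vs) \<le> C * (\<Prod>v\<leftarrow>vs. norm v)" if "x \<in> S" for x n
    using bspec[OF D that] by blast
  have rem: "\<exists>d>0. \<forall>y\<in>S. norm (y - x) < d \<longrightarrow> (\<forall>vs. length vs = n \<longrightarrow>
      norm (D y vs - D x vs - D x ((y - x) # vs)) \<le> e * norm (y - x) * (\<Prod>v\<leftarrow>vs. norm v))"
    if "x \<in> S" "e > 0" for x n e
    using bspec[OF D that(1)] that(2) by blast
  define F where "F m = {\<lambda>x. D x vs | vs. length vs = m \<and> (\<forall>v\<in>set vs. norm v \<le> 1)}" for m
  have deriv: "((\<lambda>x. D x vs) has_derivative (\<lambda>w. D x (w # vs))) (at x)" if x: "x \<in> S" for x vs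
    unfolding has_derivative_at_alt
  proof (intro conjI allI impI)
    let ?p = "\<Prod>v\<leftarrow>vs. norm v"
    obtain C where "\<And>us. length us = Suc (length vs) \<Longrightarrow> norm (D x us) \<le> C * (\<Prod>v\<leftarrow>us. norm v)"
      using bnd[OF x] by blast
    from this[of "_ # vs"] have C: "norm (D x (w # vs)) \<le> norm w * (C * ?p)" for w
      by (simp add: mult_ac)
    show "bounded_linear (\<lambda>w. D x (w # vs))"
      using linear_add[OF lin[OF x, of "[]" vs]] linear_scale[OF lin[OF x, of "[]" vs]] C
      by (intro bounded_linear_intro) auto
    fix e :: real assume e: "e > 0"
    have p: "?p + 1 > 0" using prod_list_norm_nonneg[of vs] by linarith
    have "e / (?p + 1) > 0" using e p by simp
    from rem[OF x this, of "length vs"] obtain d where d: "d > 0"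
      "\<And>y. y \<in> S \<Longrightarrow> norm (y - x) < d \<Longrightarrow> norm (D y vs - D x vs - D x ((y - x) # vs)) \<le> e / (?p + 1) * norm (y - x) * ?p"
      by blast
    obtain r where r: "r > 0" "ball x r \<subseteq> S" using S x open_contains_ball by blast
    have "norm (D y vs - D x vs - D x ((y - x) # vs)) \<le> e * norm (y - x)" if y: "norm (y - x) < min d r" for y
    proof -
      have "y \<in> S" using y r(2) by (auto simp: dist_norm norm_minus_commute)
      then have "norm (D y vs - D x vs - D x ((y - x) # vs)) \<le> (e / (?p + 1) * ?p) * norm (y - x)"
        using d(2)[of y] y by (simp add: mult_ac)
      also have "\<dots> \<le> e * norm (y - x)"
        using p e by (intro mult_right_mono) (auto simp: field_simps)
      finally show ?thesis .
    qed
    then show "\<exists>d>0. \<forall>y. norm (y - x) < d \<longrightarrow> norm (D y vs - D x vs - D x ((y - x) # vs)) \<le> e * norm (y - x)"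
      using d(1) r(1) by (intro exI[of _ "min d r"]) auto
  qed
  have leb: "locally_equibounded S (F m)" for m
    unfolding locally_equibounded_def
  proof
    fix x assume x: "x \<in> S"
    obtain C where C: "\<And>us. length us = m \<Longrightarrow> norm (D x us) \<le> C * (\<Prod>v\<leftarrow>us. norm v)"
      using bnd[OF x] by blast
    obtain C' where C': "\<And>us. length us = Suc m \<Longrightarrow> norm (D x us) \<le> C' * (\<Prod>v\<leftarrow>us. norm v)"
      using bnd[OF x] by blast
    \<comment> \<open>The definition bounds \<open>D x\<close> pointwise in \<open>x\<close>. The
      remainder estimate with constant 1 spreads the bounds of orders \<open>m\<close> and
      \<open>m + 1\<close> at \<open>x\<close> to a bound of order \<open>m\<close> on a
      neighbourhood.\<close>
    obtain d where d: "d > 0" "\<And>y vs. y \<in> S \<Longrightarrow> norm (y - x) < d \<Longrightarrow> length vs = m \<Longrightarrow>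
      norm (D y vs - D x vs - D x ((y - x) # vs)) \<le> 1 * norm (y - x) * (\<Prod>v\<leftarrow>vs. norm v)"
      using rem[OF x zero_less_one, of m] by blast
    have "norm (D y vs) \<le> \<bar>C\<bar> + \<bar>C'\<bar> * d + d"
      if y: "y \<in> ball x d \<inter> S" and vs: "length vs = m" "\<forall>v\<in>set vs. norm v \<le> 1" for y vs
    proof -
      let ?p = "\<Prod>v\<leftarrow>vs. norm v"
      have yx: "norm (y - x) < d" using y by (auto simp: dist_norm norm_minus_commute)
      have p: "0 \<le> ?p" "?p \<le> 1" using prod_list_norm_nonneg prod_list_norm_le_1 vs by auto
      have "norm (D x vs) \<le> C * ?p" by (rule C) (rule vs)
      also have "\<dots> \<le> \<bar>C\<bar> * 1" using p by (intro mult_mono) auto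
      finally have 1: "norm (D x vs) \<le> \<bar>C\<bar>" by simp
      have "norm (D x ((y - x) # vs)) \<le> C' * (norm (y - x) * ?p)" using C'[of "(y - x) # vs"] vs by simp
      also have "\<dots> \<le> \<bar>C'\<bar> * (d * 1)" using p yx d(1) by (intro mult_mono) auto
      finally have 2: "norm (D x ((y - x) # vs)) \<le> \<bar>C'\<bar> * d" by simp
      have "norm (D y vs - D x vs - D x ((y - x) # vs)) \<le> norm (y - x) * ?p" using d(2)[of y vs] y yx vs by simp
      also have "\<dots> \<le> d * 1" using p yx d(1) by (intro mult_mono) auto
      finally have 3: "norm (D y vs - D x vs - D x ((y - x) # vs)) \<le> d" by simp
      have "D y vs = D x vs + D x ((y - x) # vs) + (D y vs - D x vs - D x ((y - x) # vs))" by simp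
      also have "norm \<dots> \<le> \<bar>C\<bar> + \<bar>C'\<bar> * d + d"
        by (intro norm_triangle_le add_mono 1 2 3)
      finally show ?thesis .
    qed
    then show "\<exists>r>0. \<exists>C. \<forall>y\<in>ball x r \<inter> S. \<forall>g\<in>F m. norm (g y) \<le> C"
      using d(1) by (intro exI[of _ d] conjI exI[of _ "\<bar>C\<bar> + \<bar>C'\<bar> * d + d"]) (auto simp: F_def)
  qed
  have "equi_diff n S (F m)" for m
  proof (induction n arbitrary: m)
    case 0 then show ?case using leb by simp
  next
    case (Suc n)
    have "equi_diff n S (unit_derivs (F m))"
    proof (rule equi_diff_mono[OF Suc.IH[of "Suc m"] S])
      fix g assume "g \<in> unit_derivs (F m)"
      then obtain vs d where g: "g = dir_deriv (\<lambda>x. D x vs) d" "length vs = m" "\<forall>v\<in>set vs. norm v \<le> 1" "norm d \<le> 1"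
        by (auto simp: unit_derivs_def F_def)
      have "\<forall>x\<in>S. g x = D x (d # vs)" using dir_deriv_eq[OF deriv] g(1) by blast
      moreover have "(\<lambda>x. D x (d # vs)) \<in> F (Suc m)"
        unfolding F_def using g by (intro CollectI exI[of _ "d # vs"]) auto
      ultimately show "\<exists>h\<in>F (Suc m). \<forall>x\<in>S. g x = h x" by (intro bexI[of _ "\<lambda>x. D x (d # vs)"])
    qed
    moreover have "g differentiable (at x)" if "g \<in> F m" "x \<in> S" for g x
      using that deriv by (auto simp: F_def differentiable_def)
    ultimately show ?case using leb by simp
  qed
  from this[of 0] show ?thesis
    by (rule equi_diff_mono[OF _ S]) (use D0 in \<open>auto simp: F_def\<close>)
qed

text \<open>The head of the list is the direction differentiated last, in accordance with
  \<open>D x ((y - x) # vs)\<close> in \<open>smooth_on\<close>.\<close>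

primrec iter_deriv :: "('a::real_normed_vector \<Rightarrow> 'b::real_normed_vector) \<Rightarrow> 'a list \<Rightarrow> 'a \<Rightarrow> 'b" where
  "iter_deriv f [] = f"
| "iter_deriv f (v # vs) = dir_deriv (iter_deriv f vs) v"

text \<open>The iterated directional derivatives serve as \<open>D\<close>. Locally uniform bounds
  over unit directions become estimates in operator norm once the norms of the arguments are
  factored out.\<close>

lemma equi_diff_imp_smooth_on:
  assumes S: "open S" and f: "\<And>n. equi_diff n S {f}"
  shows "smooth_on S f"
proof -
  have eq: "equi_diff n S {iter_deriv f vs}" for vs n
    by (induction vs arbitrary: n) (auto intro: f equi_diff_dir_deriv[OF S] simp del: equi_diff.simps)
  have diff: "iter_deriv f vs differentiable (at x)" if "x \<in> S" for vs x
    using eq[of "Suc 0" vs] that by simp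
  define F where "F m = {iter_deriv f vs | vs. length vs = m \<and> (\<forall>v\<in>set vs. norm v \<le> 1)}" for m
  have F: "equi_diff n S (F m)" for n m
  proof (induction m arbitrary: n)
    case 0
    have "F 0 = {f}" by (auto simp: F_def)
    then show ?case using f by simp
  next
    case (Suc m)
    have "F (Suc m) \<subseteq> unit_derivs (F m)"
    proof
      fix g assume "g \<in> F (Suc m)"
      then obtain v vs where "g = iter_deriv f (v # vs)" "length vs = m" "\<forall>u\<in>set (v # vs). norm u \<le> 1"
        by (auto simp: F_def length_Suc_conv)
      then show "g \<in> unit_derivs (F m)" by (auto simp: F_def intro!: unit_derivsI)
    qed
    note sub = this
    have "equi_diff n S (unit_derivs (F m))" using Suc[of "Suc n"] by simp
    then show ?case by (rule equi_diff_subset[OF _ S sub])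
  qed
  have sgn_F: "iter_deriv f (map sgn vs) \<in> F (length vs)" for vs
    unfolding F_def by (intro CollectI exI[of _ "map sgn vs"]) (auto simp: norm_sgn)
  \<comment> \<open>Directions are normalised one at a time. A zero direction causes no exception,
    since its \<open>sgn\<close> is 0 and the product of norms vanishes.\<close>
  have iter_sgn: "iter_deriv f vs x = (\<Prod>v\<leftarrow>vs. norm v) *\<^sub>R iter_deriv f (map sgn vs) x" if "x \<in> S" for vs x
    using that
  proof (induction vs arbitrary: x)
    case (Cons v vs)
    let ?p = "\<Prod>v\<leftarrow>vs. norm v"
    have "((\<lambda>z. ?p *\<^sub>R iter_deriv f (map sgn vs) z) has_derivative
        (\<lambda>d. ?p *\<^sub>R dir_deriv (iter_deriv f (map sgn vs)) d x)) (at x)"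
      by (intro has_derivative_scaleR_right has_derivative_dir_deriv diff Cons)
    then have "(iter_deriv f vs has_derivative (\<lambda>d. ?p *\<^sub>R dir_deriv (iter_deriv f (map sgn vs)) d x)) (at x)"
      by (rule has_derivative_transform_within_open[OF _ S Cons.prems]) (simp add: Cons.IH)
    then have "iter_deriv f (v # vs) x = ?p *\<^sub>R dir_deriv (iter_deriv f (map sgn vs)) v x"
      by (simp add: dir_deriv_eq)
    also have "dir_deriv (iter_deriv f (map sgn vs)) v x = norm v *\<^sub>R dir_deriv (iter_deriv f (map sgn vs)) (sgn v) x"
      by (rule dir_deriv_scaled_sgn[OF diff[OF Cons.prems]])
    finally show ?case by (simp add: mult.commute)
  qed simp
  have deriv_sgn: "dir_deriv (iter_deriv f vs) d x = (\<Prod>v\<leftarrow>vs. norm v) *\<^sub>R dir_deriv (iter_deriv f (map sgn vs)) d x"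
    if x: "x \<in> S" for vs d x
  proof -
    have "((\<lambda>z. (\<Prod>v\<leftarrow>vs. norm v) *\<^sub>R iter_deriv f (map sgn vs) z) has_derivative
        (\<lambda>d. (\<Prod>v\<leftarrow>vs. norm v) *\<^sub>R dir_deriv (iter_deriv f (map sgn vs)) d x)) (at x)"
      by (intro has_derivative_scaleR_right has_derivative_dir_deriv diff x)
    then have "(iter_deriv f vs has_derivative (\<lambda>d. (\<Prod>v\<leftarrow>vs. norm v) *\<^sub>R dir_deriv (iter_deriv f (map sgn vs)) d x)) (at x)"
      by (rule has_derivative_transform_within_open[OF _ S x]) (simp add: iter_sgn[symmetric])
    then show ?thesis by (rule dir_deriv_eq)
  qed
  \<comment> \<open>Linearity in an inner slot holds at every point of the open set
    \<open>S\<close>, and differentiating that identity along the outer directions preserves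
    it.\<close>
  have linear_iter: "linear (\<lambda>w. iter_deriv f (us @ w # vs) x)" if "x \<in> S" for us vs x
    using that
  proof (induction us arbitrary: x)
    case Nil
    then show ?case using linear_dir_deriv[OF diff] by simp
  next
    case (Cons u us)
    let ?g = "\<lambda>w. iter_deriv f (us @ w # vs)"
    show ?case
    proof (rule linearI)
      fix w w' :: 'a and c :: real
      have "((\<lambda>z. ?g w z + ?g w' z) has_derivative (\<lambda>e. dir_deriv (?g w) e x + dir_deriv (?g w') e x)) (at x)"
        by (intro has_derivative_add has_derivative_dir_deriv diff Cons)
      then have "(?g (w + w') has_derivative (\<lambda>e. dir_deriv (?g w) e x + dir_deriv (?g w') e x)) (at x)"
        by (rule has_derivative_transform_within_open[OF _ S Cons.prems]) (simp add: linear_add[OF Cons.IH])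
      then show "iter_deriv f ((u # us) @ (w + w') # vs) x
          = iter_deriv f ((u # us) @ w # vs) x + iter_deriv f ((u # us) @ w' # vs) x"
        by (simp add: dir_deriv_eq)
      have "((\<lambda>z. c *\<^sub>R ?g w z) has_derivative (\<lambda>e. c *\<^sub>R dir_deriv (?g w) e x)) (at x)"
        by (intro has_derivative_scaleR_right has_derivative_dir_deriv diff Cons)
      then have "(?g (c *\<^sub>R w) has_derivative (\<lambda>e. c *\<^sub>R dir_deriv (?g w) e x)) (at x)"
        by (rule has_derivative_transform_within_open[OF _ S Cons.prems]) (simp add: linear_scale[OF Cons.IH])
      then show "iter_deriv f ((u # us) @ (c *\<^sub>R w) # vs) x = c *\<^sub>R iter_deriv f ((u # us) @ w # vs) x"
        by (simp add: dir_deriv_eq)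
    qed
  qed
  have bound: "\<exists>C. \<forall>vs. length vs = n \<longrightarrow> norm (iter_deriv f vs x) \<le> C * (\<Prod>v\<leftarrow>vs. norm v)" if x: "x \<in> S" for x n
  proof -
    obtain r C where r: "r > 0" "\<And>g y. g \<in> F n \<Longrightarrow> y \<in> ball x r \<Longrightarrow> norm (g y) \<le> C"
      by (rule locally_equiboundedE[OF equi_diff_locally_equibounded[OF F[of 0 n]] S x]) blast
    have "norm (iter_deriv f vs x) \<le> C * (\<Prod>v\<leftarrow>vs. norm v)" if "length vs = n" for vs
    proof -
      have "norm (iter_deriv f (map sgn vs) x) \<le> C" using r sgn_F[of vs] that by auto
      then have "(\<Prod>v\<leftarrow>vs. norm v) * norm (iter_deriv f (map sgn vs) x) \<le> (\<Prod>v\<leftarrow>vs. norm v) * C"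
        by (intro mult_left_mono prod_list_norm_nonneg)
      then show ?thesis
        by (subst iter_sgn[OF x]) (simp add: prod_list_norm_nonneg abs_of_nonneg mult.commute[of C])
    qed
    then show ?thesis by blast
  qed
  have rem: "\<exists>d>0. \<forall>y\<in>S. norm (y - x) < d \<longrightarrow> (\<forall>vs. length vs = n \<longrightarrow>
      norm (iter_deriv f vs y - iter_deriv f vs x - iter_deriv f ((y - x) # vs) x)
        \<le> e * norm (y - x) * (\<Prod>v\<leftarrow>vs. norm v))" if x: "x \<in> S" and e: "e > 0" for x n e
  proof -
    obtain r C where r: "r > 0" "C \<ge> 0" "\<And>g y. g \<in> F n \<Longrightarrow> y \<in> ball x r \<Longrightarrow>
      norm (g y - g x - dir_deriv g (y - x) x) \<le> C * (norm (y - x))\<^sup>2"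
      by (rule equi_quadratic_remainder[OF S x F[of _ n]]) blast
    \<comment> \<open>Makes \<open>C * norm (y - x)\<close> at most \<open>e\<close>, which turns
      the quadratic remainder into the required linear one.\<close>
    define d where "d = min r (e / (C + 1))"
    have "d > 0" using r e by (simp add: d_def)
    moreover have "norm (iter_deriv f vs y - iter_deriv f vs x - iter_deriv f ((y - x) # vs) x)
        \<le> e * norm (y - x) * (\<Prod>v\<leftarrow>vs. norm v)" if y: "y \<in> S" "norm (y - x) < d" "length vs = n" for y vs
    proof -
      let ?p = "\<Prod>v\<leftarrow>vs. norm v" and ?g = "iter_deriv f (map sgn vs)"
      have "norm (y - x) * (C + 1) \<le> e" using y(2) r(2) by (simp add: d_def pos_less_divide_eq less_imp_le)
      moreover have "norm (y - x) * (C + 1) = C * norm (y - x) + norm (y - x)" by (simp add: algebra_simps)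
      ultimately have Ce: "C * norm (y - x) \<le> e" using norm_ge_zero[of "y - x"] by linarith
      have "norm (?g y - ?g x - dir_deriv ?g (y - x) x) \<le> C * (norm (y - x))\<^sup>2"
        by (rule r(3)) (use sgn_F[of vs] y in \<open>auto simp: d_def dist_norm norm_minus_commute\<close>)
      also have "\<dots> = (C * norm (y - x)) * norm (y - x)" by (simp add: power2_eq_square)
      also have "\<dots> \<le> e * norm (y - x)" by (intro mult_right_mono Ce) simp
      finally have "?p * norm (?g y - ?g x - dir_deriv ?g (y - x) x) \<le> ?p * (e * norm (y - x))"
        by (intro mult_left_mono prod_list_norm_nonneg)
      moreover have "iter_deriv f vs y - iter_deriv f vs x - iter_deriv f ((y - x) # vs) x
          = ?p *\<^sub>R (?g y - ?g x - dir_deriv ?g (y - x) x)"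
        using iter_sgn[OF x, of vs] iter_sgn[OF y(1), of vs] deriv_sgn[OF x, of vs "y - x"]
        by (simp add: scaleR_diff_right)
      ultimately show ?thesis by (simp add: prod_list_norm_nonneg abs_of_nonneg mult_ac)
    qed
    ultimately show ?thesis by blast
  qed
  show ?thesis
    unfolding smooth_on_def
    by (intro conjI S exI[of _ "\<lambda>x vs. iter_deriv f vs x"] ballI allI impI bound rem linear_iter) auto
qed

lemma smooth_on_iff_equi_diff: "smooth_on S f \<longleftrightarrow> open S \<and> (\<forall>n. equi_diff n S {f})"
proof
  show "open S \<and> (\<forall>n. equi_diff n S {f})" if "smooth_on S f"
    using that smooth_on_imp_equi_diff[OF that] by (simp add: smooth_on_def)
qed (use equi_diff_imp_smooth_on in blast)

section \<open>Brackets and torsion in a chart\<close>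

lemma related_dir_deriv:
  fixes X :: "'a::real_normed_vector \<Rightarrow> 'c::real_normed_vector" and X' :: "'b::real_normed_vector \<Rightarrow> 'd::real_normed_vector"
  assumes U: "open U" and x: "x \<in> U"
    and \<phi>: "(\<phi> has_derivative \<phi>') (at x)"
    and R: "R differentiable (at x)" and X: "X differentiable (at x)" and X': "X' differentiable (at (\<phi> x))"
    and rel: "\<And>y. y \<in> U \<Longrightarrow> X' (\<phi> y) = blinfun_apply (R y) (X y)"
  shows "dir_deriv X' (\<phi>' d) (\<phi> x) = dir_deriv R d x (X x) + R x (dir_deriv X d x)"
proof -
  have "((\<lambda>y. R y (X y)) has_derivative (\<lambda>d. R x (dir_deriv X d x) + dir_deriv R d x (X x))) (at x)"
    by (intro bounded_bilinear.FDERIV[OF bounded_bilinear_blinfun_apply] has_derivative_dir_deriv R X)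
  then have "((\<lambda>y. X' (\<phi> y)) has_derivative (\<lambda>d. R x (dir_deriv X d x) + dir_deriv R d x (X x))) (at x)"
    by (rule has_derivative_transform_within_open[OF _ U x]) (simp add: rel)
  moreover have "((\<lambda>y. X' (\<phi> y)) has_derivative (\<lambda>d. dir_deriv X' (\<phi>' d) (\<phi> x))) (at x)"
    by (rule has_derivative_compose[OF \<phi> has_derivative_dir_deriv[OF X']])
  ultimately have "(\<lambda>d. dir_deriv X' (\<phi>' d) (\<phi> x)) = (\<lambda>d. R x (dir_deriv X d x) + dir_deriv R d x (X x))"
    by (rule has_derivative_unique[rotated])
  then show ?thesis by (simp add: fun_eq_iff add.commute)
qed

definition flat_bracket :: "('a::real_normed_vector \<Rightarrow> 'a) \<Rightarrow> ('a \<Rightarrow> 'a) \<Rightarrow> 'a \<Rightarrow> 'a" where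
  "flat_bracket X Y x = dir_deriv Y (X x) x - dir_deriv X (Y x) x"

locale twice_differentiable =
  fixes U :: "'a::real_normed_vector set" and \<phi> :: "'a \<Rightarrow> 'b::real_normed_vector" and x :: 'a
  assumes U: "open U" and x: "x \<in> U"
    and first: "\<And>y. y \<in> U \<Longrightarrow> \<phi> differentiable (at y)"
    and second: "bderiv \<phi> differentiable (at x)"
begin

lemma has_first: "y \<in> U \<Longrightarrow> (\<phi> has_derivative blinfun_apply (bderiv \<phi> y)) (at y)"
  by (rule has_derivative_bderiv[OF first])

lemma symmetric:
  "blinfun_apply (dir_deriv (bderiv \<phi>) u x) v = blinfun_apply (dir_deriv (bderiv \<phi>) v x) u"
  by (rule symmetric_second_derivative[OF U x has_first has_derivative_dir_deriv[OF second]])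

text \<open>Differentiating the two relations yields second derivatives of \<phi> at
  \<open>(X x, Y x)\<close> and \<open>(Y x, X x)\<close>, which cancel by symmetry.\<close>

lemma flat_bracket_related:
  assumes "X differentiable (at x)" "Y differentiable (at x)"
    and "X' differentiable (at (\<phi> x))" "Y' differentiable (at (\<phi> x))"
    and relX: "\<And>y. y \<in> U \<Longrightarrow> X' (\<phi> y) = bderiv \<phi> y (X y)"
    and relY: "\<And>y. y \<in> U \<Longrightarrow> Y' (\<phi> y) = bderiv \<phi> y (Y y)"
  shows "flat_bracket X' Y' (\<phi> x) = bderiv \<phi> x (flat_bracket X Y x)"
  using related_dir_deriv[OF U x has_first[OF x] second assms(1,3) relX, of "Y x"]
    related_dir_deriv[OF U x has_first[OF x] second assms(2,4) relY, of "X x"]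
    symmetric[of "X x" "Y x"] relX[OF x] relY[OF x]
  by (simp add: flat_bracket_def blinfun.diff_right)

end

locale intertwined_fields = twice_differentiable U \<pi> x
  for U :: "'a::real_normed_vector set" and \<pi> :: "'a \<Rightarrow> 'b::real_normed_vector" and x +
  fixes J :: "'b \<Rightarrow> 'b \<Rightarrow>\<^sub>L 'b"
  assumes J: "J differentiable (at (\<pi> x))"
begin

abbreviation "P \<equiv> bderiv \<pi>"
abbreviation "P2 \<equiv> \<lambda>d. dir_deriv (bderiv \<pi>) d x"

text \<open>Both sides of \<open>rel\<close> are differentiated at \<open>x\<close> and the result
  is solved for the derivative of \<open>J\<close>, which thereby becomes computable from the fields
  upstairs in all directions \<open>P x d\<close>.\<close>

lemma intertwining_dir_deriv:
  assumes a: "a differentiable (at x)" and a': "a' differentiable (at x)"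
    and rel: "\<And>y. y \<in> U \<Longrightarrow> J (\<pi> y) (P y (a y)) = P y (a' y)"
  shows "dir_deriv J (P x d) (\<pi> x) (P x (a x)) =
    P2 d (a' x) + P x (dir_deriv a' d x) - J (\<pi> x) (P2 d (a x) + P x (dir_deriv a d x))"
proof -
  have DP: "(P has_derivative P2) (at x)" by (rule has_derivative_dir_deriv[OF second])
  have J\<pi>: "((\<lambda>y. J (\<pi> y)) has_derivative (\<lambda>d. dir_deriv J (P x d) (\<pi> x))) (at x)"
    by (rule has_derivative_compose[OF has_first[OF x] has_derivative_dir_deriv[OF J]])
  have Pa: "((\<lambda>y. P y (a y)) has_derivative (\<lambda>d. P x (dir_deriv a d x) + P2 d (a x))) (at x)"
    by (intro bounded_bilinear.FDERIV[OF bounded_bilinear_blinfun_apply] DP has_derivative_dir_deriv[OF a])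
  have "((\<lambda>y. J (\<pi> y) (P y (a y))) has_derivative
      (\<lambda>d. J (\<pi> x) (P x (dir_deriv a d x) + P2 d (a x)) + dir_deriv J (P x d) (\<pi> x) (P x (a x)))) (at x)"
    by (rule bounded_bilinear.FDERIV[OF bounded_bilinear_blinfun_apply J\<pi> Pa])
  then have "((\<lambda>y. P y (a' y)) has_derivative
      (\<lambda>d. J (\<pi> x) (P x (dir_deriv a d x) + P2 d (a x)) + dir_deriv J (P x d) (\<pi> x) (P x (a x)))) (at x)"
    by (rule has_derivative_transform_within_open[OF _ U x]) (simp add: rel)
  moreover have "((\<lambda>y. P y (a' y)) has_derivative (\<lambda>d. P x (dir_deriv a' d x) + P2 d (a' x))) (at x)"
    by (intro bounded_bilinear.FDERIV[OF bounded_bilinear_blinfun_apply] DP has_derivative_dir_deriv[OF a'])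
  ultimately have "(\<lambda>d. J (\<pi> x) (P x (dir_deriv a d x) + P2 d (a x)) + dir_deriv J (P x d) (\<pi> x) (P x (a x)))
      = (\<lambda>d. P x (dir_deriv a' d x) + P2 d (a' x))"
    by (rule has_derivative_unique)
  from fun_cong[OF this, of d] show ?thesis by (simp add: algebra_simps)
qed

text \<open>Both terms of a torsion that involve derivatives of \<open>X\<close> and \<open>Y\<close> cancel, leaving an expression
  in the derivative of \<open>J\<close>, which the fields \<open>a, b, a', b'\<close> upstairs compute.\<close>

lemma torsion_eq:
  assumes a: "a differentiable (at x)" and a': "a' differentiable (at x)"
    and b: "b differentiable (at x)" and b': "b' differentiable (at x)"
    and rela: "\<And>y. y \<in> U \<Longrightarrow> J (\<pi> y) (P y (a y)) = P y (a' y)"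
    and relb: "\<And>y. y \<in> U \<Longrightarrow> J (\<pi> y) (P y (b y)) = P y (b' y)"
    and sq: "\<And>w. J (\<pi> x) (J (\<pi> x) w) = - w"
    and X: "X differentiable (at (\<pi> x))" and Y: "Y differentiable (at (\<pi> x))"
    and Xa: "X (\<pi> x) = P x (a x)" and Yb: "Y (\<pi> x) = P x (b x)"
  shows "J (\<pi> x) (flat_bracket (\<lambda>y. J y (X y)) Y (\<pi> x)) + J (\<pi> x) (flat_bracket X (\<lambda>y. J y (Y y)) (\<pi> x))
      - flat_bracket (\<lambda>y. J y (X y)) (\<lambda>y. J y (Y y)) (\<pi> x) + flat_bracket X Y (\<pi> x)
    = J (\<pi> x) (P x (flat_bracket a' b x)) + J (\<pi> x) (P x (flat_bracket a b' x))
      - P x (flat_bracket a' b' x) + P x (flat_bracket a b x)"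
proof -
  have JX: "dir_deriv (\<lambda>y. J y (X y)) d (\<pi> x) = J (\<pi> x) (dir_deriv X d (\<pi> x)) + dir_deriv J d (\<pi> x) (X (\<pi> x))"
    if "X differentiable (at (\<pi> x))" for X d
    by (rule dir_deriv_eq, rule bounded_bilinear.FDERIV[OF bounded_bilinear_blinfun_apply])
       (intro has_derivative_dir_deriv J that)+
  have lin: "linear (\<lambda>d. dir_deriv X d (\<pi> x))" if "X differentiable (at (\<pi> x))" for X :: "'b \<Rightarrow> 'b"
    by (rule linear_dir_deriv[OF that])
  show ?thesis
    \<comment> \<open>The torsion contains the derivative of \<open>J\<close> in the directions
      \<open>Y\<close>, \<open>X\<close>, \<open>JX\<close> and \<open>JY\<close>, which are the
      images under \<open>P x\<close> of \<open>b x\<close>, \<open>a x\<close>, \<open>a' x\<close>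
      and \<open>b' x\<close>. The second derivatives of \<pi> cancel by symmetry, those terms with
      derivatives of \<open>X\<close> and \<open>Y\<close> that carry \<open>J\<close> twice by
      \<open>sq\<close>.\<close>
    unfolding flat_bracket_def JX[OF X] JX[OF Y] Xa Yb rela[OF x] relb[OF x]
    using intertwining_dir_deriv[OF a a' rela, of "b x"] intertwining_dir_deriv[OF b b' relb, of "a x"]
      intertwining_dir_deriv[OF b b' relb, of "a' x"] intertwining_dir_deriv[OF a a' rela, of "b' x"]
      symmetric[of "a x" "b x"] symmetric[of "a x" "b' x"] symmetric[of "a' x" "b x"] symmetric[of "a' x" "b' x"]
    by (simp add: blinfun.diff_right blinfun.add_right sq)
qed

text \<open>Along a vertical field the base point does not move to first order, so the derivative of
  \<open>J\<close> drops out of the intertwining identity.\<close>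

lemma vertical_bracket_eq:
  assumes a: "a differentiable (at x)" and a': "a' differentiable (at x)" and k: "k differentiable (at x)"
    and rel: "\<And>y. y \<in> U \<Longrightarrow> J (\<pi> y) (P y (a y)) = P y (a' y)"
    and vert: "\<And>y. y \<in> U \<Longrightarrow> P y (k y) = 0"
  shows "J (\<pi> x) (P x (flat_bracket k a x)) = P x (flat_bracket k a' x)"
proof -
  have "((\<lambda>y. P y (k y)) has_derivative (\<lambda>d. P x (dir_deriv k d x) + P2 d (k x))) (at x)"
    by (intro bounded_bilinear.FDERIV[OF bounded_bilinear_blinfun_apply] has_derivative_dir_deriv second k)
  then have "((\<lambda>y. 0) has_derivative (\<lambda>d. P x (dir_deriv k d x) + P2 d (k x))) (at x)"
    by (rule has_derivative_transform_within_open[OF _ U x]) (simp add: vert)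
  then have "(\<lambda>d. P x (dir_deriv k d x) + P2 d (k x)) = (\<lambda>d. 0)"
    by (rule has_derivative_unique) (rule has_derivative_const)
  from fun_cong[OF this] have "P x (dir_deriv k d x) = - P2 d (k x)" for d
    by (simp add: eq_neg_iff_add_eq_0)
  then have Pk: "P x (dir_deriv k d x) = - P2 (k x) d" for d
    using symmetric[of d "k x"] by simp
  have "dir_deriv J 0 (\<pi> x) = 0" using linear_0[OF linear_dir_deriv[OF J]] .
  then have "J (\<pi> x) (P2 (k x) (a x) + P x (dir_deriv a (k x) x)) = P2 (k x) (a' x) + P x (dir_deriv a' (k x) x)"
    using intertwining_dir_deriv[OF a a' rel, of "k x"] vert[OF x] by simp
  then show ?thesis by (simp add: flat_bracket_def blinfun.diff_right Pk add.commute)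
qed

end

text \<open>Vertical fields are those related to the zero field.\<close>

lemma (in twice_differentiable) vertical_bracket_vertical:
  assumes k: "k differentiable (at x)" and l: "l differentiable (at x)"
    and vert: "\<And>y. y \<in> U \<Longrightarrow> bderiv \<phi> y (k y) = 0" "\<And>y. y \<in> U \<Longrightarrow> bderiv \<phi> y (l y) = 0"
  shows "bderiv \<phi> x (flat_bracket k l x) = 0"
  using flat_bracket_related[OF k l, of "\<lambda>y. 0" "\<lambda>y. 0"] vert by (simp add: flat_bracket_def)

section \<open>Differentials on Banach manifolds\<close>

text \<open>Charts are pairs, and splitting them would keep the rules on charts from applying.\<close>

declare split_paired_All [simp del] split_paired_Ex [simp del]

locale banach_mfd =
  fixes M :: "('m, 'e::banach) mfd"
  assumes banach_manifold: "banach_manifold M"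
begin

lemma chart_at_pt:
  assumes "p \<in> pts M" obtains c where "c \<in> charts_at M p"
  using assms banach_manifold unfolding banach_manifold_def charts_at_def by blast

lemma openin_chart_dom: "c \<in> atlas M \<Longrightarrow> openin (mfd_topology M) (chart_dom c)"
  and open_chart_image: "c \<in> atlas M \<Longrightarrow> open (chart_map c ` chart_dom c)"
  and chart_homeomorphic: "c \<in> atlas M \<Longrightarrow>
    homeomorphic_map (subtopology (mfd_topology M) (chart_dom c)) (top_of_set (chart_map c ` chart_dom c)) (chart_map c)"
  using banach_manifold unfolding banach_manifold_def by auto

lemma chart_dom_subset: "c \<in> atlas M \<Longrightarrow> chart_dom c \<subseteq> pts M"
  using openin_chart_dom openin_subset by blast

lemma topspace_chart: "c \<in> atlas M \<Longrightarrow> topspace (subtopology (mfd_topology M) (chart_dom c)) = chart_dom c"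
  unfolding topspace_subtopology using chart_dom_subset by blast

lemma inj_on_chart: "c \<in> atlas M \<Longrightarrow> inj_on (chart_map c) (chart_dom c)"
  using homeomorphic_imp_injective_map[OF chart_homeomorphic] topspace_chart by metis

lemma chart_inv_chart: "c \<in> atlas M \<Longrightarrow> q \<in> chart_dom c \<Longrightarrow> chart_inv c (chart_map c q) = q"
  unfolding chart_inv_def by (rule inv_into_f_f[OF inj_on_chart])

lemma chart_inv_dom: "x \<in> chart_map c ` chart_dom c \<Longrightarrow> chart_inv c x \<in> chart_dom c"
  unfolding chart_inv_def by (rule inv_into_into)

lemma chart_chart_inv: "x \<in> chart_map c ` chart_dom c \<Longrightarrow> chart_map c (chart_inv c x) = x"
  unfolding chart_inv_def by (rule f_inv_into_f)

lemma open_chart_image_openin: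
  assumes c: "c \<in> atlas M" and V: "openin (mfd_topology M) V"
  shows "open (chart_map c ` (chart_dom c \<inter> V))"
proof -
  have "openin (subtopology (mfd_topology M) (chart_dom c)) (chart_dom c \<inter> V)"
    using V by (simp add: openin_subtopology_Int2)
  then have "openin (top_of_set (chart_map c ` chart_dom c)) (chart_map c ` (chart_dom c \<inter> V))"
    using homeomorphic_imp_open_map[OF chart_homeomorphic[OF c]] unfolding open_map_def by blast
  then show ?thesis using openin_open_trans open_chart_image[OF c] by blast
qed

lemma openin_chart_vimage:
  assumes c: "c \<in> atlas M" and W: "open W"
  shows "openin (mfd_topology M) {q \<in> chart_dom c. chart_map c q \<in> W}"
proof -
  have "continuous_map (subtopology (mfd_topology M) (chart_dom c)) euclidean (chart_map c)"
    using homeomorphic_imp_continuous_map[OF chart_homeomorphic[OF c]] by (rule continuous_map_into_fulltopology)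
  from openin_continuous_map_preimage[OF this, of W]
  have "openin (subtopology (mfd_topology M) (chart_dom c)) {q \<in> chart_dom c. chart_map c q \<in> W}"
    using W unfolding topspace_chart[OF c] by simp
  then show ?thesis by (rule openin_trans_full[OF _ openin_chart_dom[OF c]])
qed

lemma charts_atD: "c \<in> charts_at M p \<Longrightarrow> c \<in> atlas M" "c \<in> charts_at M p \<Longrightarrow> p \<in> chart_dom c"
  by (auto simp: charts_at_def)

lemma transition_smooth:
  assumes "c \<in> atlas M" "d \<in> atlas M"
  shows "smooth_on (chart_map c ` (chart_dom c \<inter> chart_dom d)) (chart_map d \<circ> chart_inv c)"
  using banach_manifold assms unfolding banach_manifold_def by blast

end

text \<open>A first derivative at one point suffices for \<open>differential\<close> to be
  functorial, and it is what gets established for the translations of \<open>Q\<close>. Continuity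
  is required globally so that chart domains have open preimages.\<close>

definition mdiff :: "('m, 'e::banach) mfd \<Rightarrow> ('n, 'f::banach) mfd \<Rightarrow> ('m \<Rightarrow> 'n) \<Rightarrow> 'm \<Rightarrow> bool" where
  "mdiff M N f p \<longleftrightarrow> p \<in> pts M \<and> continuous_map (mfd_topology M) (mfd_topology N) f \<and>
     (\<forall>c\<in>charts_at M p. \<forall>d\<in>charts_at N (f p). (chart_map d \<circ> f \<circ> chart_inv c) differentiable (at (chart_map c p)))"

text \<open>For a chart \<open>c\<close> at \<open>p\<close> this is the inverse of the coordinate
  map v \<mapsto> v c on the tangent space.\<close>

definition tvec_of :: "('m, 'e::banach) mfd \<Rightarrow> 'm \<Rightarrow> ('m, 'e) chart \<Rightarrow> 'e \<Rightarrow> ('m, 'e) tvec" where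
  "tvec_of M p c w = (\<lambda>d. if d \<in> charts_at M p
     then dir_deriv (chart_map d \<circ> chart_inv c) w (chart_map c p) else 0)"

lemma mdiff_pts: "mdiff M N f p \<Longrightarrow> f p \<in> pts N"
  unfolding mdiff_def continuous_map_def by (metis PiE)

lemma smooth_on_differentiable: "smooth_on S f \<Longrightarrow> x \<in> S \<Longrightarrow> f differentiable (at x)"
  using smooth_on_imp_equi_diff[of S f "Suc 0"] by simp

lemma (in banach_mfd) smooth_map_mdiff:
  assumes f: "smooth_map M N f" and p: "p \<in> pts M"
  shows "mdiff M N f p"
  unfolding mdiff_def
proof (intro conjI ballI)
  fix c d assume cd: "c \<in> charts_at M p" "d \<in> charts_at N (f p)"
  then have "smooth_on (chart_map c ` (chart_dom c \<inter> f -` chart_dom d)) (chart_map d \<circ> f \<circ> chart_inv c)"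
    using f unfolding smooth_map_def charts_at_def by blast
  then show "(chart_map d \<circ> f \<circ> chart_inv c) differentiable (at (chart_map c p))"
    by (rule smooth_on_differentiable) (use cd in \<open>auto simp: charts_at_def\<close>)
qed (use assms in \<open>auto simp: smooth_map_def\<close>)

text \<open>The composite of the local maps agrees with the local map of the composite only where
  \<open>f\<close> lands in the domain of \<open>d\<close>, an open set by continuity. With an
  identity map as one factor, this also gives all the change-of-chart rules below.\<close>

lemma (in banach_mfd) mdiff_comp_chart:
  assumes N: "banach_mfd N" and f: "mdiff M N f p" and g: "mdiff N P g (f p)"
    and c: "c \<in> charts_at M p" and d: "d \<in> charts_at N (f p)" and e: "e \<in> charts_at P (g (f p))"
  shows "((chart_map e \<circ> (g \<circ> f) \<circ> chart_inv c) has_derivative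
    (\<lambda>w. dir_deriv (chart_map e \<circ> g \<circ> chart_inv d) (dir_deriv (chart_map d \<circ> f \<circ> chart_inv c) w (chart_map c p))
      (chart_map d (f p)))) (at (chart_map c p))"
proof -
  interpret N: banach_mfd N by fact
  let ?f = "chart_map d \<circ> f \<circ> chart_inv c" and ?g = "chart_map e \<circ> g \<circ> chart_inv d" and ?x = "chart_map c p"
  note c' = charts_atD[OF c] and d' = N.charts_atD[OF d]
  have fx: "?f ?x = chart_map d (f p)" using chart_inv_chart[OF c'] by simp
  define V where "V = {q \<in> pts M. f q \<in> chart_dom d}"
  have V: "openin (mfd_topology M) V"
    unfolding V_def using f N.openin_chart_dom[OF d'(1)]
    by (intro openin_continuous_map_preimage) (auto simp: mdiff_def)
  have "((?g \<circ> ?f) has_derivative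
      (\<lambda>w. dir_deriv ?g w (chart_map d (f p))) \<circ> (\<lambda>w. dir_deriv ?f w ?x)) (at ?x)"
  proof (rule diff_chain_at)
    show "(?f has_derivative (\<lambda>w. dir_deriv ?f w ?x)) (at ?x)"
      by (rule has_derivative_dir_deriv) (use f c d in \<open>auto simp: mdiff_def\<close>)
    show "(?g has_derivative (\<lambda>w. dir_deriv ?g w (chart_map d (f p)))) (at (?f ?x))"
      unfolding fx by (rule has_derivative_dir_deriv) (use g d e in \<open>auto simp: mdiff_def\<close>)
  qed
  moreover have "(\<lambda>w. dir_deriv ?g w (chart_map d (f p))) \<circ> (\<lambda>w. dir_deriv ?f w ?x)
      = (\<lambda>w. dir_deriv ?g (dir_deriv ?f w ?x) (chart_map d (f p)))" by (rule ext) simp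
  ultimately have "((?g \<circ> ?f) has_derivative (\<lambda>w. dir_deriv ?g (dir_deriv ?f w ?x) (chart_map d (f p)))) (at ?x)"
    by simp
  then show ?thesis
  proof (rule has_derivative_transform_within_open)
    show "open (chart_map c ` (chart_dom c \<inter> V))" by (rule open_chart_image_openin[OF c'(1) V])
    show "?x \<in> chart_map c ` (chart_dom c \<inter> V)"
      using c' d' f by (auto simp: V_def mdiff_def)
    fix y assume "y \<in> chart_map c ` (chart_dom c \<inter> V)"
    then obtain q where q: "q \<in> chart_dom c" "q \<in> V" "y = chart_map c q" by blast
    then show "(?g \<circ> ?f) y = (chart_map e \<circ> (g \<circ> f) \<circ> chart_inv c) y"
      using chart_inv_chart[OF c'(1) q(1)] N.chart_inv_chart[OF d'(1)] by (simp add: V_def)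
  qed
qed

lemma (in banach_mfd) mdiff_comp:
  assumes N: "banach_mfd N" and f: "mdiff M N f p" and g: "mdiff N P g (f p)"
  shows "mdiff M P (g \<circ> f) p"
  unfolding mdiff_def
proof (intro conjI ballI)
  show "p \<in> pts M" using f by (simp add: mdiff_def)
  show "continuous_map (mfd_topology M) (mfd_topology P) (g \<circ> f)"
    using f g by (auto simp: mdiff_def intro: continuous_map_compose)
  obtain d where d: "d \<in> charts_at N (f p)"
    using banach_mfd.chart_at_pt[OF N mdiff_pts[OF f]] by blast
  fix c e assume c: "c \<in> charts_at M p" and e: "e \<in> charts_at P ((g \<circ> f) p)"
  have "e \<in> charts_at P (g (f p))" using e by simp
  from mdiff_comp_chart[OF N f g c d this]
  show "(chart_map e \<circ> (g \<circ> f) \<circ> chart_inv c) differentiable (at (chart_map c p))"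
    unfolding differentiable_def by blast
qed

lemma (in banach_mfd) mdiff_id: "p \<in> pts M \<Longrightarrow> mdiff M M id p"
  unfolding mdiff_def
proof (intro conjI ballI)
  fix c d assume "c \<in> charts_at M p" "d \<in> charts_at M (id p)"
  then show "(chart_map d \<circ> id \<circ> chart_inv c) differentiable (at (chart_map c p))"
    using smooth_on_differentiable[OF transition_smooth, of c d "chart_map c p"] by (auto simp: charts_at_def)
qed auto

lemma (in banach_mfd) mdiff_cong:
  assumes f: "mdiff M N f p" and eq: "\<And>q. q \<in> pts M \<Longrightarrow> f q = g q"
  shows "mdiff M N g p" "differential M N g p v = differential M N f p v"
proof -
  have p: "p \<in> pts M" using f by (simp add: mdiff_def)
  have D: "((chart_map d \<circ> g \<circ> chart_inv c) has_derivative (\<lambda>w. dir_deriv (chart_map d \<circ> f \<circ> chart_inv c) w (chart_map c p))) (at (chart_map c p))"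
    if c: "c \<in> charts_at M p" and d: "d \<in> charts_at N (f p)" for c d
  proof (rule has_derivative_transform_within_open)
    show "((chart_map d \<circ> f \<circ> chart_inv c) has_derivative (\<lambda>w. dir_deriv (chart_map d \<circ> f \<circ> chart_inv c) w (chart_map c p))) (at (chart_map c p))"
      by (rule has_derivative_dir_deriv) (use f c d in \<open>auto simp: mdiff_def\<close>)
    show "open (chart_map c ` chart_dom c)" "chart_map c p \<in> chart_map c ` chart_dom c"
      using open_chart_image charts_atD[OF c] by auto
    show "(chart_map d \<circ> f \<circ> chart_inv c) x = (chart_map d \<circ> g \<circ> chart_inv c) x"
      if "x \<in> chart_map c ` chart_dom c" for x
      using chart_inv_dom[OF that] chart_dom_subset[OF charts_atD(1)[OF c]] eq by auto
  qed
  show "mdiff M N g p"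
    unfolding mdiff_def
  proof (intro conjI ballI p)
    show "continuous_map (mfd_topology M) (mfd_topology N) g"
      using f eq by (auto simp: mdiff_def intro: continuous_map_eq)
    show "(chart_map d \<circ> g \<circ> chart_inv c) differentiable (at (chart_map c p))"
      if "c \<in> charts_at M p" "d \<in> charts_at N (g p)" for c d
      using D[OF that(1), of d] that eq[OF p] by (auto simp: differentiable_def)
  qed
  obtain c0 where "c0 \<in> charts_at M p" using chart_at_pt[OF p] by blast
  then have c: "(SOME c. c \<in> charts_at M p) \<in> charts_at M p" by (rule someI)
  show "differential M N g p v = differential M N f p v"
  proof
    fix d
    show "differential M N g p v d = differential M N f p v d"
    proof (cases "d \<in> charts_at N (f p)")
      case True
      then show ?thesis
        unfolding differential_def Let_def using dir_deriv_eq[OF D[OF c True]] eq[OF p] by simp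
    next
      case False
      then show ?thesis using eq[OF p] by (simp add: differential_def)
    qed
  qed
qed

section \<open>Tangent spaces and functoriality of differentials\<close>

lemma tspaceD:
  "v \<in> tspace M p \<Longrightarrow> c \<in> charts_at M p \<Longrightarrow> d \<in> charts_at M p \<Longrightarrow>
    v d = dir_deriv (chart_map d \<circ> chart_inv c) (v c) (chart_map c p)"
  "v \<in> tspace M p \<Longrightarrow> c \<notin> charts_at M p \<Longrightarrow> v c = 0"
  unfolding tspace_def by blast+

lemma tspaceI:
  "(\<And>c d. c \<in> charts_at M p \<Longrightarrow> d \<in> charts_at M p \<Longrightarrow>
    v d = dir_deriv (chart_map d \<circ> chart_inv c) (v c) (chart_map c p)) \<Longrightarrow>
  (\<And>c. c \<notin> charts_at M p \<Longrightarrow> v c = 0) \<Longrightarrow> v \<in> tspace M p"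
  unfolding tspace_def by blast

lemma (in banach_mfd) tspace_eqI:
  assumes v: "v \<in> tspace M p" and w: "w \<in> tspace M p" and c: "c \<in> charts_at M p" and eq: "v c = w c"
  shows "v = w"
proof
  fix d
  show "v d = w d"
  proof (cases "d \<in> charts_at M p")
    case True
    then show ?thesis using tspaceD(1)[OF v c] tspaceD(1)[OF w c] eq by simp
  next
    case False
    then show ?thesis using tspaceD(2)[OF v] tspaceD(2)[OF w] by simp
  qed
qed

text \<open>The chain rule for the identity followed by the identity, read in three charts.\<close>

lemma (in banach_mfd) transition_cocycle:
  assumes c: "c \<in> charts_at M p" and d: "d \<in> charts_at M p" and e: "e \<in> charts_at M p"
  shows "dir_deriv (chart_map e \<circ> chart_inv d) (dir_deriv (chart_map d \<circ> chart_inv c) w (chart_map c p)) (chart_map d p)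
    = dir_deriv (chart_map e \<circ> chart_inv c) w (chart_map c p)"
proof -
  have p: "p \<in> pts M" using chart_dom_subset charts_atD[OF c] by blast
  have id: "mdiff M M id (id p)" "mdiff M M id p" using mdiff_id[OF p] by auto
  have e': "e \<in> charts_at M (id (id p))" and d': "d \<in> charts_at M (id p)" using d e by auto
  show ?thesis
    using dir_deriv_eq[OF mdiff_comp_chart[OF banach_mfd_axioms id(2) id(1) c d' e'], of w]
    unfolding id_comp comp_id by (simp only: id_apply)
qed

lemma (in banach_mfd) transition_self:
  assumes c: "c \<in> charts_at M p"
  shows "dir_deriv (chart_map c \<circ> chart_inv c) w (chart_map c p) = w"
proof (rule dir_deriv_eq)
  show "((chart_map c \<circ> chart_inv c) has_derivative (\<lambda>w. w)) (at (chart_map c p))"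
  proof (rule has_derivative_transform_within_open[OF has_derivative_ident open_chart_image[OF charts_atD(1)[OF c]]])
    show "chart_map c p \<in> chart_map c ` chart_dom c" using charts_atD(2)[OF c] by simp
    show "x = (chart_map c \<circ> chart_inv c) x" if "x \<in> chart_map c ` chart_dom c" for x
      using chart_chart_inv[OF that] by simp
  qed
qed

lemma (in banach_mfd) tvec_of_tspace:
  assumes c: "c \<in> charts_at M p"
  shows "tvec_of M p c w \<in> tspace M p" "tvec_of M p c w c = w"
proof -
  show "tvec_of M p c w \<in> tspace M p"
    unfolding tspace_def tvec_of_def using transition_cocycle[OF c] by auto
  show "tvec_of M p c w c = w" unfolding tvec_of_def using c transition_self[OF c] by auto
qed

lemma (in banach_mfd) tvec_of_coord:
  assumes c: "c \<in> charts_at M p" and v: "v \<in> tspace M p"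
  shows "tvec_of M p c (v c) = v"
  by (rule tspace_eqI[OF tvec_of_tspace(1)[OF c] v c tvec_of_tspace(2)[OF c]])

text \<open>\<open>differential\<close> uses an arbitrarily selected chart \<open>c'\<close>; the
  chain rule for \<open>f\<close> after the identity, read in \<open>c'\<close> and
  \<open>c\<close>, compares it with \<open>c\<close>.\<close>

lemma (in banach_mfd) differential_coord:
  assumes f: "mdiff M N f p" and v: "v \<in> tspace M p" and c: "c \<in> charts_at M p" and d: "d \<in> charts_at N (f p)"
  shows "differential M N f p v d = dir_deriv (chart_map d \<circ> f \<circ> chart_inv c) (v c) (chart_map c p)"
proof -
  define c' where "c' = (SOME c. c \<in> charts_at M p)"
  have c': "c' \<in> charts_at M p" unfolding c'_def using c by (rule someI)
  have p: "p \<in> pts M" using f by (simp add: mdiff_def)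
  have id: "mdiff M M id p" by (rule mdiff_id[OF p])
  have f': "mdiff M N f (id p)" "d \<in> charts_at N (f (id p))" "c \<in> charts_at M (id p)" using f d c by auto
  have vc: "v c = dir_deriv (chart_map c \<circ> chart_inv c') (v c') (chart_map c' p)"
    by (rule tspaceD(1)[OF v c' c])
  have "differential M N f p v d = dir_deriv (chart_map d \<circ> f \<circ> chart_inv c') (v c') (chart_map c' p)"
    unfolding differential_def Let_def c'_def[symmetric] using d by simp
  also have "\<dots> = dir_deriv (chart_map d \<circ> f \<circ> chart_inv c) (v c) (chart_map c p)"
    using dir_deriv_eq[OF mdiff_comp_chart[OF banach_mfd_axioms id f'(1) c' f'(3) f'(2)], of "v c'"]
    unfolding id_comp comp_id vc by (simp only: id_apply)
  finally show ?thesis .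
qed

lemma (in banach_mfd) differential_comp:
  assumes N: "banach_mfd N" and f: "mdiff M N f p" and g: "mdiff N P g (f p)" and v: "v \<in> tspace M p"
    and fv: "differential M N f p v \<in> tspace N (f p)"
  shows "differential M P (g \<circ> f) p v = differential N P g (f p) (differential M N f p v)"
proof
  fix e
  obtain c where c: "c \<in> charts_at M p" using chart_at_pt f unfolding mdiff_def by blast
  obtain d where d: "d \<in> charts_at N (f p)" using banach_mfd.chart_at_pt[OF N mdiff_pts[OF f]] by blast
  show "differential M P (g \<circ> f) p v e = differential N P g (f p) (differential M N f p v) e"
  proof (cases "e \<in> charts_at P (g (f p))")
    case True
    have gf: "e \<in> charts_at P ((g \<circ> f) p)" using True by simp
    show ?thesis
      unfolding differential_coord[OF mdiff_comp[OF N f g] v c gf]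
        banach_mfd.differential_coord[OF N g fv d True] differential_coord[OF f v c d]
      by (rule dir_deriv_eq[OF mdiff_comp_chart[OF N f g c d True]])
  next
    case False
    then show ?thesis by (simp add: differential_def)
  qed
qed

lemma (in banach_mfd) differential_tspace:
  assumes N: "banach_mfd N" and f: "mdiff M N f p" and v: "v \<in> tspace M p"
  shows "differential M N f p v \<in> tspace N (f p)"
proof -
  interpret N: banach_mfd N by fact
  obtain c where c: "c \<in> charts_at M p" using chart_at_pt f unfolding mdiff_def by blast
  have id: "mdiff N N id (f p)" by (rule N.mdiff_id[OF mdiff_pts[OF f]])
  show ?thesis
    unfolding tspace_def
  proof (intro CollectI conjI ballI allI impI)
    show "differential M N f p v d = 0" if "d \<notin> charts_at N (f p)" for d
      using that by (simp add: differential_def)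
    fix d e assume d: "d \<in> charts_at N (f p)" and e: "e \<in> charts_at N (f p)"
    then have e': "e \<in> charts_at N (id (f p))" by simp
    show "differential M N f p v e =
        frechet_derivative (chart_map e \<circ> chart_inv d) (at (chart_map d (f p))) (differential M N f p v d)"
      unfolding differential_coord[OF f v c d] differential_coord[OF f v c e]
      using dir_deriv_eq[OF mdiff_comp_chart[OF N f id c d e'], of "v c"]
      unfolding id_comp comp_id by (simp only: id_apply)
  qed
qed

lemma (in banach_mfd) differential_chain:
  assumes "banach_mfd N" "mdiff M N f p" "mdiff N P g (f p)" "v \<in> tspace M p"
  shows "differential M P (g \<circ> f) p v = differential N P g (f p) (differential M N f p v)"
  by (rule differential_comp[OF assms differential_tspace[OF assms(1,2,4)]])

lemma (in banach_mfd) differential_id: "p \<in> pts M \<Longrightarrow> v \<in> tspace M p \<Longrightarrow> differential M M id p v = v"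
proof -
  assume p: "p \<in> pts M" and v: "v \<in> tspace M p"
  obtain c where c: "c \<in> charts_at M p" using chart_at_pt[OF p] by blast
  have id: "mdiff M M id p" by (rule mdiff_id[OF p])
  have c': "c \<in> charts_at M (id p)" using c by simp
  have "differential M M id p v \<in> tspace M p" using differential_tspace[OF banach_mfd_axioms id v] by simp
  then show ?thesis
    by (rule tspace_eqI[OF _ v c]) (use differential_coord[OF id v c c'] transition_self[OF c] in \<open>simp only: comp_id\<close>)
qed

lemma (in banach_mfd) tspace_add: "v \<in> tspace M p \<Longrightarrow> w \<in> tspace M p \<Longrightarrow> v + w \<in> tspace M p"
  and tspace_scale: "v \<in> tspace M p \<Longrightarrow> (\<lambda>c. r *\<^sub>R v c) \<in> tspace M p"
  and tspace_diff: "v \<in> tspace M p \<Longrightarrow> w \<in> tspace M p \<Longrightarrow> v - w \<in> tspace M p"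
  and tspace_zero: "0 \<in> tspace M p"
proof -
  have lin: "linear (\<lambda>w. dir_deriv (chart_map d \<circ> chart_inv c) w (chart_map c p))"
    if "c \<in> charts_at M p" "d \<in> charts_at M p" for c d
    by (rule linear_dir_deriv, rule smooth_on_differentiable[OF transition_smooth])
       (use that in \<open>auto simp: charts_at_def\<close>)
  show "v + w \<in> tspace M p" if v: "v \<in> tspace M p" and w: "w \<in> tspace M p"
  proof (rule tspaceI)
    show "(v + w) d = dir_deriv (chart_map d \<circ> chart_inv c) ((v + w) c) (chart_map c p)"
      if c: "c \<in> charts_at M p" and d: "d \<in> charts_at M p" for c d
      using tspaceD(1)[OF v c d] tspaceD(1)[OF w c d] linear_add[OF lin[OF c d]] by simp
  qed (use tspaceD(2)[OF v] tspaceD(2)[OF w] in simp)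
  show "(\<lambda>c. r *\<^sub>R v c) \<in> tspace M p" if v: "v \<in> tspace M p" for v r
  proof (rule tspaceI)
    show "r *\<^sub>R v d = dir_deriv (chart_map d \<circ> chart_inv c) (r *\<^sub>R v c) (chart_map c p)"
      if c: "c \<in> charts_at M p" and d: "d \<in> charts_at M p" for c d
      using tspaceD(1)[OF v c d] linear_scale[OF lin[OF c d]] by simp
  qed (use tspaceD(2)[OF v] in simp)
  show "v - w \<in> tspace M p" if v: "v \<in> tspace M p" and w: "w \<in> tspace M p"
  proof (rule tspaceI)
    show "(v - w) d = dir_deriv (chart_map d \<circ> chart_inv c) ((v - w) c) (chart_map c p)"
      if c: "c \<in> charts_at M p" and d: "d \<in> charts_at M p" for c d
      using tspaceD(1)[OF v c d] tspaceD(1)[OF w c d] linear_diff[OF lin[OF c d]] by simp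
  qed (use tspaceD(2)[OF v] tspaceD(2)[OF w] in simp)
  show "0 \<in> tspace M p"
    by (rule tspaceI) (use linear_0[OF lin] in auto)
qed

section \<open>Banach--Lie groups in charts\<close>

lemma smooth_on_cong: "smooth_on S f \<Longrightarrow> (\<And>x. x \<in> S \<Longrightarrow> f x = g x) \<Longrightarrow> smooth_on S g"
  unfolding smooth_on_iff_equi_diff by (auto intro: equi_diff_mono)

lemma smooth_on_twice_differentiable:
  assumes f: "smooth_on U f" and x: "x \<in> U"
  shows "twice_differentiable U f x"
proof
  show U: "open U" using f by (simp add: smooth_on_def)
  show "f differentiable (at y)" if "y \<in> U" for y by (rule smooth_on_differentiable[OF f that])
  show "bderiv f differentiable (at x)"
    using bderiv_has_derivative[OF U x smooth_on_imp_equi_diff[OF f]] by (auto simp: differentiable_def)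
qed (fact x)

lemma flat_bracket_cong:
  assumes "open U" "x \<in> U" "X differentiable (at x)" "Y differentiable (at x)"
    and "\<And>y. y \<in> U \<Longrightarrow> X y = X' y" "\<And>y. y \<in> U \<Longrightarrow> Y y = Y' y"
  shows "flat_bracket X' Y' x = flat_bracket X Y x"
  using dir_deriv_cong(1)[OF assms(3,1,2,5)] dir_deriv_cong(1)[OF assms(4,1,2,6)] assms
  by (simp add: flat_bracket_def)

context banach_mfd
begin

lemma local_rep_chart: "c \<in> charts_at M p \<Longrightarrow> local_rep c X (chart_map c p) = X p c"
  using chart_inv_chart[OF charts_atD] by (simp add: local_rep_def)

lemma bracket_coord: "c \<in> charts_at M p \<Longrightarrow>
    bracket M X Y p c = flat_bracket (local_rep c X) (local_rep c Y) (chart_map c p)"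
  by (simp add: bracket_def flat_bracket_def local_rep_chart)

lemma local_rep_transition:
  assumes X: "\<And>q. q \<in> pts M \<Longrightarrow> X q \<in> tspace M q" and c: "c \<in> atlas M" and d: "d \<in> atlas M"
    and y: "y \<in> chart_map c ` (chart_dom c \<inter> chart_dom d)"
  shows "local_rep d X ((chart_map d \<circ> chart_inv c) y) = bderiv (chart_map d \<circ> chart_inv c) y (local_rep c X y)"
proof -
  obtain q where q: "q \<in> chart_dom c" "q \<in> chart_dom d" "y = chart_map c q" using y by blast
  have cq: "c \<in> charts_at M q" and dq: "d \<in> charts_at M q" using q c d by (auto simp: charts_at_def)
  have "X q \<in> tspace M q" using X chart_dom_subset[OF c] q by blast
  from tspaceD(1)[OF this cq dq] show ?thesis
    using bderiv_apply[OF smooth_on_differentiable[OF transition_smooth[OF c d] y]]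
    by (simp add: local_rep_def q(3) chart_inv_chart[OF c q(1)] chart_inv_chart[OF d q(2)])
qed

text \<open>The local representatives in two charts are related by the transition map, and brackets
  of related fields are related.\<close>

lemma bracket_tspace:
  assumes p: "p \<in> pts M"
    and X: "\<And>q. q \<in> pts M \<Longrightarrow> X q \<in> tspace M q" and Y: "\<And>q. q \<in> pts M \<Longrightarrow> Y q \<in> tspace M q"
    and DX: "\<And>c. c \<in> charts_at M p \<Longrightarrow> local_rep c X differentiable (at (chart_map c p))"
    and DY: "\<And>c. c \<in> charts_at M p \<Longrightarrow> local_rep c Y differentiable (at (chart_map c p))"
  shows "bracket M X Y p \<in> tspace M p"
proof (rule tspaceI)
  fix c d assume c: "c \<in> charts_at M p" and d: "d \<in> charts_at M p"
  let ?\<phi> = "chart_map d \<circ> chart_inv c" and ?U = "chart_map c ` (chart_dom c \<inter> chart_dom d)"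
  note c' = charts_atD[OF c] and d' = charts_atD[OF d]
  have x: "chart_map c p \<in> ?U" using c' d' by blast
  have smooth: "smooth_on ?U ?\<phi>" by (rule transition_smooth[OF c'(1) d'(1)])
  interpret twice_differentiable ?U ?\<phi> "chart_map c p" by (rule smooth_on_twice_differentiable[OF smooth x])
  have \<phi>x: "?\<phi> (chart_map c p) = chart_map d p" using chart_inv_chart[OF c'] by simp
  have DX': "local_rep d X differentiable (at (?\<phi> (chart_map c p)))"
    and DY': "local_rep d Y differentiable (at (?\<phi> (chart_map c p)))" unfolding \<phi>x using DX DY d by auto
  have "flat_bracket (local_rep d X) (local_rep d Y) (?\<phi> (chart_map c p))
      = bderiv ?\<phi> (chart_map c p) (flat_bracket (local_rep c X) (local_rep c Y) (chart_map c p))"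
    by (rule flat_bracket_related[OF DX[OF c] DY[OF c] DX' DY'])
       (rule local_rep_transition[OF X c'(1) d'(1)] local_rep_transition[OF Y c'(1) d'(1)]; assumption)+
  then show "bracket M X Y p d = dir_deriv ?\<phi> (bracket M X Y p c) (chart_map c p)"
    unfolding bracket_coord[OF c] bracket_coord[OF d] \<phi>x
    by (simp add: bderiv_apply[OF smooth_on_differentiable[OF smooth x]])
qed (simp add: bracket_def)

end

text \<open>Three charts, as two elements and their product need not lie in a common one.\<close>

definition mulmap :: "'g monoid \<Rightarrow> ('g, 'a) chart \<Rightarrow> ('g, 'a) chart \<Rightarrow> ('g, 'a) chart \<Rightarrow> 'a \<times> 'a \<Rightarrow> 'a" where
  "mulmap G d b c = (\<lambda>(x, z). chart_map d (chart_inv b x \<otimes>\<^bsub>G\<^esub> chart_inv c z))"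

definition mulset :: "'g monoid \<Rightarrow> ('g, 'a) chart \<Rightarrow> ('g, 'a) chart \<Rightarrow> ('g, 'a) chart \<Rightarrow> ('a \<times> 'a) set" where
  "mulset G d b c = {(x, z). x \<in> chart_map b ` chart_dom b \<and> z \<in> chart_map c ` chart_dom c \<and>
     chart_inv b x \<otimes>\<^bsub>G\<^esub> chart_inv c z \<in> chart_dom d}"

lemma blinfun_Pair: "blinfun_apply (Blinfun (\<lambda>a. (0, a))) w = (0, w)" "blinfun_apply (Blinfun (\<lambda>a. (a, 0))) w = (w, 0)"
  by (auto simp: bounded_linear_Blinfun_apply bounded_linear_Pair bounded_linear_zero bounded_linear_ident)

text \<open>The chart \<open>c0\<close> fixes the identification of the Lie algebra with
  \<open>'a\<close> by v \<mapsto> v c0; the other charts stay variable.\<close>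

locale lie_group_chart =
  fixes G :: "'g monoid" (structure) and M :: "('g, 'a::banach) mfd" and c0 :: "('g, 'a) chart"
  assumes lie_group: "banach_lie_group G M" and c0: "c0 \<in> charts_at M \<one>"

sublocale lie_group_chart \<subseteq> group G
  using lie_group by (simp add: banach_lie_group_def)

sublocale lie_group_chart \<subseteq> banach_mfd M
  using lie_group by (simp add: banach_lie_group_def banach_mfd_def)

context lie_group_chart
begin

abbreviation "e0 \<equiv> chart_map c0 \<one>"

lemma pts [simp]: "pts M = carrier G" using lie_group by (simp add: banach_lie_group_def)

lemma chart_pt: "c \<in> charts_at M g \<Longrightarrow> g \<in> carrier G"
  using charts_atD(2)[of c g] chart_dom_subset[OF charts_atD(1)[of c g]] by auto

lemma mult_smooth_map: "smooth_map (prod_mfd M M) M (\<lambda>(g, h). g \<otimes> h)"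
  using lie_group by (simp add: banach_lie_group_def)

lemma mulmap_smooth:
  assumes b: "b \<in> atlas M" and c: "c \<in> atlas M" and d: "d \<in> atlas M"
  shows "smooth_on (mulset G d b c) (mulmap G d b c)"
proof -
  define P where "P = (chart_dom b \<times> chart_dom c, map_prod (chart_map b) (chart_map c))"
  let ?m = "\<lambda>(g, h). g \<otimes> h"
  have P: "P \<in> atlas (prod_mfd M M)" using b c unfolding prod_mfd_def P_def by (simp; blast)
  have inj: "inj_on (chart_map P) (chart_dom P)"
    using map_prod_inj_on[OF inj_on_chart[OF b] inj_on_chart[OF c]] by (simp add: P_def)
  have inv: "chart_inv P (x, z) = (chart_inv b x, chart_inv c z)"
    if "x \<in> chart_map b ` chart_dom b" "z \<in> chart_map c ` chart_dom c" for x z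
  proof -
    have "(x, z) = chart_map P (chart_inv b x, chart_inv c z)"
      using that by (simp add: P_def chart_chart_inv)
    moreover have "(chart_inv b x, chart_inv c z) \<in> chart_dom P"
      using that by (simp add: P_def chart_inv_dom)
    ultimately show ?thesis unfolding chart_inv_def[of P] using inv_into_f_f[OF inj] by simp
  qed
  have set: "chart_map P ` (chart_dom P \<inter> ?m -` chart_dom d) = mulset G d b c"
  proof (rule subset_antisym; rule subsetI)
    fix xz assume "xz \<in> chart_map P ` (chart_dom P \<inter> ?m -` chart_dom d)"
    then show "xz \<in> mulset G d b c"
      using chart_inv_chart[OF b] chart_inv_chart[OF c] by (auto simp: P_def mulset_def)
  next
    fix xz assume "xz \<in> mulset G d b c"
    then show "xz \<in> chart_map P ` (chart_dom P \<inter> ?m -` chart_dom d)"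
      by (intro image_eqI[of _ _ "(chart_inv b (fst xz), chart_inv c (snd xz))"])
         (auto simp: P_def mulset_def chart_inv_dom chart_chart_inv simp del: image_iff)
  qed
  have "smooth_on (mulset G d b c) (chart_map d \<circ> ?m \<circ> chart_inv P)"
    using mult_smooth_map P d set unfolding smooth_map_def by metis
  then show ?thesis
    by (rule smooth_on_cong) (auto simp: mulset_def mulmap_def inv)
qed

lemma mulset_mem: "b \<in> charts_at M g \<Longrightarrow> c \<in> charts_at M h \<Longrightarrow> d \<in> charts_at M (g \<otimes> h) \<Longrightarrow>
    (chart_map b g, chart_map c h) \<in> mulset G d b c"
  using charts_atD chart_inv_chart by (simp add: mulset_def)

lemma mulmap_derivative:
  assumes "b \<in> charts_at M g" "c \<in> charts_at M h" "d \<in> charts_at M (g \<otimes> h)"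
  shows "(mulmap G d b c has_derivative blinfun_apply (bderiv (mulmap G d b c) (chart_map b g, chart_map c h)))
    (at (chart_map b g, chart_map c h))"
  by (rule has_derivative_bderiv[OF smooth_on_differentiable[OF mulmap_smooth mulset_mem]])
     (use assms charts_atD in auto)

lemma left_mult_derivative:
  assumes "b \<in> charts_at M g" "c \<in> charts_at M h" "d \<in> charts_at M (g \<otimes> h)"
  shows "((chart_map d \<circ> (\<lambda>h. g \<otimes> h) \<circ> chart_inv c) has_derivative
    (\<lambda>w. bderiv (mulmap G d b c) (chart_map b g, chart_map c h) (0, w))) (at (chart_map c h))"
proof -
  have "((\<lambda>z. mulmap G d b c (chart_map b g, z)) has_derivative
    (\<lambda>w. bderiv (mulmap G d b c) (chart_map b g, chart_map c h) (0, w))) (at (chart_map c h))"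
    by (rule has_derivative_compose[where f = "\<lambda>z. (chart_map b g, z)", OF _ mulmap_derivative[OF assms]])
       (intro has_derivative_Pair has_derivative_const has_derivative_ident)
  then show ?thesis
    using chart_inv_chart[OF charts_atD[OF assms(1)]] by (simp add: mulmap_def o_def)
qed

lemma right_mult_derivative:
  assumes "b \<in> charts_at M g" "c \<in> charts_at M h" "d \<in> charts_at M (g \<otimes> h)"
  shows "((chart_map d \<circ> (\<lambda>g. g \<otimes> h) \<circ> chart_inv b) has_derivative
    (\<lambda>w. bderiv (mulmap G d b c) (chart_map b g, chart_map c h) (w, 0))) (at (chart_map b g))"
proof -
  have "((\<lambda>x. mulmap G d b c (x, chart_map c h)) has_derivative
    (\<lambda>w. bderiv (mulmap G d b c) (chart_map b g, chart_map c h) (w, 0))) (at (chart_map b g))"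
    by (rule has_derivative_compose[where f = "\<lambda>x. (x, chart_map c h)", OF _ mulmap_derivative[OF assms]])
       (intro has_derivative_Pair has_derivative_const has_derivative_ident)
  then show ?thesis
    using chart_inv_chart[OF charts_atD[OF assms(2)]] by (simp add: mulmap_def o_def)
qed

lemma mult_continuous:
  "continuous_map (prod_topology (mfd_topology M) (mfd_topology M)) (mfd_topology M) (\<lambda>(g, h). g \<otimes> h)"
  using mult_smooth_map by (simp add: smooth_map_def prod_mfd_def)

lemma mdiff_left_mult:
  assumes g: "g \<in> carrier G" and h: "h \<in> carrier G"
  shows "mdiff M M (\<lambda>h. g \<otimes> h) h"
  unfolding mdiff_def
proof (intro conjI ballI)
  have "continuous_map (mfd_topology M) (prod_topology (mfd_topology M) (mfd_topology M)) (\<lambda>h. (g, h))"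
    using g by (intro continuous_map_pairedI) auto
  from continuous_map_compose[OF this mult_continuous]
  show "continuous_map (mfd_topology M) (mfd_topology M) (\<lambda>h. g \<otimes> h)" by (simp add: o_def)
  obtain b where "b \<in> charts_at M g" using chart_at_pt g by auto
  then show "(chart_map d \<circ> (\<lambda>h. g \<otimes> h) \<circ> chart_inv c) differentiable (at (chart_map c h))"
    if "c \<in> charts_at M h" "d \<in> charts_at M (g \<otimes> h)" for c d
    using left_mult_derivative[OF _ that] unfolding differentiable_def by blast
qed (use h in simp)

lemma mdiff_right_mult:
  assumes g: "g \<in> carrier G" and h: "h \<in> carrier G"
  shows "mdiff M M (\<lambda>g. g \<otimes> h) g"
  unfolding mdiff_def
proof (intro conjI ballI)
  have "continuous_map (mfd_topology M) (prod_topology (mfd_topology M) (mfd_topology M)) (\<lambda>g. (g, h))"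
    using h by (intro continuous_map_pairedI) auto
  from continuous_map_compose[OF this mult_continuous]
  show "continuous_map (mfd_topology M) (mfd_topology M) (\<lambda>g. g \<otimes> h)" by (simp add: o_def)
  obtain c where "c \<in> charts_at M h" using chart_at_pt h by auto
  then show "(chart_map d \<circ> (\<lambda>g. g \<otimes> h) \<circ> chart_inv b) differentiable (at (chart_map b g))"
    if "b \<in> charts_at M g" "d \<in> charts_at M (g \<otimes> h)" for b d
    using right_mult_derivative[OF that(1) _ that(2)] unfolding differentiable_def by blast
qed (use g in simp)

text \<open>The left trivialisation of the tangent bundle in charts: left translation from the
  identity to the point with coordinate \<open>x\<close>, obtained as the partial derivative of the
  multiplication in its second factor. \<open>right_frame\<close> is the analogue for right
  translation.\<close>

definition left_frame :: "('g, 'a) chart \<Rightarrow> 'a \<Rightarrow> 'a \<Rightarrow>\<^sub>L 'a" where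
  "left_frame c x = bderiv (mulmap G c c c0) (x, e0) o\<^sub>L Blinfun (\<lambda>a. (0, a))"

definition right_frame :: "('g, 'a) chart \<Rightarrow> 'a \<Rightarrow> 'a \<Rightarrow>\<^sub>L 'a" where
  "right_frame c x = bderiv (mulmap G c c0 c) (e0, x) o\<^sub>L Blinfun (\<lambda>a. (a, 0))"

lemma equi_diff_compose_right:
  assumes "open U" "equi_diff n U {P}"
  shows "equi_diff n U {\<lambda>x. P x o\<^sub>L B}"
  by (rule equi_diff_subset[OF bounded_bilinear.equi_diff_prod[OF bounded_bilinear_blinfun_compose assms
      equi_diff_const[OF assms(1), of _ "norm B"]] assms(1)]) (auto intro: pointwise2I)

lemma left_frame_smooth:
  assumes c: "c \<in> atlas M"
  shows "equi_diff n (chart_map c ` chart_dom c) {left_frame c}"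
proof -
  let ?m = "mulmap G c c c0" and ?S = "mulset G c c c0" and ?V = "chart_map c ` chart_dom c"
  have m: "smooth_on ?S ?m" by (rule mulmap_smooth[OF c charts_atD(1)[OF c0] c])
  have S: "open ?S" using m by (simp add: smooth_on_def)
  have B: "equi_diff n ?S {bderiv ?m}" using equi_diff_bderiv[OF S smooth_on_imp_equi_diff[OF m]] by simp
  have "(0, e0) + (x, 0) \<in> ?S" if x: "x \<in> ?V" for x
    using x chart_inv_dom[OF x] chart_dom_subset[OF c] charts_atD[OF c0] chart_inv_chart[OF charts_atD[OF c0]]
    by (auto simp: mulset_def subset_iff simp del: image_iff)
  then have "equi_diff n ?V {\<lambda>x. bderiv ?m ((0, e0) + (x, 0))}"
    using equi_diff_affine[OF S bounded_linear_Pair[OF bounded_linear_ident bounded_linear_zero]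
        open_chart_image[OF c], of "(0, e0)" n "{bderiv ?m}"] B by simp
  then have "equi_diff n ?V {\<lambda>x. bderiv ?m (x, e0)}" by simp
  from equi_diff_compose_right[OF open_chart_image[OF c] this]
  show ?thesis unfolding left_frame_def[abs_def] .
qed

lemma right_frame_smooth:
  assumes c: "c \<in> atlas M"
  shows "equi_diff n (chart_map c ` chart_dom c) {right_frame c}"
proof -
  let ?m = "mulmap G c c0 c" and ?S = "mulset G c c0 c" and ?V = "chart_map c ` chart_dom c"
  have m: "smooth_on ?S ?m" by (rule mulmap_smooth[OF charts_atD(1)[OF c0] c c])
  have S: "open ?S" using m by (simp add: smooth_on_def)
  have B: "equi_diff n ?S {bderiv ?m}" using equi_diff_bderiv[OF S smooth_on_imp_equi_diff[OF m]] by simp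
  have "(e0, 0) + (0, x) \<in> ?S" if x: "x \<in> ?V" for x
    using x chart_inv_dom[OF x] chart_dom_subset[OF c] charts_atD[OF c0] chart_inv_chart[OF charts_atD[OF c0]]
    by (auto simp: mulset_def subset_iff simp del: image_iff)
  then have "equi_diff n ?V {\<lambda>x. bderiv ?m ((e0, 0) + (0, x))}"
    using equi_diff_affine[OF S bounded_linear_Pair[OF bounded_linear_zero bounded_linear_ident]
        open_chart_image[OF c], of "(e0, 0)" n "{bderiv ?m}"] B by simp
  then have "equi_diff n ?V {\<lambda>x. bderiv ?m (e0, x)}" by simp
  from equi_diff_compose_right[OF open_chart_image[OF c] this]
  show ?thesis unfolding right_frame_def[abs_def] .
qed

lemma left_frame_differentiable: "c \<in> charts_at M g \<Longrightarrow> left_frame c differentiable (at (chart_map c g))"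
  using left_frame_smooth[of c "Suc 0"] charts_atD by simp

lemma left_inv_field_tspace:
  assumes "v \<in> tspace M \<one>" "g \<in> carrier G"
  shows "left_inv_field G M v g \<in> tspace M g"
  using differential_tspace[OF banach_mfd_axioms mdiff_left_mult[OF assms(2) one_closed] assms(1)] assms(2)
  by (simp add: left_inv_field_def)

lemma left_inv_field_coord:
  assumes v: "v \<in> tspace M \<one>" and c: "c \<in> charts_at M g"
  shows "left_inv_field G M v g c = left_frame c (chart_map c g) (v c0)"
proof -
  have g: "g \<in> carrier G" using chart_pt[OF c] .
  have c': "c \<in> charts_at M (g \<otimes> \<one>)" using c g by simp
  show ?thesis
    unfolding left_inv_field_def
    using differential_coord[OF mdiff_left_mult[OF g one_closed] v c0 c']
      dir_deriv_eq[OF left_mult_derivative[OF c c0 c']]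
    by (simp add: left_frame_def blinfun_Pair)
qed

lemma right_mult_coord:
  assumes v: "v \<in> tspace M \<one>" and c: "c \<in> charts_at M g"
  shows "differential M M (\<lambda>h. h \<otimes> g) \<one> v c = right_frame c (chart_map c g) (v c0)"
proof -
  have g: "g \<in> carrier G" using chart_pt[OF c] .
  have c': "c \<in> charts_at M (\<one> \<otimes> g)" using c g by simp
  show ?thesis
    using differential_coord[OF mdiff_right_mult[OF one_closed g] v c0 c']
      dir_deriv_eq[OF right_mult_derivative[OF c0 c c']]
    by (simp add: right_frame_def blinfun_Pair)
qed

lemma left_inv_field_translate:
  assumes v: "v \<in> tspace M \<one>" and g: "g \<in> carrier G" and h: "h \<in> carrier G"
  shows "left_inv_field G M v (g \<otimes> h) = differential M M (\<lambda>h. g \<otimes> h) h (left_inv_field G M v h)"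
proof -
  have "mdiff M M (\<lambda>h. g \<otimes> h) (h \<otimes> \<one>)" using mdiff_left_mult[OF g h] h by simp
  note chain = differential_chain[OF banach_mfd_axioms mdiff_left_mult[OF h one_closed] this v]
    and comp = mdiff_comp[OF banach_mfd_axioms mdiff_left_mult[OF h one_closed] this]
  have "left_inv_field G M v (g \<otimes> h) = differential M M ((\<lambda>h. g \<otimes> h) \<circ> (\<lambda>x. h \<otimes> x)) \<one> v"
    unfolding left_inv_field_def by (rule mdiff_cong(2)[OF comp]) (simp add: g h m_assoc)
  also have "\<dots> = differential M M (\<lambda>h. g \<otimes> h) h (left_inv_field G M v h)"
    unfolding chain left_inv_field_def using h by simp
  finally show ?thesis .
qed

lemma local_rep_left_inv_field:
  assumes v: "v \<in> tspace M \<one>" and c: "c \<in> atlas M" and x: "x \<in> chart_map c ` chart_dom c"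
  shows "local_rep c (left_inv_field G M v) x = left_frame c x (v c0)"
proof -
  have "c \<in> charts_at M (chart_inv c x)" using c chart_inv_dom[OF x] by (simp add: charts_at_def)
  from left_inv_field_coord[OF v this] show ?thesis
    by (simp add: local_rep_def chart_chart_inv[OF x])
qed

lemma frame_field_differentiable:
  assumes "c \<in> charts_at M g"
  shows "(\<lambda>x. blinfun_apply (left_frame c x) a) differentiable (at (chart_map c g))"
  using bounded_linear.has_derivative[OF blinfun.bounded_linear_left
      has_derivative_dir_deriv[OF left_frame_differentiable[OF assms]]]
  by (auto simp: differentiable_def)

lemma local_rep_left_inv_field_differentiable:
  assumes v: "v \<in> tspace M \<one>" and c: "c \<in> charts_at M g"
  shows "local_rep c (left_inv_field G M v) differentiable (at (chart_map c g))"
  by (rule dir_deriv_cong(2)[OF frame_field_differentiable[OF c] open_chart_image[OF charts_atD(1)[OF c]]])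
     (use local_rep_left_inv_field[OF v charts_atD(1)[OF c]] charts_atD(2)[OF c] in auto)

lemma lie_bracket_tspace:
  assumes "v \<in> tspace M \<one>" "w \<in> tspace M \<one>"
  shows "lie_bracket G M v w \<in> tspace M \<one>"
  unfolding lie_bracket_def
  by (rule bracket_tspace) (use left_inv_field_tspace local_rep_left_inv_field_differentiable assms in auto)

text \<open>The Lie bracket transported to \<open>'a\<close> by the chart \<open>c0\<close>.\<close>

definition frame_bracket :: "'a \<Rightarrow> 'a \<Rightarrow> 'a" where
  "frame_bracket a b = flat_bracket (\<lambda>x. left_frame c0 x a) (\<lambda>x. left_frame c0 x b) e0"

lemma lie_bracket_coord:
  assumes v: "v \<in> tspace M \<one>" and w: "w \<in> tspace M \<one>"
  shows "lie_bracket G M v w c0 = frame_bracket (v c0) (w c0)"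
  unfolding lie_bracket_def bracket_coord[OF c0] frame_bracket_def
  by (rule flat_bracket_cong[OF open_chart_image[OF charts_atD(1)[OF c0]] _
        frame_field_differentiable[OF c0] frame_field_differentiable[OF c0]])
     (use local_rep_left_inv_field[OF _ charts_atD(1)[OF c0]] v w charts_atD(2)[OF c0] in auto)

lemma left_mult_smooth:
  assumes b: "b \<in> charts_at M g" and c: "c \<in> atlas M" and d: "d \<in> atlas M"
  shows "smooth_on ((\<lambda>z. (chart_map b g, z)) -` mulset G d b c) (chart_map d \<circ> (\<lambda>h. g \<otimes> h) \<circ> chart_inv c)"
proof -
  let ?U = "(\<lambda>z. (chart_map b g, z)) -` mulset G d b c"
  have m: "smooth_on (mulset G d b c) (mulmap G d b c)"
    by (rule mulmap_smooth[OF charts_atD(1)[OF b] c d])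
  have S: "open (mulset G d b c)" using m by (simp add: smooth_on_def)
  have U: "open ?U" by (intro open_vimage S continuous_intros)
  have eq: "chart_map d \<circ> (\<lambda>h. g \<otimes> h) \<circ> chart_inv c = (\<lambda>z. mulmap G d b c (chart_map b g, z))"
    by (simp add: fun_eq_iff mulmap_def chart_inv_chart[OF charts_atD[OF b]])
  have "equi_diff n ?U ((\<lambda>f x. f ((chart_map b g, 0) + (0, x))) ` {mulmap G d b c})" for n
    by (rule equi_diff_affine[OF S bounded_linear_Pair[OF bounded_linear_zero bounded_linear_ident] U _
          smooth_on_imp_equi_diff[OF m]]) simp
  then show ?thesis unfolding smooth_on_iff_equi_diff eq using U by simp
qed

text \<open>Left translation by \<open>g\<close> relates each left invariant field to itself, so the
  bracket of two of them is again left invariant and determined by its value at the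
  identity.\<close>

lemma flat_bracket_left_frame:
  assumes c: "c \<in> charts_at M g"
  shows "flat_bracket (\<lambda>x. left_frame c x a) (\<lambda>x. left_frame c x b) (chart_map c g)
    = left_frame c (chart_map c g) (frame_bracket a b)"
proof -
  have g: "g \<in> carrier G" using chart_pt[OF c] .
  have c1: "c \<in> charts_at M (g \<otimes> \<one>)" using c g by simp
  let ?\<phi> = "chart_map c \<circ> (\<lambda>h. g \<otimes> h) \<circ> chart_inv c0"
  let ?U = "(\<lambda>z. (chart_map c g, z)) -` mulset G c c c0"
  have smooth: "smooth_on ?U ?\<phi>" by (rule left_mult_smooth) (use charts_atD c c0 in auto)
  have e0U: "e0 \<in> ?U" using mulset_mem[OF c c0 c1] by simp
  interpret twice_differentiable ?U ?\<phi> e0 by (rule smooth_on_twice_differentiable[OF smooth e0U])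
  have \<phi>e0: "?\<phi> e0 = chart_map c g" using chart_inv_chart[OF charts_atD[OF c0]] g by simp
  have rel: "left_frame c (?\<phi> z) w = bderiv ?\<phi> z (left_frame c0 z w)" if z: "z \<in> ?U" for z w
  proof -
    define h where "h = chart_inv c0 z"
    have zc: "z \<in> chart_map c0 ` chart_dom c0" using z by (simp add: mulset_def)
    have h: "h \<in> chart_dom c0" "chart_map c0 h = z"
      using chart_inv_dom[OF zc] chart_chart_inv[OF zc] by (auto simp: h_def)
    have hG: "h \<in> carrier G" using h chart_dom_subset[OF charts_atD(1)[OF c0]] by auto
    have c0h: "c0 \<in> charts_at M h" using c0 h by (simp add: charts_at_def)
    have cgh: "c \<in> charts_at M (g \<otimes> h)"
      using z c chart_inv_chart[OF charts_atD[OF c]] by (simp add: charts_at_def mulset_def h_def)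
    have \<phi>z: "?\<phi> z = chart_map c (g \<otimes> h)" by (simp add: h_def)
    let ?v = "tvec_of M \<one> c0 w"
    have v: "?v \<in> tspace M \<one>" and vc: "?v c0 = w" using tvec_of_tspace[OF c0] by auto
    have "left_frame c (?\<phi> z) w = left_inv_field G M ?v (g \<otimes> h) c"
      unfolding \<phi>z left_inv_field_coord[OF v cgh] vc ..
    also have "\<dots> = dir_deriv ?\<phi> (left_inv_field G M ?v h c0) (chart_map c0 h)"
      unfolding left_inv_field_translate[OF v g hG]
      by (rule differential_coord[OF mdiff_left_mult[OF g hG] left_inv_field_tspace[OF v hG] c0h cgh])
    also have "\<dots> = bderiv ?\<phi> z (left_frame c0 z w)"
      unfolding left_inv_field_coord[OF v c0h] vc h(2) bderiv_apply[OF first[OF z]] ..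
    finally show ?thesis .
  qed
  have "flat_bracket (\<lambda>x. left_frame c x a) (\<lambda>x. left_frame c x b) (?\<phi> e0)
      = bderiv ?\<phi> e0 (frame_bracket a b)"
    unfolding frame_bracket_def
    by (rule flat_bracket_related[OF frame_field_differentiable[OF c0] frame_field_differentiable[OF c0]])
       (use rel frame_field_differentiable[OF c] \<phi>e0 in auto)
  moreover have "bderiv ?\<phi> e0 w = left_frame c (chart_map c g) w" for w
    using dir_deriv_eq[OF left_mult_derivative[OF c c0 c1]] bderiv_apply[OF first[OF e0U]]
    by (simp add: left_frame_def blinfun_Pair)
  ultimately show ?thesis unfolding \<phi>e0 by simp
qed

lemma left_frame_e0: "left_frame c0 e0 a = a"
proof -
  let ?v = "tvec_of M \<one> c0 a"
  have v: "?v \<in> tspace M \<one>" and vc: "?v c0 = a" using tvec_of_tspace[OF c0] by auto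
  have id: "mdiff M M id \<one>" by (rule mdiff_id) simp
  have "left_inv_field G M ?v \<one> = differential M M id \<one> ?v"
    unfolding left_inv_field_def by (rule mdiff_cong(2)[OF id]) simp
  also have "\<dots> = ?v" by (rule differential_id[OF _ v]) simp
  finally show ?thesis using left_inv_field_coord[OF v c0] vc by simp
qed

text \<open>At the identity the frame is the identity operator, which leaves only the derivative of
  the frame. Biadditivity and antisymmetry can be read off from this form.\<close>

lemma frame_bracket_eq:
  "frame_bracket a b = dir_deriv (left_frame c0) a e0 b - dir_deriv (left_frame c0) b e0 a"
proof -
  have "dir_deriv (\<lambda>x. left_frame c0 x b) a e0 = dir_deriv (left_frame c0) a e0 b" for a b
    by (rule dir_deriv_eq[OF bounded_linear.has_derivative[OF blinfun.bounded_linear_left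
            has_derivative_dir_deriv[OF left_frame_differentiable[OF c0]]]])
  then show ?thesis by (simp add: frame_bracket_def flat_bracket_def left_frame_e0)
qed

lemma frame_bracket_add:
  "frame_bracket (a + a') b = frame_bracket a b + frame_bracket a' b"
  "frame_bracket b (a + a') = frame_bracket b a + frame_bracket b a'"
  using linear_add[OF linear_dir_deriv[OF left_frame_differentiable[OF c0]]]
  by (simp_all add: frame_bracket_eq blinfun.add_left blinfun.add_right)

lemma frame_bracket_antisym: "frame_bracket a b = - frame_bracket b a"
  by (simp add: frame_bracket_eq)

end

section \<open>Homogeneous spaces\<close>

lemma locally_lipschitz_comp:
  assumes "r > 0" "A \<ge> 0" and q: "\<And>y z. y \<in> ball x r \<Longrightarrow> z \<in> ball x r \<Longrightarrow> norm (q y - q z) \<le> A * norm (y - z)"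
    and "s > 0" "B \<ge> 0" and p: "\<And>y z. y \<in> ball (q x) s \<Longrightarrow> z \<in> ball (q x) s \<Longrightarrow> norm (p y - p z) \<le> B * norm (y - z)"
  shows "\<exists>t>0. \<forall>y\<in>ball x t. \<forall>z\<in>ball x t. norm (p (q y) - p (q z)) \<le> (B * A) * norm (y - z)"
proof (intro exI conjI ballI)
  define t where "t = min r (s / (A + 1))"
  show "min r (s / (A + 1)) > 0" using assms by simp
  have near: "q y \<in> ball (q x) s" if y: "y \<in> ball x t" for y
  proof -
    have "norm (q x - q y) \<le> A * norm (x - y)" by (rule q) (use y assms(1) in \<open>auto simp: t_def\<close>)
    also have "\<dots> \<le> (A + 1) * norm (x - y)" by (intro mult_right_mono) auto
    also have "\<dots> < s" using y assms(2) by (simp add: t_def dist_norm pos_less_divide_eq mult.commute)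
    finally show ?thesis by (simp add: dist_norm)
  qed
  fix y z assume "y \<in> ball x (min r (s / (A + 1)))" "z \<in> ball x (min r (s / (A + 1)))"
  then have yz: "y \<in> ball x t" "z \<in> ball x t" by (simp_all add: t_def)
  have "norm (p (q y) - p (q z)) \<le> B * norm (q y - q z)" by (rule p[OF near[OF yz(1)] near[OF yz(2)]])
  also have "\<dots> \<le> B * (A * norm (y - z))" by (intro mult_left_mono q assms) (use yz in \<open>auto simp: t_def\<close>)
  finally show "norm (p (q y) - p (q z)) \<le> (B * A) * norm (y - z)" by simp
qed

lemma smooth_on_locally_lipschitz:
  assumes "smooth_on S f" "x \<in> S"
  obtains r A where "r > 0" "A \<ge> 0" "ball x r \<subseteq> S"
    "\<And>y z. y \<in> ball x r \<Longrightarrow> z \<in> ball x r \<Longrightarrow> norm (f y - f z) \<le> A * norm (y - z)"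
proof -
  have "open S" using assms by (simp add: smooth_on_def)
  obtain r A where r: "r > 0" "A \<ge> 0" "ball x r \<subseteq> S"
    "\<And>g y z. g \<in> {f} \<Longrightarrow> y \<in> ball x r \<Longrightarrow> z \<in> ball x r \<Longrightarrow> norm (g y - g z) \<le> A * norm (y - z)"
    by (rule equi_lipschitz[OF \<open>open S\<close> assms(2) smooth_on_imp_equi_diff[OF assms(1)]]) blast
  show ?thesis by (rule that[OF r(1-3)]) (use r(4) in simp)
qed

context banach_mfd
begin

lemma differential_linear:
  assumes f: "mdiff M N f p"
  shows "differential M N f p (v + w) = differential M N f p v + differential M N f p w"
    and "differential M N f p (v - w) = differential M N f p v - differential M N f p w"
    and "differential M N f p 0 = 0"
proof -
  define c where "c = (SOME c. c \<in> charts_at M p)"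
  have "\<exists>c. c \<in> charts_at M p" using chart_at_pt f unfolding mdiff_def by blast
  then have c: "c \<in> charts_at M p" unfolding c_def by (rule someI_ex)
  have lin: "linear (\<lambda>w. dir_deriv (chart_map d \<circ> f \<circ> chart_inv c) w (chart_map c p))" if "d \<in> charts_at N (f p)" for d
    by (rule linear_dir_deriv) (use f c that in \<open>auto simp: mdiff_def\<close>)
  show "differential M N f p (v + w) = differential M N f p v + differential M N f p w"
    "differential M N f p (v - w) = differential M N f p v - differential M N f p w"
    "differential M N f p 0 = 0"
    unfolding differential_def Let_def c_def[symmetric]
    using linear_add[OF lin] linear_diff[OF lin] linear_0[OF lin] by (auto simp: fun_eq_iff)
qed

end

locale homogeneous_chart = lie_group_chart G M c0
  for G :: "'g monoid" (structure) and M :: "('g, 'a::banach) mfd" and c0 +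
  fixes K :: "'g set" and L :: "('g, 'b::banach) mfd" and Q :: "('g set, 'e::banach) mfd"
  assumes homogeneous: "homogeneous_space G M K L Q"

sublocale homogeneous_chart \<subseteq> Q: banach_mfd Q
  using homogeneous by (simp add: homogeneous_space_def banach_mfd_def)

context homogeneous_chart
begin

abbreviation "\<pi> \<equiv> quot_map G K"
abbreviation "\<alpha> \<equiv> action G"
abbreviation "d\<pi> \<equiv> differential M Q (quot_map G K)"
abbreviation "T1 \<equiv> tspace M \<one>"
abbreviation "lfield \<equiv> left_inv_field G M"
abbreviation "\<kk> \<equiv> sub_lie_alg G M L"

lemma subgroup_K: "subgroup K G"
  using homogeneous by (simp add: homogeneous_space_def immersed_lie_subgroup_def)

lemma K_carrier: "k \<in> K \<Longrightarrow> k \<in> carrier G"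
  using subgroup.mem_carrier[OF subgroup_K] .

lemma pts_Q: "pts Q = \<pi> ` carrier G"
  using homogeneous by (auto simp: homogeneous_space_def LCOSETS_def quot_map_def)

lemma \<pi>_pts: "g \<in> carrier G \<Longrightarrow> \<pi> g \<in> pts Q" using pts_Q by auto

lemma \<pi>_smooth: "smooth_map M Q \<pi>"
  and \<pi>_submersive: "g \<in> carrier G \<Longrightarrow> d\<pi> g ` tspace M g = tspace Q (\<pi> g)"
  using homogeneous by (auto simp: homogeneous_space_def submersion_def)

lemma mdiff_\<pi>: "g \<in> carrier G \<Longrightarrow> mdiff M Q \<pi> g"
  using smooth_map_mdiff[OF \<pi>_smooth] by simp

lemma kernel: "v \<in> \<kk> \<longleftrightarrow> v \<in> T1 \<and> d\<pi> \<one> v = 0"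
  using homogeneous by (auto simp: homogeneous_space_def lie_alg_def)

lemma action_\<pi>: "g \<in> carrier G \<Longrightarrow> h \<in> carrier G \<Longrightarrow> \<alpha> g (\<pi> h) = \<pi> (g \<otimes> h)"
  unfolding action_def quot_map_def using lcos_m_assoc[OF subgroup.subset[OF subgroup_K]] by simp

lemma \<pi>_mult_K: "g \<in> carrier G \<Longrightarrow> k \<in> K \<Longrightarrow> \<pi> (g \<otimes> k) = \<pi> g"
  unfolding quot_map_def
  using lcos_m_assoc[OF subgroup.subset[OF subgroup_K], of g k] K_carrier coset_join3[OF _ subgroup_K] by auto

lemma \<pi>_eqD:
  assumes "g \<in> carrier G" "h \<in> carrier G" "\<pi> g = \<pi> h"
  obtains k where "k \<in> K" "g = h \<otimes> k"
proof -
  have "g \<in> h <# K" using assms lcos_self[OF assms(1) subgroup_K] by (simp add: quot_map_def)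
  then show ?thesis using that by (auto simp: l_coset_def)
qed

section \<open>The projection to the quotient in charts\<close>

definition pre_dom :: "('g, 'a) chart \<Rightarrow> ('g set, 'e) chart \<Rightarrow> 'a set" where
  "pre_dom c d = chart_map c ` (chart_dom c \<inter> \<pi> -` chart_dom d)"

abbreviation \<pi>_loc :: "('g, 'a) chart \<Rightarrow> ('g set, 'e) chart \<Rightarrow> 'a \<Rightarrow> 'e" where
  "\<pi>_loc c d \<equiv> chart_map d \<circ> \<pi> \<circ> chart_inv c"

lemma \<pi>_loc_smooth: "c \<in> atlas M \<Longrightarrow> d \<in> atlas Q \<Longrightarrow> smooth_on (pre_dom c d) (\<pi>_loc c d)"
  using \<pi>_smooth unfolding smooth_map_def pre_dom_def by blast

lemma \<pi>_loc_chart: "c \<in> charts_at M g \<Longrightarrow> \<pi>_loc c d (chart_map c g) = chart_map d (\<pi> g)"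
  using chart_inv_chart[OF charts_atD] by simp

lemma pre_domE:
  assumes "x \<in> pre_dom c d" "c \<in> atlas M" "d \<in> atlas Q"
  obtains g where "g \<in> carrier G" "c \<in> charts_at M g" "d \<in> charts_at Q (\<pi> g)" "x = chart_map c g"
proof -
  obtain g where g: "g \<in> chart_dom c" "\<pi> g \<in> chart_dom d" "x = chart_map c g"
    using assms(1) unfolding pre_dom_def by blast
  have "c \<in> charts_at M g" using g assms by (simp add: charts_at_def)
  moreover have "d \<in> charts_at Q (\<pi> g)" using g assms by (simp add: charts_at_def)
  ultimately show ?thesis using that g chart_pt by blast
qed

lemma pre_domI: "c \<in> charts_at M g \<Longrightarrow> d \<in> charts_at Q (\<pi> g) \<Longrightarrow> chart_map c g \<in> pre_dom c d"
  unfolding pre_dom_def charts_at_def by blast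

lemma d\<pi>_coord:
  assumes "c \<in> charts_at M g" "d \<in> charts_at Q (\<pi> g)" "v \<in> tspace M g"
  shows "d\<pi> g v d = bderiv (\<pi>_loc c d) (chart_map c g) (v c)"
  unfolding differential_coord[OF mdiff_\<pi>[OF chart_pt[OF assms(1)]] assms(3,1,2)]
  by (rule bderiv_apply[symmetric, OF smooth_on_differentiable[OF \<pi>_loc_smooth pre_domI]])
     (use assms charts_atD Q.charts_atD in auto)

lemma submersion_loc:
  assumes c: "c \<in> atlas M" and d: "d \<in> atlas Q"
  shows "smooth_submersion (pre_dom c d) (\<pi>_loc c d)"
proof
  show "open (pre_dom c d)" "equi_diff n (pre_dom c d) {\<pi>_loc c d}" for n
    using \<pi>_loc_smooth[OF c d] by (auto simp: smooth_on_iff_equi_diff)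
  fix x assume "x \<in> pre_dom c d"
  then obtain g where g: "g \<in> carrier G" "c \<in> charts_at M g" "d \<in> charts_at Q (\<pi> g)" "x = chart_map c g"
    using pre_domE c d by metis
  show "surj (blinfun_apply (bderiv (\<pi>_loc c d) x))"
  proof (rule surjI)
    fix w
    let ?w = "tvec_of Q (\<pi> g) d w"
    obtain v where v: "v \<in> tspace M g" "d\<pi> g v = ?w"
      using \<pi>_submersive[OF g(1)] Q.tvec_of_tspace(1)[OF g(3), of w] by (metis imageE)
    then have "bderiv (\<pi>_loc c d) x (v c) = w"
      using d\<pi>_coord[OF g(2,3) v(1)] Q.tvec_of_tspace(2)[OF g(3), of w] g(4) by simp
    then show "bderiv (\<pi>_loc c d) x ((SOME u. bderiv (\<pi>_loc c d) x u = w)) = w"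
      by (rule someI)
  qed
qed

lemma \<pi>_continuous: "continuous_map (mfd_topology M) (mfd_topology Q) \<pi>"
  using \<pi>_smooth by (simp add: smooth_map_def)

text \<open>Openness makes \<pi> a quotient map in the topological sense, from which the continuity
  of the translations of \<open>Q\<close> follows.\<close>

lemma \<pi>_open_map: "open_map (mfd_topology M) (mfd_topology Q) \<pi>"
  unfolding open_map_def
proof (intro allI impI)
  fix W assume W: "openin (mfd_topology M) W"
  show "openin (mfd_topology Q) (\<pi> ` W)"
  proof (subst openin_subopen, intro ballI)
    fix q assume "q \<in> \<pi> ` W"
    then obtain g where g: "g \<in> W" "q = \<pi> g" by blast
    then have gG: "g \<in> carrier G" using openin_subset[OF W] by auto
    obtain c where c: "c \<in> charts_at M g" using chart_at_pt gG by auto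
    obtain d where d: "d \<in> charts_at Q (\<pi> g)" using Q.chart_at_pt[OF \<pi>_pts[OF gG]] by blast
    interpret S: smooth_submersion "pre_dom c d" "\<pi>_loc c d"
      by (rule submersion_loc[OF charts_atD(1)[OF c] Q.charts_atD(1)[OF d]])
    \<comment> \<open>Restricting the submersion to coordinates of points of \<open>W\<close> keeps
      its open image inside the image of \<open>W\<close>.\<close>
    let ?V = "pre_dom c d \<inter> chart_map c ` (chart_dom c \<inter> W)"
    have V: "open ?V"
      using S.U open_chart_image_openin[OF charts_atD(1)[OF c] W] by blast
    interpret V: smooth_submersion ?V "\<pi>_loc c d"
      by unfold_locales (use V S.surj equi_diff_subdomain[OF S.smooth] in auto)
    define T where "T = {q \<in> chart_dom d. chart_map d q \<in> \<pi>_loc c d ` ?V}"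
    have "openin (mfd_topology Q) T"
      unfolding T_def by (rule Q.openin_chart_vimage[OF Q.charts_atD(1)[OF d] V.open_image])
    moreover have "q \<in> T"
    proof -
      have "chart_map c g \<in> ?V" using pre_domI[OF c d] charts_atD[OF c] g by blast
      then have "\<pi>_loc c d (chart_map c g) \<in> \<pi>_loc c d ` ?V" by (rule imageI)
      then show ?thesis using \<pi>_loc_chart[OF c] Q.charts_atD[OF d] g by (simp add: T_def)
    qed
    moreover have "T \<subseteq> \<pi> ` W"
    proof
      fix p assume "p \<in> T"
      then obtain x where p: "p \<in> chart_dom d" and x: "x \<in> ?V" "chart_map d p = \<pi>_loc c d x"
        unfolding T_def by blast
      obtain h where h: "h \<in> carrier G" "c \<in> charts_at M h" "d \<in> charts_at Q (\<pi> h)" "x = chart_map c h"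
        using x(1) pre_domE[OF _ charts_atD(1)[OF c] Q.charts_atD(1)[OF d]] by blast
      obtain h' where h': "h' \<in> chart_dom c" "h' \<in> W" "x = chart_map c h'" using x(1) by blast
      have "h = h'" using h h' inj_onD[OF inj_on_chart[OF charts_atD(1)[OF c]]] charts_atD(2)[OF h(2)] by metis
      moreover have "p = \<pi> h"
        using x(2) h(4) \<pi>_loc_chart[OF h(2)] inj_onD[OF Q.inj_on_chart[OF Q.charts_atD(1)[OF d]]]
          p Q.charts_atD(2)[OF h(3)] by metis
      ultimately show "p \<in> \<pi> ` W" using h' by blast
    qed
    ultimately show "\<exists>T. openin (mfd_topology Q) T \<and> q \<in> T \<and> T \<subseteq> \<pi> ` W" by blast
  qed
qed

lemma quotient_map_\<pi>: "quotient_map (mfd_topology M) (mfd_topology Q) \<pi>"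
  by (rule continuous_open_imp_quotient_map[OF \<pi>_continuous \<pi>_open_map]) (simp add: pts_Q)

lemma mdiff_\<pi>_left_mult:
  assumes "g \<in> carrier G" "h \<in> carrier G"
  shows "mdiff M Q (\<pi> \<circ> (\<lambda>h. g \<otimes> h)) h"
  by (rule mdiff_comp[OF banach_mfd_axioms mdiff_left_mult[OF assms] mdiff_\<pi>]) (use assms in simp)

text \<open>The translation of \<open>Q\<close> by \<open>g\<close> composed with \<pi> is \<pi>
  after left multiplication by \<open>g\<close>. Differentiability descends along the submersion
  once this composite is known to be locally Lipschitz.\<close>

lemma mdiff_action:
  assumes g: "g \<in> carrier G" and p: "p \<in> pts Q"
  shows "mdiff Q Q (\<alpha> g) p"
  unfolding mdiff_def
proof (intro conjI ballI p)
  have "continuous_map (mfd_topology M) (mfd_topology Q) (\<pi> \<circ> (\<lambda>h. g \<otimes> h))"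
    using mdiff_\<pi>_left_mult[OF g one_closed] by (simp add: mdiff_def)
  then have "continuous_map (mfd_topology M) (mfd_topology Q) (\<alpha> g \<circ> \<pi>)"
    by (rule continuous_map_eq) (simp add: action_\<pi> g)
  then show "continuous_map (mfd_topology Q) (mfd_topology Q) (\<alpha> g)"
    by (rule continuous_compose_quotient_map[OF quotient_map_\<pi>])
  fix d e assume d: "d \<in> charts_at Q p" and e: "e \<in> charts_at Q (\<alpha> g p)"
  obtain h where h: "h \<in> carrier G" "p = \<pi> h" using p pts_Q by auto
  have gh: "g \<otimes> h \<in> carrier G" using g h by simp
  have d': "d \<in> charts_at Q (\<pi> h)" and e': "e \<in> charts_at Q (\<pi> (g \<otimes> h))"
    using d e h g by (auto simp: action_\<pi>)
  obtain b where b: "b \<in> charts_at M g" using chart_at_pt g by auto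
  obtain c where c: "c \<in> charts_at M h" using chart_at_pt h by auto
  obtain c' where c': "c' \<in> charts_at M (g \<otimes> h)" using chart_at_pt gh by auto
  note cA = charts_atD(1)[OF c] and c'A = charts_atD(1)[OF c'] and dA = Q.charts_atD(1)[OF d'] and eA = Q.charts_atD(1)[OF e']
  interpret S: smooth_submersion "pre_dom c d" "\<pi>_loc c d" by (rule submersion_loc[OF cA dA])
  let ?\<gamma> = "chart_map e \<circ> \<alpha> g \<circ> chart_inv d"
  let ?F = "chart_map e \<circ> (\<pi> \<circ> (\<lambda>h. g \<otimes> h)) \<circ> chart_inv c"
  \<comment> \<open>Near \<open>?x\<close> the map \<open>?F\<close> factors through a chart
    \<open>c'\<close> around the product, as \<pi> in the charts \<open>c'\<close>, \<open>e\<close>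
    after \<open>?q\<close>. Both factors are smooth, hence locally Lipschitz.\<close>
  let ?q = "chart_map c' \<circ> (\<lambda>h. g \<otimes> h) \<circ> chart_inv c"
  let ?S = "(\<lambda>z. (chart_map b g, z)) -` mulset G c' b c"
  let ?x = "chart_map c h"
  have x: "?x \<in> pre_dom c d" by (rule pre_domI[OF c d'])
  have \<gamma>F: "?\<gamma> (\<pi>_loc c d y) = ?F y" if y: "y \<in> pre_dom c d" for y
  proof -
    obtain k where k: "k \<in> carrier G" "c \<in> charts_at M k" "d \<in> charts_at Q (\<pi> k)" "y = chart_map c k"
      using pre_domE[OF y cA dA] by blast
    show ?thesis
      unfolding k(4) using chart_inv_chart[OF charts_atD[OF k(2)]] Q.chart_inv_chart[OF Q.charts_atD[OF k(3)]] g k(1)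
      by (simp add: action_\<pi>)
  qed
  have "?F differentiable (at ?x)"
    using mdiff_\<pi>_left_mult[OF g h(1)] c e' by (simp add: mdiff_def)
  then have F: "(\<lambda>y. ?\<gamma> (\<pi>_loc c d y)) differentiable (at ?x)"
    by (rule dir_deriv_cong(2)[OF _ S.U x]) (simp only: \<gamma>F)
  have q: "smooth_on ?S ?q" by (rule left_mult_smooth[OF b cA c'A])
  have xS: "?x \<in> ?S" using mulset_mem[OF b c c'] by simp
  have qx: "?q ?x = chart_map c' (g \<otimes> h)" using chart_inv_chart[OF charts_atD[OF c]] by simp
  have qxP: "?q ?x \<in> pre_dom c' e" unfolding qx by (rule pre_domI[OF c' e'])
  obtain r1 A where r1: "r1 > 0" "A \<ge> 0" "ball ?x r1 \<subseteq> ?S"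
    "\<And>y z. y \<in> ball ?x r1 \<Longrightarrow> z \<in> ball ?x r1 \<Longrightarrow> norm (?q y - ?q z) \<le> A * norm (y - z)"
    by (rule smooth_on_locally_lipschitz[OF q xS]) blast
  obtain r2 B where r2: "r2 > 0" "B \<ge> 0"
    "\<And>y z. y \<in> ball (?q ?x) r2 \<Longrightarrow> z \<in> ball (?q ?x) r2 \<Longrightarrow> norm (\<pi>_loc c' e y - \<pi>_loc c' e z) \<le> B * norm (y - z)"
    by (rule smooth_on_locally_lipschitz[OF \<pi>_loc_smooth[OF c'A eA] qxP]) blast
  from locally_lipschitz_comp[OF r1(1,2,4) r2] obtain t where t: "t > 0"
    "\<forall>y\<in>ball ?x t. \<forall>z\<in>ball ?x t. norm (\<pi>_loc c' e (?q y) - \<pi>_loc c' e (?q z)) \<le> (B * A) * norm (y - z)"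
    by blast
  have qF: "\<pi>_loc c' e (?q y) = ?F y" if y: "y \<in> ?S" for y
  proof -
    have "g \<otimes> chart_inv c y \<in> chart_dom c'"
      using y chart_inv_chart[OF charts_atD[OF b]] by (simp add: mulset_def)
    then show ?thesis using chart_inv_chart[OF c'A] by simp
  qed
  obtain r3 where r3: "r3 > 0" "ball ?x r3 \<subseteq> pre_dom c d" using S.U x open_contains_ball by blast
  \<comment> \<open>On this ball the factorisation, the Lipschitz bound of the composite and the
    identity \<open>\<gamma>F\<close> are all available.\<close>
  define \<rho> where "\<rho> = min r1 (min t r3)"
  have "?\<gamma> differentiable (at (\<pi>_loc c d ?x))"
  proof (rule S.quotient_differentiable_at_lipschitz[OF x F, of \<rho> "B * A"])
    show "\<rho> > 0" "B * A \<ge> 0" using r1 t r3 r2 by (auto simp: \<rho>_def)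
    fix y z assume yz: "y \<in> ball ?x \<rho>" "z \<in> ball ?x \<rho>"
    then have in1: "y \<in> ?S" "z \<in> ?S" using r1(3) by (auto simp: \<rho>_def simp del: vimage_eq)
    have in2: "y \<in> pre_dom c d" "z \<in> pre_dom c d" using r3(2) yz by (auto simp: \<rho>_def)
    have in3: "y \<in> ball ?x t" "z \<in> ball ?x t" using yz by (auto simp: \<rho>_def)
    show "norm (?\<gamma> (\<pi>_loc c d y) - ?\<gamma> (\<pi>_loc c d z)) \<le> B * A * norm (y - z)"
      unfolding \<gamma>F[OF in2(1)] \<gamma>F[OF in2(2)] qF[OF in1(1), symmetric] qF[OF in1(2), symmetric]
      by (rule t(2)[rule_format, OF in3])
  qed
  then show "?\<gamma> differentiable (at (chart_map d p))" unfolding \<pi>_loc_chart[OF c] h(2) .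
qed

end

section \<open>Translations, left invariant fields and frames over the quotient\<close>

context homogeneous_chart
begin

abbreviation "d\<alpha> g \<equiv> differential Q Q (action G g)"

lemma d_action_d\<pi>:
  assumes g: "g \<in> carrier G" and h: "h \<in> carrier G" and v: "v \<in> tspace M h"
  shows "d\<alpha> g (\<pi> h) (d\<pi> h v) = d\<pi> (g \<otimes> h) (differential M M (\<lambda>h. g \<otimes> h) h v)"
proof -
  have \<pi>gh: "mdiff M Q \<pi> (g \<otimes> h)" using mdiff_\<pi> g h by simp
  have "d\<alpha> g (\<pi> h) (d\<pi> h v) = differential M Q (\<alpha> g \<circ> \<pi>) h v"
    by (rule differential_chain[OF Q.banach_mfd_axioms mdiff_\<pi>[OF h] mdiff_action[OF g \<pi>_pts[OF h]] v, symmetric])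
  also have "\<dots> = differential M Q (\<pi> \<circ> (\<lambda>h. g \<otimes> h)) h v"
    by (rule mdiff_cong(2)[OF mdiff_\<pi>_left_mult[OF g h]]) (simp add: action_\<pi> g)
  also have "\<dots> = d\<pi> (g \<otimes> h) (differential M M (\<lambda>h. g \<otimes> h) h v)"
    by (rule differential_chain[OF banach_mfd_axioms mdiff_left_mult[OF g h] \<pi>gh v])
  finally show ?thesis .
qed

lemma d\<pi>_lfield:
  assumes "g \<in> carrier G" "v \<in> T1"
  shows "d\<pi> g (lfield v g) = d\<alpha> g (\<pi> \<one>) (d\<pi> \<one> v)"
  using d_action_d\<pi>[OF assms(1) one_closed assms(2)] assms(1) by (simp add: left_inv_field_def)

lemma d_action_inverse:
  assumes g: "g \<in> carrier G" and p: "p \<in> pts Q" and u: "u \<in> tspace Q p"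
  shows "d\<alpha> (inv g) (\<alpha> g p) (d\<alpha> g p u) = u"
proof -
  have eq: "\<alpha> (inv g) (\<alpha> g q) = q" if q: "q \<in> pts Q" for q
  proof -
    obtain h where "h \<in> carrier G" "q = \<pi> h" using q pts_Q by auto
    then show ?thesis using g by (simp add: action_\<pi> m_assoc[symmetric])
  qed
  have gp: "\<alpha> g p \<in> pts Q" using mdiff_pts[OF mdiff_action[OF g p]] .
  have "d\<alpha> (inv g) (\<alpha> g p) (d\<alpha> g p u) = differential Q Q (\<alpha> (inv g) \<circ> \<alpha> g) p u"
    by (rule Q.differential_chain[OF Q.banach_mfd_axioms mdiff_action[OF g p] mdiff_action[OF inv_closed[OF g] gp] u, symmetric])
  also have "\<dots> = differential Q Q id p u"
    by (rule Q.mdiff_cong(2)[OF Q.mdiff_id[OF p]]) (simp add: eq)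
  also have "\<dots> = u" by (rule Q.differential_id[OF p u])
  finally show ?thesis .
qed

lemma inj_on_d_action: "g \<in> carrier G \<Longrightarrow> p \<in> pts Q \<Longrightarrow> inj_on (d\<alpha> g p) (tspace Q p)"
  by (rule inj_on_inverseI[of _ "d\<alpha> (inv g) (\<alpha> g p)"]) (rule d_action_inverse)

lemma d\<pi>_one_tspace: "v \<in> T1 \<Longrightarrow> d\<pi> \<one> v \<in> tspace Q (\<pi> \<one>)"
  using \<pi>_submersive[OF one_closed] by blast

text \<open>\<open>homogeneous_space\<close> prescribes the kernel of the differential at the
  identity. The translations have invertible differentials and carry this description to every
  \<open>g\<close>.\<close>

lemma d\<pi>_lfield_eq_0_iff:
  assumes g: "g \<in> carrier G" and v: "v \<in> T1"
  shows "d\<pi> g (lfield v g) = 0 \<longleftrightarrow> v \<in> \<kk>"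
proof -
  have p: "\<pi> \<one> \<in> pts Q" by (rule \<pi>_pts) simp
  have "d\<alpha> g (\<pi> \<one>) (d\<pi> \<one> v) = 0 \<longleftrightarrow> d\<pi> \<one> v = 0"
    using inj_onD[OF inj_on_d_action[OF g p] _ d\<pi>_one_tspace[OF v] Q.tspace_zero]
      Q.differential_linear(3)[OF mdiff_action[OF g p]] by auto
  then show ?thesis using d\<pi>_lfield[OF g v] kernel v by simp
qed

lemma \<kk>_subspace:
  shows "v \<in> \<kk> \<Longrightarrow> v \<in> T1"
    and "v \<in> \<kk> \<Longrightarrow> w \<in> \<kk> \<Longrightarrow> v + w \<in> \<kk>" and "v \<in> \<kk> \<Longrightarrow> w \<in> \<kk> \<Longrightarrow> v - w \<in> \<kk>"
  using differential_linear[OF mdiff_\<pi>[OF one_closed]] by (auto simp: kernel tspace_add tspace_diff)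

lemma lfield_diff: "g \<in> carrier G \<Longrightarrow> lfield (v - w) g = lfield v g - lfield w g"
  unfolding left_inv_field_def by (rule differential_linear(2)[OF mdiff_left_mult[OF _ one_closed]])

lemma d\<pi>_lfield_cong:
  assumes g: "g \<in> carrier G" and v: "v \<in> T1" and w: "w \<in> T1" and vw: "v - w \<in> \<kk>"
  shows "d\<pi> g (lfield v g) = d\<pi> g (lfield w g)"
  using d\<pi>_lfield_eq_0_iff[OF g tspace_diff[OF v w]] vw
  by (simp add: lfield_diff[OF g] differential_linear(2)[OF mdiff_\<pi>[OF g]])

lemma mdiff_conj:
  assumes k: "k \<in> carrier G"
  shows "mdiff M M (\<lambda>h. k \<otimes> h \<otimes> inv k) \<one>"
proof -
  have "mdiff M M (\<lambda>x. x \<otimes> inv k) (k \<otimes> \<one>)"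
    by (rule mdiff_right_mult) (use k in auto)
  from mdiff_comp[OF banach_mfd_axioms mdiff_left_mult[OF k one_closed] this] show ?thesis by (simp add: o_def)
qed

lemma Ad_tspace: "k \<in> carrier G \<Longrightarrow> v \<in> T1 \<Longrightarrow> Ad G M k v \<in> T1"
  unfolding Ad_def using differential_tspace[OF banach_mfd_axioms mdiff_conj, of k v] by simp

text \<open>Differentiates gkhK = g(khk^-1)K in \<open>h\<close> at the identity; the two sides are
  equal because k^-1 is absorbed by the coset.\<close>

lemma d\<pi>_lfield_Ad:
  assumes g: "g \<in> carrier G" and k: "k \<in> K" and v: "v \<in> T1"
  shows "d\<pi> (g \<otimes> k) (lfield v (g \<otimes> k)) = d\<pi> g (lfield (Ad G M k v) g)"
proof -
  let ?conj = "\<lambda>h. k \<otimes> h \<otimes> inv k"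
  have kG: "k \<in> carrier G" and gk: "g \<otimes> k \<in> carrier G" using k g K_carrier by auto
  have via: "d\<pi> h (lfield w h) = differential M Q (\<pi> \<circ> (\<lambda>x. h \<otimes> x)) \<one> w"
    if h: "h \<in> carrier G" and w: "w \<in> T1" for h w
  proof -
    have "mdiff M Q \<pi> (h \<otimes> \<one>)" using mdiff_\<pi> h by simp
    from differential_chain[OF banach_mfd_axioms mdiff_left_mult[OF h one_closed] this w] show ?thesis
      using h by (simp add: left_inv_field_def)
  qed
  have conj1: "?conj \<one> = \<one>" using kG by simp
  have gconj: "mdiff M Q (\<pi> \<circ> (\<lambda>x. g \<otimes> x)) (?conj \<one>)"
    unfolding conj1 by (rule mdiff_\<pi>_left_mult[OF g one_closed])
  have "d\<pi> g (lfield (Ad G M k v) g) = differential M Q ((\<pi> \<circ> (\<lambda>x. g \<otimes> x)) \<circ> ?conj) \<one> v"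
    unfolding via[OF g Ad_tspace[OF kG v]]
    by (simp only: Ad_def differential_chain[OF banach_mfd_axioms mdiff_conj[OF kG] gconj v] conj1)
  also have "\<dots> = differential M Q (\<pi> \<circ> (\<lambda>x. (g \<otimes> k) \<otimes> x)) \<one> v"
  proof (rule mdiff_cong(2)[OF mdiff_\<pi>_left_mult[OF gk one_closed]])
    fix h assume "h \<in> pts M"
    then have h: "h \<in> carrier G" by simp
    have "inv k \<in> K" using subgroup.m_inv_closed[OF subgroup_K k] .
    from \<pi>_mult_K[OF _ this, of "g \<otimes> k \<otimes> h"]
    show "(\<pi> \<circ> (\<lambda>x. (g \<otimes> k) \<otimes> x)) h = ((\<pi> \<circ> (\<lambda>x. g \<otimes> x)) \<circ> ?conj) h"
      using g kG h by (simp add: m_assoc)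
  qed
  also have "\<dots> = d\<pi> (g \<otimes> k) (lfield v (g \<otimes> k))" by (rule via[OF gk v, symmetric])
  finally show ?thesis by simp
qed

lemma lfield_surj:
  assumes g: "g \<in> carrier G" and w: "w \<in> tspace M g"
  obtains v where "v \<in> T1" "lfield v g = w"
proof
  let ?i = "inv g"
  let ?v = "differential M M (\<lambda>h. ?i \<otimes> h) g w"
  have i: "?i \<in> carrier G" using g by simp
  show v: "?v \<in> T1" using differential_tspace[OF banach_mfd_axioms mdiff_left_mult[OF i g] w] g by simp
  have gi: "mdiff M M (\<lambda>h. g \<otimes> h) (?i \<otimes> g)" by (rule mdiff_left_mult) (use g in auto)
  have "lfield ?v g = differential M M ((\<lambda>h. g \<otimes> h) \<circ> (\<lambda>h. ?i \<otimes> h)) g w"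
    using differential_chain[OF banach_mfd_axioms mdiff_left_mult[OF i g] gi w] g
    by (simp add: left_inv_field_def)
  also have "\<dots> = differential M M id g w"
    by (rule mdiff_cong(2)[OF mdiff_id]) (use g in \<open>auto simp: m_assoc[symmetric]\<close>)
  also have "\<dots> = w" by (rule differential_id[OF _ w]) (use g in simp)
  finally show "lfield ?v g = w" .
qed

lemma d\<pi>_lfield_surj:
  assumes g: "g \<in> carrier G" and u: "u \<in> tspace Q (\<pi> g)"
  obtains v where "v \<in> T1" "u = d\<pi> g (lfield v g)"
  using \<pi>_submersive[OF g] u lfield_surj[OF g] by (metis imageE)

lemma d\<pi>_lfield_tspace: "g \<in> carrier G \<Longrightarrow> v \<in> T1 \<Longrightarrow> d\<pi> g (lfield v g) \<in> tspace Q (\<pi> g)"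
  using \<pi>_submersive left_inv_field_tspace by blast

text \<open>In charts, the map sending a vector of the Lie algebra to the projection of its left
  invariant field at \<open>g\<close>. It is surjective at every point, and its kernel is constantly
  the Lie algebra of \<open>K\<close>.\<close>

definition proj_frame :: "('g, 'a) chart \<Rightarrow> ('g set, 'e) chart \<Rightarrow> 'a \<Rightarrow> 'a \<Rightarrow>\<^sub>L 'e" where
  "proj_frame c d x = bderiv (\<pi>_loc c d) x o\<^sub>L left_frame c x"

lemma d\<pi>_lfield_coord:
  assumes c: "c \<in> charts_at M g" and d: "d \<in> charts_at Q (\<pi> g)" and v: "v \<in> T1"
  shows "d\<pi> g (lfield v g) d = proj_frame c d (chart_map c g) (v c0)"
  using d\<pi>_coord[OF c d left_inv_field_tspace[OF v chart_pt[OF c]]] left_inv_field_coord[OF v c]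
  by (simp add: proj_frame_def)

abbreviation vec :: "'a \<Rightarrow> ('g, 'a) tvec" where "vec \<equiv> tvec_of M \<one> c0"

lemma vec_T1: "vec a \<in> T1" and vec_c0: "vec a c0 = a" and vec_coord: "v \<in> T1 \<Longrightarrow> vec (v c0) = v"
  using tvec_of_tspace[OF c0] tvec_of_coord[OF c0] by auto

lemma surj_proj_frame:
  assumes x: "x \<in> pre_dom c d" and c: "c \<in> atlas M" and d: "d \<in> atlas Q"
  shows "surj (blinfun_apply (proj_frame c d x))"
proof -
  obtain g where g: "g \<in> carrier G" "c \<in> charts_at M g" "d \<in> charts_at Q (\<pi> g)" "x = chart_map c g"
    using pre_domE[OF x c d] by blast
  have "\<exists>a. w = proj_frame c d x a" for w
  proof -
    obtain v where v: "v \<in> T1" "tvec_of Q (\<pi> g) d w = d\<pi> g (lfield v g)"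
      using d\<pi>_lfield_surj[OF g(1) Q.tvec_of_tspace(1)[OF g(3)]] by metis
    have "w = proj_frame c d x (v c0)"
      using d\<pi>_lfield_coord[OF g(2,3) v(1)] v(2) Q.tvec_of_tspace(2)[OF g(3), of w] g(4) by simp
    then show ?thesis ..
  qed
  then show ?thesis by (auto simp: surj_def)
qed

lemma frame_smooth_on_pre_dom:
  assumes c: "c \<in> atlas M" and d: "d \<in> atlas Q"
  shows "equi_diff n (pre_dom c d) {bderiv (\<pi>_loc c d)}"
    and "equi_diff n (pre_dom c d) {left_frame c}" and "equi_diff n (pre_dom c d) {right_frame c}"
proof -
  interpret S: smooth_submersion "pre_dom c d" "\<pi>_loc c d" by (rule submersion_loc[OF c d])
  show "equi_diff n (pre_dom c d) {bderiv (\<pi>_loc c d)}"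
    using equi_diff_bderiv[OF S.U S.smooth, of n] by simp
  have sub: "pre_dom c d \<subseteq> chart_map c ` chart_dom c" by (auto simp: pre_dom_def)
  show "equi_diff n (pre_dom c d) {left_frame c}" "equi_diff n (pre_dom c d) {right_frame c}"
    using equi_diff_subdomain[OF left_frame_smooth[OF c] sub] equi_diff_subdomain[OF right_frame_smooth[OF c] sub] .
qed

lemma open_pre_dom: "c \<in> atlas M \<Longrightarrow> d \<in> atlas Q \<Longrightarrow> open (pre_dom c d)"
  using \<pi>_loc_smooth by (simp add: smooth_on_def)

lemma proj_frame_smooth:
  assumes c: "c \<in> atlas M" and d: "d \<in> atlas Q"
  shows "equi_diff n (pre_dom c d) {proj_frame c d}"
  by (rule equi_diff_subset[OF bounded_bilinear.equi_diff_prod[OF bounded_bilinear_blinfun_compose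
          open_pre_dom[OF c d] frame_smooth_on_pre_dom(1,2)[OF c d]] open_pre_dom[OF c d]])
     (auto simp: proj_frame_def[abs_def] intro: pointwise2I)

text \<open>These are the only global smooth fields at hand, since smooth bump functions may fail to exist.\<close>

definition fundamental_field :: "('g, 'a) tvec \<Rightarrow> 'g set \<Rightarrow> ('g set, 'e) tvec" where
  "fundamental_field v p = differential M Q (\<lambda>h. action G h p) \<one> v"

text \<open>Since h(gK) = (hg)K, a fundamental field is the projection of a right invariant field,
  so \<open>right_frame\<close> describes it in charts.\<close>

lemma fundamental_field_\<pi>:
  assumes g: "g \<in> carrier G" and v: "v \<in> T1"
  shows "fundamental_field v (\<pi> g) = d\<pi> g (differential M M (\<lambda>h. h \<otimes> g) \<one> v)"
proof -
  have \<pi>g: "mdiff M Q \<pi> (\<one> \<otimes> g)" using mdiff_\<pi> g by simp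
  have comp: "mdiff M Q (\<pi> \<circ> (\<lambda>h. h \<otimes> g)) \<one>"
    by (rule mdiff_comp[OF banach_mfd_axioms mdiff_right_mult[OF one_closed g] \<pi>g])
  have "fundamental_field v (\<pi> g) = differential M Q (\<pi> \<circ> (\<lambda>h. h \<otimes> g)) \<one> v"
    unfolding fundamental_field_def by (rule mdiff_cong(2)[OF comp]) (use g in \<open>simp add: action_\<pi>\<close>)
  also have "\<dots> = d\<pi> g (differential M M (\<lambda>h. h \<otimes> g) \<one> v)"
    using differential_chain[OF banach_mfd_axioms mdiff_right_mult[OF one_closed g] \<pi>g v] g by simp
  finally show ?thesis .
qed

lemma right_mult_tspace: "g \<in> carrier G \<Longrightarrow> v \<in> T1 \<Longrightarrow> differential M M (\<lambda>h. h \<otimes> g) \<one> v \<in> tspace M g"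
  using differential_tspace[OF banach_mfd_axioms mdiff_right_mult[OF one_closed]] by simp

lemma fundamental_field_one:
  assumes v: "v \<in> T1"
  shows "fundamental_field v (\<pi> \<one>) = d\<pi> \<one> v"
proof -
  have "differential M M (\<lambda>h. h \<otimes> \<one>) \<one> v = differential M M id \<one> v"
    by (rule mdiff_cong(2)[OF mdiff_id]) auto
  also have "\<dots> = v" by (rule differential_id[OF _ v]) simp
  finally show ?thesis using fundamental_field_\<pi>[OF one_closed v] by simp
qed

lemma \<pi>_loc_image_cover:
  assumes d: "d \<in> atlas Q" and y: "y \<in> chart_map d ` chart_dom d"
  obtains c where "c \<in> atlas M" "y \<in> \<pi>_loc c d ` pre_dom c d"
proof -
  obtain p where p: "p \<in> chart_dom d" "y = chart_map d p" using y by blast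
  then obtain g where g: "g \<in> carrier G" "p = \<pi> g" using Q.chart_dom_subset[OF d] pts_Q by blast
  obtain c where c: "c \<in> charts_at M g" using chart_at_pt g by auto
  have "d \<in> charts_at Q (\<pi> g)" using d p g by (simp add: charts_at_def)
  from imageI[OF pre_domI[OF c this], of "\<pi>_loc c d"]
  have "y \<in> \<pi>_loc c d ` pre_dom c d" unfolding \<pi>_loc_chart[OF c] using p g by simp
  then show ?thesis using that charts_atD(1)[OF c] by blast
qed

text \<open>A local test: the images of the sets \<open>pre_dom c d\<close> are open and cover the
  image of the chart \<open>d\<close>, and on each of them the descent along the submersion
  applies.\<close>

lemma equi_diff_on_quotient:
  assumes d: "d \<in> atlas Q"
    and f: "\<And>c n. c \<in> atlas M \<Longrightarrow> equi_diff n (pre_dom c d) {\<lambda>x. f (\<pi>_loc c d x)}"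
  shows "equi_diff n (chart_map d ` chart_dom d) {f}"
proof (rule equi_diff_local)
  fix y assume "y \<in> chart_map d ` chart_dom d"
  then obtain c where c: "c \<in> atlas M" "y \<in> \<pi>_loc c d ` pre_dom c d" using \<pi>_loc_image_cover[OF d] by blast
  interpret S: smooth_submersion "pre_dom c d" "\<pi>_loc c d" by (rule submersion_loc[OF c(1) d])
  have "equi_diff m (pre_dom c d) ((\<lambda>\<gamma> x. \<gamma> (\<pi>_loc c d x)) ` {f})" for m using f[OF c(1)] by simp
  then have "equi_diff n (\<pi>_loc c d ` pre_dom c d) {f}" by (rule S.quotient_equi_diff)
  with S.open_image c(2) show "\<exists>V. open V \<and> y \<in> V \<and> equi_diff n V {f}" by blast
qed

lemma fundamental_field_vector_field:
  assumes v: "v \<in> T1"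
  shows "vector_field Q (fundamental_field v)"
  unfolding vector_field_def
proof (intro conjI ballI)
  fix p assume "p \<in> pts Q"
  then obtain g where g: "g \<in> carrier G" "p = \<pi> g" using pts_Q by auto
  show "fundamental_field v p \<in> tspace Q p"
    unfolding g(2) fundamental_field_\<pi>[OF g(1) v]
    using \<pi>_submersive[OF g(1)] right_mult_tspace[OF g(1) v] by blast
next
  fix d assume d: "d \<in> atlas Q"
  have "equi_diff n (pre_dom c d) {\<lambda>x. local_rep d (fundamental_field v) (\<pi>_loc c d x)}"
    if c: "c \<in> atlas M" for c n
  proof (rule equi_diff_mono[OF _ open_pre_dom[OF c d]])
    let ?F = "pointwise2 blinfun_apply (pointwise2 (o\<^sub>L) {bderiv (\<pi>_loc c d)} {right_frame c})
      {\<lambda>x. w | w. norm w \<le> norm (v c0)}"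
    show "equi_diff n (pre_dom c d) ?F"
      by (intro bounded_bilinear.equi_diff_prod[OF bounded_bilinear_blinfun_apply]
          bounded_bilinear.equi_diff_prod[OF bounded_bilinear_blinfun_compose]
          equi_diff_const frame_smooth_on_pre_dom open_pre_dom c d)
    fix f assume f: "f \<in> {\<lambda>x. local_rep d (fundamental_field v) (\<pi>_loc c d x)}"
    have "f x = blinfun_apply (bderiv (\<pi>_loc c d) x o\<^sub>L right_frame c x) (v c0)" if x: "x \<in> pre_dom c d" for x
    proof -
      obtain g where g: "g \<in> carrier G" "c \<in> charts_at M g" "d \<in> charts_at Q (\<pi> g)" "x = chart_map c g"
        using pre_domE[OF x c d] by blast
      show ?thesis
        using f \<pi>_loc_chart[OF g(2), of d] Q.local_rep_chart[OF g(3)] fundamental_field_\<pi>[OF g(1) v]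
          d\<pi>_coord[OF g(2,3) right_mult_tspace[OF g(1) v]] right_mult_coord[OF v g(2)] g(4)
        by simp
    qed
    moreover have "(\<lambda>x. blinfun_apply (bderiv (\<pi>_loc c d) x o\<^sub>L right_frame c x) (v c0)) \<in> ?F"
      by (rule pointwise2I[OF pointwise2I]) auto
    ultimately show "\<exists>g\<in>?F. \<forall>x\<in>pre_dom c d. f x = g x"
      by (intro bexI[of _ "\<lambda>x. blinfun_apply (bderiv (\<pi>_loc c d) x o\<^sub>L right_frame c x) (v c0)"]) auto
  qed
  then have "equi_diff n (chart_map d ` chart_dom d) {local_rep d (fundamental_field v)}" for n
    by (rule equi_diff_on_quotient[OF d])
  then show "smooth_on (chart_map d ` chart_dom d) (local_rep d (fundamental_field v))"
    unfolding smooth_on_iff_equi_diff using Q.open_chart_image[OF d] by simp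
qed

end

section \<open>The induced structure\<close>

locale homogeneous_complex = homogeneous_chart G M c0 K L Q
  for G :: "'g monoid" (structure) and M :: "('g, 'a::banach) mfd" and c0
    and K :: "'g set" and L :: "('g, 'b::banach) mfd" and Q :: "('g set, 'e::banach) mfd" +
  fixes J :: "('g, 'a) tvec \<Rightarrow> ('g, 'a) tvec"
  assumes admissible_complex: "J \<in> admissible_complex G M K L"
begin

lemma J_operator: "bounded_operator M \<one> J"
  and J_\<kk>: "v \<in> \<kk> \<Longrightarrow> J v \<in> \<kk>"
  and J_Ad: "k \<in> K \<Longrightarrow> v \<in> T1 \<Longrightarrow> Ad G M k (J v) - J (Ad G M k v) \<in> \<kk>"
  and J_sq: "v \<in> T1 \<Longrightarrow> J (J v) + v \<in> \<kk>"
  using admissible_complex by (auto simp: admissible_complex_def admissible_def lie_alg_def)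

lemma J_T1: "v \<in> T1 \<Longrightarrow> J v \<in> T1"
  and J_add: "v \<in> T1 \<Longrightarrow> w \<in> T1 \<Longrightarrow> J (v + w) = J v + J w"
  and J_scale: "v \<in> T1 \<Longrightarrow> J (\<lambda>c. r *\<^sub>R v c) = (\<lambda>c. r *\<^sub>R J v c)"
  and J_bounded: "\<exists>C. \<forall>v\<in>T1. norm (J v c0) \<le> C * norm (v c0)"
  using J_operator c0 unfolding bounded_operator_def by auto

lemma J_diff: "v \<in> T1 \<Longrightarrow> w \<in> T1 \<Longrightarrow> J (v - w) = J v - J w"
  using J_add[OF tspace_diff, of v w w] by (simp add: eq_diff_eq)

lemma vec_add: "vec (a + b) = vec a + vec b"
  by (rule tspace_eqI[OF vec_T1 tspace_add[OF vec_T1 vec_T1] c0]) (simp add: vec_c0)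

lemma vec_diff: "vec (a - b) = vec a - vec b"
  by (rule tspace_eqI[OF vec_T1 tspace_diff[OF vec_T1 vec_T1] c0]) (simp add: vec_c0)

lemma vec_scale: "vec (r *\<^sub>R a) = (\<lambda>c. r *\<^sub>R vec a c)"
  by (rule tspace_eqI[OF vec_T1 tspace_scale[OF vec_T1] c0]) (simp add: vec_c0)

definition J0 :: "'a \<Rightarrow>\<^sub>L 'a" where "J0 = Blinfun (\<lambda>a. J (vec a) c0)"

lemma J0_apply: "J0 a = J (vec a) c0"
proof -
  obtain C where C: "\<And>v. v \<in> T1 \<Longrightarrow> norm (J v c0) \<le> C * norm (v c0)" using J_bounded by blast
  have "bounded_linear (\<lambda>a. J (vec a) c0)"
    by (rule bounded_linear_intro[of _ C])
       (use C[OF vec_T1] in \<open>simp_all add: vec_add vec_scale J_add J_scale vec_T1 vec_c0 mult.commute\<close>)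
  then show ?thesis by (simp add: J0_def bounded_linear_Blinfun_apply)
qed

lemma J0_coord: "v \<in> T1 \<Longrightarrow> J0 (v c0) = J v c0"
  by (simp add: J0_apply vec_coord)

lemma J_vec: "J (vec a) = vec (J0 a)"
  by (rule tspace_eqI[OF J_T1[OF vec_T1] vec_T1 c0]) (simp add: J0_apply vec_c0)

abbreviation "\<J> \<equiv> induced_structure G M K Q J"

text \<open>Two lifts of a tangent vector differ by an element of \<kk>, which \<open>J\<close>
  keeps in \<kk>; this is the uniqueness behind the definite description.\<close>

lemma induced_base_eq:
  assumes v: "v \<in> T1"
  shows "induced_base G M K Q J (d\<pi> \<one> v) = d\<pi> \<one> (J v)"
  unfolding induced_base_def lie_alg_def
proof (rule the_equality)
  fix w assume "\<exists>v'\<in>T1. d\<pi> \<one> v = d\<pi> \<one> v' \<and> w = d\<pi> \<one> (J v')"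
  then obtain v' where v': "v' \<in> T1" "d\<pi> \<one> v = d\<pi> \<one> v'" "w = d\<pi> \<one> (J v')" by blast
  have sub: "v - v' \<in> \<kk>"
    using v v' by (simp add: kernel tspace_diff differential_linear(2)[OF mdiff_\<pi>[OF one_closed]])
  have "J v - J v' \<in> \<kk>" using J_\<kk>[OF sub] J_diff[OF v v'(1)] by simp
  then have "d\<pi> \<one> (J v - J v') = 0" by (simp add: kernel)
  then show "w = d\<pi> \<one> (J v)"
    unfolding v'(3) differential_linear(2)[OF mdiff_\<pi>[OF one_closed]] by simp
qed (use v in blast)

text \<open>Replacing the representative \<open>g\<close> by \<open>h\<close> with
  \<open>g = h k\<close> replaces \<open>v\<close> by its image under \<open>Ad k\<close>. As
  \<open>J\<close> commutes with \<open>Ad k\<close> modulo \<kk>, the value does not depend on the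
  representative.\<close>

lemma induced_structure_eq:
  assumes g: "g \<in> carrier G" and v: "v \<in> T1"
  shows "\<J> (\<pi> g) (d\<pi> g (lfield v g)) = d\<pi> g (lfield (J v) g)"
proof -
  let ?p0 = "\<pi> \<one>" and ?u = "d\<pi> g (lfield v g)"
  have val: "d\<alpha> h ?p0 (induced_base G M K Q J (inv_into (tspace Q ?p0) (d\<alpha> h ?p0) ?u)) = d\<pi> g (lfield (J v) g)"
    if h: "h \<in> carrier G" and gh: "\<pi> g = \<pi> h" for h
  proof -
    obtain k where k: "k \<in> K" "g = h \<otimes> k" using \<pi>_eqD[OF g h gh] .
    let ?v = "Ad G M k v"
    have v': "?v \<in> T1" by (rule Ad_tspace[OF K_carrier[OF k(1)] v])
    have "?u = d\<alpha> h ?p0 (d\<pi> \<one> ?v)"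
      unfolding k(2) d\<pi>_lfield_Ad[OF h k(1) v] by (rule d\<pi>_lfield[OF h v'])
    then have "inv_into (tspace Q ?p0) (d\<alpha> h ?p0) ?u = d\<pi> \<one> ?v"
      using inv_into_f_f[OF inj_on_d_action[OF h \<pi>_pts[OF one_closed]] d\<pi>_one_tspace[OF v']] by simp
    then have "d\<alpha> h ?p0 (induced_base G M K Q J (inv_into (tspace Q ?p0) (d\<alpha> h ?p0) ?u)) = d\<pi> h (lfield (J ?v) h)"
      using induced_base_eq[OF v'] d\<pi>_lfield[OF h J_T1[OF v']] by simp
    also have "\<dots> = d\<pi> h (lfield (Ad G M k (J v)) h)"
      by (rule d\<pi>_lfield_cong[OF h Ad_tspace[OF K_carrier[OF k(1)] J_T1[OF v]] J_T1[OF v'] J_Ad[OF k(1) v], symmetric])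
    also have "\<dots> = d\<pi> g (lfield (J v) g)"
      unfolding k(2) by (rule d\<pi>_lfield_Ad[OF h k(1) J_T1[OF v], symmetric])
    finally show ?thesis .
  qed
  show ?thesis
    unfolding induced_structure_def Let_def
    by (rule the_equality) (use val g in auto)
qed

lemma \<J>_tspace:
  assumes "p \<in> pts Q" "u \<in> tspace Q p"
  shows "\<J> p u \<in> tspace Q p"
proof -
  obtain g where g: "g \<in> carrier G" "p = \<pi> g" using assms(1) pts_Q by auto
  obtain v where "v \<in> T1" "u = d\<pi> g (lfield v g)" using d\<pi>_lfield_surj[OF g(1)] assms(2) g(2) by metis
  then show ?thesis using induced_structure_eq[OF g(1)] d\<pi>_lfield_tspace[OF g(1) J_T1] g(2) by simp
qed

text \<open>The structure in a chart as a function with values in the bounded operators, the form in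
  which it can be differentiated and obtained by division. Boundedness of the underlying map is
  proved in the next lemma.\<close>

definition Jop :: "('g set, 'e) chart \<Rightarrow> 'e \<Rightarrow> 'e \<Rightarrow>\<^sub>L 'e" where
  "Jop d y = Blinfun (\<lambda>w. \<J> (chart_inv d y) (tvec_of Q (chart_inv d y) d w) d)"

text \<open>The map under \<open>Blinfun\<close> is defined fibrewise through definite descriptions.
  Its linearity and boundedness come from factoring \<open>proj_frame\<close> after
  \<open>J0\<close> through the surjective \<open>proj_frame\<close>: the factor \<open>Z\<close>
  coincides with it.\<close>

lemma
  assumes c: "c \<in> charts_at M g" and d: "d \<in> charts_at Q (\<pi> g)"
  shows Jop_apply: "Jop d (chart_map d (\<pi> g)) w = \<J> (\<pi> g) (tvec_of Q (\<pi> g) d w) d"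
    and Jop_proj_frame: "Jop d (chart_map d (\<pi> g)) (proj_frame c d (chart_map c g) a) = proj_frame c d (chart_map c g) (J0 a)"
proof -
  let ?A = "proj_frame c d (chart_map c g)" and ?raw = "\<lambda>w. \<J> (\<pi> g) (tvec_of Q (\<pi> g) d w) d"
  have g: "g \<in> carrier G" by (rule chart_pt[OF c])
  have surj: "surj (blinfun_apply ?A)"
    by (rule surj_proj_frame[OF pre_domI[OF c d] charts_atD(1)[OF c] Q.charts_atD(1)[OF d]])
  have Aa: "?A a = d\<pi> g (lfield (vec a) g) d" for a
    using d\<pi>_lfield_coord[OF c d vec_T1] by (simp add: vec_c0)
  have raw: "?raw (?A a) = ?A (J0 a)" for a
  proof -
    have "tvec_of Q (\<pi> g) d (?A a) = d\<pi> g (lfield (vec a) g)"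
      unfolding Aa by (rule Q.tvec_of_coord[OF d d\<pi>_lfield_tspace[OF g vec_T1]])
    then show ?thesis
      using induced_structure_eq[OF g vec_T1, of a] d\<pi>_lfield_coord[OF c d vec_T1] by (simp add: J_vec vec_c0)
  qed
  have "?A (J0 a) = 0" if "?A a = 0" for a
  proof -
    have "d\<pi> g (lfield (vec a) g) = 0"
      by (rule Q.tspace_eqI[OF d\<pi>_lfield_tspace[OF g vec_T1] Q.tspace_zero d]) (use Aa that in simp)
    then have "vec (J0 a) \<in> \<kk>" using d\<pi>_lfield_eq_0_iff[OF g vec_T1] J_\<kk>[of "vec a"] J_vec by simp
    then have "d\<pi> g (lfield (vec (J0 a)) g) = 0" using d\<pi>_lfield_eq_0_iff[OF g vec_T1] by simp
    then show ?thesis using Aa[of "J0 a"] by simp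
  qed
  then obtain Z where Z: "\<And>a. blinfun_apply Z (?A a) = ?A (J0 a)"
    using blinfun_factor_surjective[OF surj, of "\<lambda>a. ?A (J0 a)"]
      bounded_linear_compose[OF blinfun.bounded_linear_right blinfun.bounded_linear_right] by metis
  have rawZ: "?raw = blinfun_apply Z"
  proof
    fix w
    obtain a where "w = ?A a" using surj by (auto simp: surj_def)
    then show "?raw w = Z w" using raw Z by simp
  qed
  show *: "Jop d (chart_map d (\<pi> g)) w = ?raw w" for w
    unfolding Jop_def Q.chart_inv_chart[OF Q.charts_atD[OF d]] rawZ blinfun_apply_inverse
    using fun_cong[OF rawZ, of w] by simp
  show "Jop d (chart_map d (\<pi> g)) (?A a) = ?A (J0 a)" unfolding * by (rule raw)
qed

lemma Jop_coord:
  assumes p: "p \<in> pts Q" and u: "u \<in> tspace Q p" and d: "d \<in> charts_at Q p"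
  shows "\<J> p u d = Jop d (chart_map d p) (u d)"
proof -
  obtain g where g: "g \<in> carrier G" "p = \<pi> g" using p pts_Q by auto
  obtain c where c: "c \<in> charts_at M g" using chart_at_pt g by auto
  show ?thesis
    using Jop_apply[OF c, of d "u d"] Q.tvec_of_coord[OF d u] d g(2) by simp
qed

text \<open>Pulled back to \<open>G\<close> and composed with \<open>proj_frame\<close>, the
  structure becomes \<open>proj_frame\<close> composed with the constant operator \<open>J0\<close>.
  Division by \<open>proj_frame\<close> gives smoothness upstairs, descent along \<pi> gives it on
  the chart of \<open>Q\<close>.\<close>

lemma Jop_smooth:
  assumes d: "d \<in> atlas Q"
  shows "equi_diff n (chart_map d ` chart_dom d) {Jop d}"
proof (rule equi_diff_on_quotient[OF d])
  fix c n assume c: "c \<in> atlas M"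
  show "equi_diff n (pre_dom c d) {\<lambda>x. Jop d (\<pi>_loc c d x)}"
  proof (rule division_equi_diff[OF open_pre_dom[OF c d] proj_frame_smooth[OF c d] surj_proj_frame[OF _ c d]])
    show "equi_diff n (pre_dom c d) ((\<lambda>h x. h x o\<^sub>L proj_frame c d x) ` {\<lambda>x. Jop d (\<pi>_loc c d x)})"
    proof (rule equi_diff_mono[OF equi_diff_compose_right[OF open_pre_dom[OF c d] proj_frame_smooth[OF c d]] open_pre_dom[OF c d]])
      fix f assume f: "f \<in> (\<lambda>h x. h x o\<^sub>L proj_frame c d x) ` {\<lambda>x. Jop d (\<pi>_loc c d x)}"
      have "f x = proj_frame c d x o\<^sub>L J0" if x: "x \<in> pre_dom c d" for x
      proof -
        obtain g where g: "g \<in> carrier G" "c \<in> charts_at M g" "d \<in> charts_at Q (\<pi> g)" "x = chart_map c g"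
          using pre_domE[OF x c d] by blast
        show ?thesis
          by (rule blinfun_eqI) (use f Jop_proj_frame[OF g(2,3)] \<pi>_loc_chart[OF g(2), of d] g(4) in simp)
      qed
      then show "\<exists>h\<in>{\<lambda>x. proj_frame c d x o\<^sub>L J0}. \<forall>x\<in>pre_dom c d. f x = h x" by simp
    qed
  qed
qed

lemma Jop_differentiable: "d \<in> charts_at Q p \<Longrightarrow> Jop d differentiable (at (chart_map d p))"
  using Jop_smooth[of d "Suc 0"] Q.charts_atD by simp

definition \<kk>0 :: "'a set" where "\<kk>0 = {a. vec a \<in> \<kk>}"

lemma \<kk>_iff: "v \<in> T1 \<Longrightarrow> v \<in> \<kk> \<longleftrightarrow> v c0 \<in> \<kk>0"
  by (simp add: \<kk>0_def vec_coord)

lemma proj_frame_eq_0_iff: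
  assumes c: "c \<in> charts_at M g" and d: "d \<in> charts_at Q (\<pi> g)"
  shows "proj_frame c d (chart_map c g) a = 0 \<longleftrightarrow> a \<in> \<kk>0"
proof -
  have g: "g \<in> carrier G" by (rule chart_pt[OF c])
  have "proj_frame c d (chart_map c g) a = d\<pi> g (lfield (vec a) g) d"
    using d\<pi>_lfield_coord[OF c d vec_T1] by (simp add: vec_c0)
  moreover have "d\<pi> g (lfield (vec a) g) d = 0 \<longleftrightarrow> d\<pi> g (lfield (vec a) g) = 0"
    using Q.tspace_eqI[OF d\<pi>_lfield_tspace[OF g vec_T1] Q.tspace_zero d] by auto
  ultimately show ?thesis using d\<pi>_lfield_eq_0_iff[OF g vec_T1] by (simp add: \<kk>0_def)
qed

section \<open>The torsion of the induced structure on the Lie algebra\<close>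

definition torsion0 :: "'a \<Rightarrow> 'a \<Rightarrow> 'a" where
  "torsion0 a b = J0 (frame_bracket (J0 a) b) + J0 (frame_bracket a (J0 b)) - frame_bracket (J0 a) (J0 b) + frame_bracket a b"

lemma intertwined_fields:
  assumes c: "c \<in> charts_at M g" and d: "d \<in> charts_at Q (\<pi> g)"
  shows "intertwined_fields (pre_dom c d) (\<pi>_loc c d) (chart_map c g) (Jop d)"
proof -
  interpret twice_differentiable "pre_dom c d" "\<pi>_loc c d" "chart_map c g"
    by (rule smooth_on_twice_differentiable[OF \<pi>_loc_smooth pre_domI])
       (use c d charts_atD Q.charts_atD in auto)
  show ?thesis
    by unfold_locales (simp only: \<pi>_loc_chart[OF c] Jop_differentiable[OF d])
qed

lemma Jop_frame_field:
  assumes "y \<in> pre_dom c d" "c \<in> atlas M" "d \<in> atlas Q"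
  shows "Jop d (\<pi>_loc c d y) (bderiv (\<pi>_loc c d) y (left_frame c y a)) = bderiv (\<pi>_loc c d) y (left_frame c y (J0 a))"
proof -
  obtain g where g: "g \<in> carrier G" "c \<in> charts_at M g" "d \<in> charts_at Q (\<pi> g)" "y = chart_map c g"
    using pre_domE[OF assms] by blast
  show ?thesis
    using Jop_proj_frame[OF g(2,3), of a] \<pi>_loc_chart[OF g(2), of d] g(4) by (simp add: proj_frame_def)
qed

lemma local_rep_\<J>:
  assumes X: "\<And>p. p \<in> pts Q \<Longrightarrow> X p \<in> tspace Q p" and d: "d \<in> atlas Q" and y: "y \<in> chart_map d ` chart_dom d"
  shows "local_rep d (\<lambda>q. \<J> q (X q)) y = Jop d y (local_rep d X y)"
proof -
  obtain p where p: "p \<in> chart_dom d" "y = chart_map d p" using y by blast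
  then have pts: "p \<in> pts Q" and dp: "d \<in> charts_at Q p" using Q.chart_dom_subset[OF d] d by (auto simp: charts_at_def)
  show ?thesis
    unfolding p(2) Q.local_rep_chart[OF dp] by (rule Jop_coord[OF pts X[OF pts] dp])
qed

lemma local_rep_\<J>_differentiable:
  assumes X: "\<And>p. p \<in> pts Q \<Longrightarrow> X p \<in> tspace Q p" and d: "d \<in> charts_at Q p"
    and DX: "local_rep d X differentiable (at (chart_map d p))"
  shows "(\<lambda>y. Jop d y (local_rep d X y)) differentiable (at (chart_map d p))"
    and "local_rep d (\<lambda>q. \<J> q (X q)) differentiable (at (chart_map d p))"
proof -
  show D: "(\<lambda>y. Jop d y (local_rep d X y)) differentiable (at (chart_map d p))"
    using bounded_bilinear.FDERIV[OF bounded_bilinear_blinfun_apply has_derivative_dir_deriv[OF Jop_differentiable[OF d]]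
        has_derivative_dir_deriv[OF DX]] by (auto simp: differentiable_def)
  show "local_rep d (\<lambda>q. \<J> q (X q)) differentiable (at (chart_map d p))"
    by (rule dir_deriv_cong(2)[OF D Q.open_chart_image[OF Q.charts_atD(1)[OF d]]])
       (use Q.charts_atD(2)[OF d] local_rep_\<J>[OF X Q.charts_atD(1)[OF d]] in auto)
qed

lemma vector_field_differentiable:
  "vector_field Q X \<Longrightarrow> d \<in> charts_at Q p \<Longrightarrow> local_rep d X differentiable (at (chart_map d p))"
  using smooth_on_differentiable Q.charts_atD unfolding vector_field_def by blast

text \<open>The left invariant fields of \<open>v\<close> and \<open>w\<close> are tied to
  \<open>X\<close> and \<open>Y\<close> at the point \<open>g\<close> only, and they are not assumed
  to descend to \<open>Q\<close>. This is enough for \<open>I.torsion_eq\<close>, and left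
  invariance of the brackets then makes the result independent of the chart at
  \<open>g\<close>.\<close>

lemma nijenhuis_torsion_eq:
  assumes X: "vector_field Q X" and Y: "vector_field Q Y" and g: "g \<in> carrier G"
    and v: "v \<in> T1" "X (\<pi> g) = d\<pi> g (lfield v g)" and w: "w \<in> T1" "Y (\<pi> g) = d\<pi> g (lfield w g)"
  shows "nijenhuis_torsion Q \<J> X Y (\<pi> g) = d\<pi> g (lfield (vec (torsion0 (v c0) (w c0))) g)"
proof -
  let ?p = "\<pi> g"
  have p: "?p \<in> pts Q" by (rule \<pi>_pts[OF g])
  obtain c where c: "c \<in> charts_at M g" using chart_at_pt g by auto
  obtain d where d: "d \<in> charts_at Q ?p" using Q.chart_at_pt[OF p] by blast
  note cA = charts_atD(1)[OF c] and dA = Q.charts_atD(1)[OF d]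
  have Xt: "X q \<in> tspace Q q" and Yt: "Y q \<in> tspace Q q" if "q \<in> pts Q" for q
    using X Y that unfolding vector_field_def by blast+
  note DX = vector_field_differentiable[OF X] and DY = vector_field_differentiable[OF Y]
  let ?JX = "\<lambda>q. \<J> q (X q)" and ?JY = "\<lambda>q. \<J> q (Y q)"
  have JXt: "?JX q \<in> tspace Q q" and JYt: "?JY q \<in> tspace Q q" if "q \<in> pts Q" for q
    using \<J>_tspace[OF that] Xt[OF that] Yt[OF that] by auto
  have DJX: "(\<lambda>y. Jop e y (local_rep e X y)) differentiable (at (chart_map e q))"
      "local_rep e ?JX differentiable (at (chart_map e q))"
    and DJY: "(\<lambda>y. Jop e y (local_rep e Y y)) differentiable (at (chart_map e q))"
      "local_rep e ?JY differentiable (at (chart_map e q))" if e: "e \<in> charts_at Q q" for e q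
    by (rule local_rep_\<J>_differentiable[OF _ e DX[OF e]] local_rep_\<J>_differentiable[OF _ e DY[OF e]],
        rule Xt Yt, assumption)+
  \<comment> \<open>\<open>Jop_coord\<close> reads the structure in a chart on tangent vectors, so
    each bracket must first be known to be one.\<close>
  have br: "bracket Q ?JX Y ?p \<in> tspace Q ?p" "bracket Q X ?JY ?p \<in> tspace Q ?p"
    "bracket Q ?JX ?JY ?p \<in> tspace Q ?p" "bracket Q X Y ?p \<in> tspace Q ?p"
    by (rule Q.bracket_tspace[OF p]; (rule Xt Yt JXt JYt DX DY DJX(2) DJY(2); assumption))+
  have N: "nijenhuis_torsion Q \<J> X Y ?p = \<J> ?p (bracket Q ?JX Y ?p) + \<J> ?p (bracket Q X ?JY ?p)
      - bracket Q ?JX ?JY ?p + bracket Q X Y ?p"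
    by (simp add: nijenhuis_torsion_def Let_def)
  let ?x = "chart_map c g" and ?y = "chart_map d ?p"
  let ?X = "local_rep d X" and ?Y = "local_rep d Y" and ?P = "bderiv (\<pi>_loc c d) (chart_map c g)"
  let ?lf = "\<lambda>a x. blinfun_apply (left_frame c x) a" and ?a = "v c0" and ?b = "w c0"
  have y: "\<pi>_loc c d ?x = ?y" by (rule \<pi>_loc_chart[OF c])
  have cong: "flat_bracket X' Y' ?y = flat_bracket X'' Y'' ?y"
    if "X'' differentiable (at ?y)" "Y'' differentiable (at ?y)"
      "\<And>z. z \<in> chart_map d ` chart_dom d \<Longrightarrow> X'' z = X' z" "\<And>z. z \<in> chart_map d ` chart_dom d \<Longrightarrow> Y'' z = Y' z"
    for X' X'' Y' Y''
    by (rule flat_bracket_cong[OF Q.open_chart_image[OF dA] _ that]) (use Q.charts_atD(2)[OF d] in simp)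
  have JX: "Jop d z (?X z) = local_rep d ?JX z" and JY: "Jop d z (?Y z) = local_rep d ?JY z"
    if z: "z \<in> chart_map d ` chart_dom d" for z
    by (rule local_rep_\<J>[OF _ dA z, symmetric], rule Xt Yt, assumption)+
  have b1: "bracket Q ?JX Y ?p d = flat_bracket (\<lambda>y. Jop d y (?X y)) ?Y ?y"
    unfolding Q.bracket_coord[OF d] by (rule cong[OF DJX(1)[OF d] DY[OF d] JX refl])
  have b2: "bracket Q X ?JY ?p d = flat_bracket ?X (\<lambda>y. Jop d y (?Y y)) ?y"
    unfolding Q.bracket_coord[OF d] by (rule cong[OF DX[OF d] DJY(1)[OF d] refl JY])
  have b3: "bracket Q ?JX ?JY ?p d = flat_bracket (\<lambda>y. Jop d y (?X y)) (\<lambda>y. Jop d y (?Y y)) ?y"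
    unfolding Q.bracket_coord[OF d] by (rule cong[OF DJX(1)[OF d] DJY(1)[OF d] JX JY])
  have b4: "bracket Q X Y ?p d = flat_bracket ?X ?Y ?y" by (rule Q.bracket_coord[OF d])
  interpret I: intertwined_fields "pre_dom c d" "\<pi>_loc c d" ?x "Jop d" by (rule intertwined_fields[OF c d])
  note lfD = frame_field_differentiable[OF c]
  \<comment> \<open>On the Lie algebra J^2 = -1 holds only modulo \<kk>, which is the kernel of
    \<open>proj_frame\<close>; on the tangent space of \<open>Q\<close> it becomes exact.\<close>
  have sq: "Jop d (\<pi>_loc c d ?x) (Jop d (\<pi>_loc c d ?x) u) = - u" for u
  proof -
    obtain a where a: "u = proj_frame c d ?x a"
      using surj_proj_frame[OF pre_domI[OF c d] cA dA] by (auto simp: surj_def)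
    have "vec (J0 (J0 a) + a) \<in> \<kk>" using J_sq[OF vec_T1, of a] by (simp add: J_vec vec_add)
    then have "proj_frame c d ?x (J0 (J0 a) + a) = 0" unfolding proj_frame_eq_0_iff[OF c d] by (simp add: \<kk>0_def)
    then show ?thesis
      unfolding y a Jop_proj_frame[OF c d] by (simp add: blinfun.add_right eq_neg_iff_add_eq_0)
  qed
  have Xx: "?X (\<pi>_loc c d ?x) = ?P (?lf ?a ?x)" and Yx: "?Y (\<pi>_loc c d ?x) = ?P (?lf ?b ?x)"
    unfolding y Q.local_rep_chart[OF d] v(2) w(2) d\<pi>_lfield_coord[OF c d v(1)] d\<pi>_lfield_coord[OF c d w(1)]
    by (simp_all add: proj_frame_def)
  have "nijenhuis_torsion Q \<J> X Y ?p d = Jop d ?y (flat_bracket (\<lambda>y. Jop d y (?X y)) ?Y ?y)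
      + Jop d ?y (flat_bracket ?X (\<lambda>y. Jop d y (?Y y)) ?y)
      - flat_bracket (\<lambda>y. Jop d y (?X y)) (\<lambda>y. Jop d y (?Y y)) ?y + flat_bracket ?X ?Y ?y"
    unfolding N using b1 b2 b3 b4 Jop_coord[OF p br(1) d] Jop_coord[OF p br(2) d] by simp
  also have "\<dots> = Jop d ?y (?P (flat_bracket (?lf (J0 ?a)) (?lf ?b) ?x)) + Jop d ?y (?P (flat_bracket (?lf ?a) (?lf (J0 ?b)) ?x))
      - ?P (flat_bracket (?lf (J0 ?a)) (?lf (J0 ?b)) ?x) + ?P (flat_bracket (?lf ?a) (?lf ?b) ?x)"
    unfolding y[symmetric]
    by (rule I.torsion_eq[where a = "?lf ?a" and a' = "?lf (J0 ?a)" and b = "?lf ?b" and b' = "?lf (J0 ?b)"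
          and X = ?X and Y = ?Y, OF lfD lfD lfD lfD Jop_frame_field[OF _ cA dA] Jop_frame_field[OF _ cA dA] sq _ _ Xx Yx])
       (simp_all only: y DX[OF d] DY[OF d])
  also have "\<dots> = proj_frame c d ?x (torsion0 ?a ?b)"
    unfolding flat_bracket_left_frame[OF c] torsion0_def
    using Jop_proj_frame[OF c d] by (simp add: proj_frame_def blinfun.add_right blinfun.diff_right)
  also have "\<dots> = d\<pi> g (lfield (vec (torsion0 ?a ?b)) g) d"
    using d\<pi>_lfield_coord[OF c d vec_T1] by (simp add: vec_c0)
  finally have eq: "nijenhuis_torsion Q \<J> X Y ?p d = d\<pi> g (lfield (vec (torsion0 ?a ?b)) g) d" .
  have "nijenhuis_torsion Q \<J> X Y ?p \<in> tspace Q ?p"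
    unfolding N by (intro Q.tspace_add Q.tspace_diff \<J>_tspace[OF p] br)
  from Q.tspace_eqI[OF this d\<pi>_lfield_tspace[OF g vec_T1] d eq] show ?thesis .
qed

lemma is_nijenhuis_iff: "is_nijenhuis Q \<J> \<longleftrightarrow> (\<forall>a b. torsion0 a b \<in> \<kk>0)"
proof
  assume N: "is_nijenhuis Q \<J>"
  show "\<forall>a b. torsion0 a b \<in> \<kk>0"
  proof (intro allI)
    fix a b
    \<comment> \<open>Fundamental fields come from right invariant fields, but at the base point
      they have the same values as the projected left invariant ones. The torsion is therefore
      tested there.\<close>
    have f: "fundamental_field (vec a) (\<pi> \<one>) = d\<pi> \<one> (lfield (vec a) \<one>)" for a
    proof -
      have "lfield (vec a) \<one> = vec a"
        by (rule tspace_eqI[OF left_inv_field_tspace[OF vec_T1 one_closed] vec_T1 c0])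
           (simp add: left_inv_field_coord[OF vec_T1 c0] vec_c0 left_frame_e0)
      then show ?thesis using fundamental_field_one[OF vec_T1] by simp
    qed
    have "d\<pi> \<one> (lfield (vec (torsion0 (vec a c0) (vec b c0))) \<one>) = 0"
      using nijenhuis_torsion_eq[OF fundamental_field_vector_field[OF vec_T1] fundamental_field_vector_field[OF vec_T1]
          one_closed vec_T1 f vec_T1 f, of a b] N fundamental_field_vector_field[OF vec_T1] \<pi>_pts[OF one_closed]
      unfolding is_nijenhuis_def by metis
    then show "torsion0 a b \<in> \<kk>0"
      using d\<pi>_lfield_eq_0_iff[OF one_closed vec_T1] by (simp add: vec_c0 \<kk>0_def)
  qed
next
  assume T: "\<forall>a b. torsion0 a b \<in> \<kk>0"
  show "is_nijenhuis Q \<J>"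
    unfolding is_nijenhuis_def
  proof (intro allI impI ballI)
    fix X Y p assume X: "vector_field Q X" and Y: "vector_field Q Y" and p: "p \<in> pts Q"
    obtain g where g: "g \<in> carrier G" "p = \<pi> g" using p pts_Q by auto
    have "X (\<pi> g) \<in> tspace Q (\<pi> g)" "Y (\<pi> g) \<in> tspace Q (\<pi> g)"
      using X Y p g(2) unfolding vector_field_def by auto
    then obtain v w where v: "v \<in> T1" "X (\<pi> g) = d\<pi> g (lfield v g)" and w: "w \<in> T1" "Y (\<pi> g) = d\<pi> g (lfield w g)"
      using d\<pi>_lfield_surj[OF g(1)] by metis
    have "vec (torsion0 (v c0) (w c0)) \<in> \<kk>" using T by (simp add: \<kk>0_def)
    then show "nijenhuis_torsion Q \<J> X Y p = 0"
      unfolding g(2) nijenhuis_torsion_eq[OF X Y g(1) v w] by (simp add: d\<pi>_lfield_eq_0_iff[OF g(1) vec_T1])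
  qed
qed

text \<open>Admissibility is inherited by brackets with \<open>\<kk>\<close>: rather than differentiating the condition on
  \<open>Ad\<close> along \<open>K\<close>, use that \<open>Jop\<close> is differentiable.\<close>

lemma \<kk>0_bracket:
  assumes k: "k \<in> \<kk>0"
  shows "frame_bracket k (J0 a) - J0 (frame_bracket k a) \<in> \<kk>0"
    and "l \<in> \<kk>0 \<Longrightarrow> frame_bracket k l \<in> \<kk>0"
proof -
  obtain d where d: "d \<in> charts_at Q (\<pi> \<one>)" using Q.chart_at_pt[OF \<pi>_pts[OF one_closed]] by blast
  note cA = charts_atD(1)[OF c0] and dA = Q.charts_atD(1)[OF d]
  let ?P = "bderiv (\<pi>_loc c0 d)"
  let ?lf = "\<lambda>a x. blinfun_apply (left_frame c0 x) a"
  interpret I: intertwined_fields "pre_dom c0 d" "\<pi>_loc c0 d" e0 "Jop d" by (rule intertwined_fields[OF c0 d])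
  note lfD = frame_field_differentiable[OF c0]
  \<comment> \<open>The left invariant field of an element of \<kk> is vertical at every point, as
    the kernel of \<open>proj_frame\<close> is the same everywhere.\<close>
  have vert: "?P y (?lf k y) = 0" if k: "k \<in> \<kk>0" and y: "y \<in> pre_dom c0 d" for k y
  proof -
    obtain g where g: "g \<in> carrier G" "c0 \<in> charts_at M g" "d \<in> charts_at Q (\<pi> g)" "y = chart_map c0 g"
      using pre_domE[OF y cA dA] by blast
    show ?thesis using proj_frame_eq_0_iff[OF g(2,3), of k] k g(4) by (simp add: proj_frame_def)
  qed
  have y: "\<pi>_loc c0 d e0 = chart_map d (\<pi> \<one>)" by (rule \<pi>_loc_chart[OF c0])
  have "Jop d (\<pi>_loc c0 d e0) (?P e0 (flat_bracket (?lf k) (?lf a) e0)) = ?P e0 (flat_bracket (?lf k) (?lf (J0 a)) e0)"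
    by (rule I.vertical_bracket_eq[OF lfD lfD lfD Jop_frame_field[OF _ cA dA] vert[OF k]])
  then have "proj_frame c0 d e0 (J0 (frame_bracket k a)) = proj_frame c0 d e0 (frame_bracket k (J0 a))"
    using Jop_proj_frame[OF c0 d, of "frame_bracket k a"] unfolding y flat_bracket_left_frame[OF c0]
    by (simp add: proj_frame_def)
  then have "proj_frame c0 d e0 (frame_bracket k (J0 a) - J0 (frame_bracket k a)) = 0"
    by (simp add: blinfun.diff_right)
  then show "frame_bracket k (J0 a) - J0 (frame_bracket k a) \<in> \<kk>0"
    unfolding proj_frame_eq_0_iff[OF c0 d] .
  assume l: "l \<in> \<kk>0"
  have "?P e0 (flat_bracket (?lf k) (?lf l) e0) = 0"
    by (rule I.vertical_bracket_vertical[OF lfD lfD vert[OF k] vert[OF l]])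
  then have "proj_frame c0 d e0 (frame_bracket k l) = 0"
    unfolding flat_bracket_left_frame[OF c0] by (simp add: proj_frame_def)
  then show "frame_bracket k l \<in> \<kk>0" unfolding proj_frame_eq_0_iff[OF c0 d] .
qed

lemma \<kk>0_add: "a \<in> \<kk>0 \<Longrightarrow> b \<in> \<kk>0 \<Longrightarrow> a + b \<in> \<kk>0"
  and \<kk>0_diff: "a \<in> \<kk>0 \<Longrightarrow> b \<in> \<kk>0 \<Longrightarrow> a - b \<in> \<kk>0"
  and \<kk>0_J0: "a \<in> \<kk>0 \<Longrightarrow> J0 a \<in> \<kk>0"
  and \<kk>0_J0_sq: "J0 (J0 a) + a \<in> \<kk>0"
  using \<kk>_subspace(2,3) J_\<kk>[of "vec a"] J_sq[OF vec_T1, of a]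
  by (simp_all add: \<kk>0_def vec_add vec_diff J_vec)

text \<open>The real and imaginary parts of (J - i)(v + iw) are Jv + w and Jw - v.\<close>

lemma mem_Z_plus_iff:
  assumes "v \<in> T1" "w \<in> T1"
  shows "(v, w) \<in> Z_plus G M L J \<longleftrightarrow> J0 (v c0) + w c0 \<in> \<kk>0 \<and> J0 (w c0) - v c0 \<in> \<kk>0"
proof -
  have "(v, w) \<in> Z_plus G M L J \<longleftrightarrow> J v + w \<in> \<kk> \<and> J w - v \<in> \<kk>"
    using assms by (simp add: Z_plus_def lie_alg_def times_i_def)
  also have "\<dots> \<longleftrightarrow> J0 (v c0) + w c0 \<in> \<kk>0 \<and> J0 (w c0) - v c0 \<in> \<kk>0"
    using assms by (simp add: \<kk>_iff J_T1 tspace_add tspace_diff J0_coord)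
  finally show ?thesis .
qed

end

text \<open>Modulo \<open>S\<close>, the elements \<open>a + ia'\<close> of \<open>Z\<^sub>+\<close> are those of the form \<open>a - iJa\<close>.\<close>

lemma closed_iff_torsion_mem:
  fixes S :: "'a::ab_group_add set" and J :: "'a \<Rightarrow> 'a" and B :: "'a \<Rightarrow> 'a \<Rightarrow> 'a"
  assumes S: "\<And>a b. a \<in> S \<Longrightarrow> b \<in> S \<Longrightarrow> a + b \<in> S" "\<And>a b. a \<in> S \<Longrightarrow> b \<in> S \<Longrightarrow> a - b \<in> S"
    and J: "\<And>a b. J (a + b) = J a + J b" "\<And>a. a \<in> S \<Longrightarrow> J a \<in> S" "\<And>a. J (J a) + a \<in> S"
    and B: "\<And>a a' b. B (a + a') b = B a b + B a' b" "\<And>a b b'. B a (b + b') = B a b + B a b'"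
    and anti: "\<And>a b. B a b = - B b a"
    and SB: "\<And>k a. k \<in> S \<Longrightarrow> B k (J a) - J (B k a) \<in> S" "\<And>k l. k \<in> S \<Longrightarrow> l \<in> S \<Longrightarrow> B k l \<in> S"
  shows "(\<forall>a b. J (B (J a) b) + J (B a (J b)) - B (J a) (J b) + B a b \<in> S) \<longleftrightarrow>
    (\<forall>a a' b b'. J a + a' \<in> S \<longrightarrow> J a' - a \<in> S \<longrightarrow> J b + b' \<in> S \<longrightarrow> J b' - b \<in> S \<longrightarrow>
      J (B a b - B a' b') + (B a b' + B a' b) \<in> S \<and> J (B a b' + B a' b) - (B a b - B a' b') \<in> S)"
    (is "?T \<longleftrightarrow> ?Z")
proof -
  have J_add_0: "J 0 = 0" using J(1)[of 0 0] by simp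
  have J_minus: "J (- a) = - J a" for a using J(1)[of a "- a"] by (simp add: J_add_0 eq_neg_iff_add_eq_0 add.commute)
  have J_diff: "J (a - b) = J a - J b" for a b using J(1)[of a "- b"] by (simp add: J_minus)
  have B0: "B 0 b = 0" "B b 0 = 0" for b using B(1)[of 0 0 b] B(2)[of b 0 0] by auto
  have B_minus: "B (- a) b = - B a b" "B b (- a) = - B b a" for a b
    using B(1)[of a "- a" b] B(2)[of b a "- a"] by (simp_all add: B0 eq_neg_iff_add_eq_0 add.commute)
  have S0: "0 \<in> S" using S(2)[OF J(3)[of 0] J(3)[of 0]] by simp
  have S_minus: "a \<in> S \<Longrightarrow> - a \<in> S" for a using S(2)[OF S0, of a] by simp
  \<comment> \<open>Applying \<open>J\<close> to the first condition for membership in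
    \<open>Z_plus\<close> yields the second, up to an element of \<open>S\<close> coming from J^2 +
    1.\<close>
  have S_swap: "J y - x \<in> S" if "J x + y \<in> S" for x y
  proof -
    have "J (J x + y) - (J (J x) + x) \<in> S" by (intro S J that)
    then show ?thesis by (simp add: J)
  qed
  \<comment> \<open>Obtained from \<open>J\<close> applied to the compatibility \<open>SB\<close>
    together with J^2 + 1. These are the combinations in which the deviations \<open>k\<close> and
    \<open>l\<close> below enter the bracket.\<close>
  have mixed: "J (B k (J b)) + B k b \<in> S" if k: "k \<in> S" for k b
  proof -
    have "J (B k (J b) - J (B k b)) + (J (J (B k b)) + B k b) \<in> S" by (intro S J SB k)
    then show ?thesis by (simp add: J_diff)
  qed
  show ?thesis
  proof
    assume T: ?T
    show ?Z
    proof (intro allI impI)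
      fix a a' b b' assume ab: "J a + a' \<in> S" "J b + b' \<in> S"
      define k l where "k = J a + a'" and "l = J b + b'"
      have kl: "k \<in> S" "l \<in> S" and a': "a' = k + - J a" and b': "b' = l + - J b"
        using ab by (auto simp: k_def l_def)
      let ?t = "J (B (J a) b) + J (B a (J b)) - B (J a) (J b) + B a b"
      let ?u = "B (J a) b + B a (J b)"
      let ?x = "B a b - B a' b'" and ?y = "B a b' + B a' b"
      \<comment> \<open>With \<open>a' = k - J a\<close> and \<open>b' = l - J b\<close>, the
        expression \<open>J ?x + ?y\<close> is \<open>J ?t - (J (J ?u) + ?u)\<close> when
        \<open>k\<close> and \<open>l\<close> vanish. The other terms are the two mixed ones and
        \<open>J (B k l)\<close>, all in \<open>S\<close>.\<close>
      have "J ?t - (J (J ?u) + ?u) - (J (B l (J a)) + B l a) + (J (B k (J b)) + B k b) - J (B k l) \<in> S"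
        by (rule S(2)[OF S(1)[OF S(2)[OF S(2)[OF J(2) J(3)] mixed[OF kl(2)]] mixed[OF kl(1)]] J(2)[OF SB(2)[OF kl]]])
           (use T in blast)
      moreover have "J ?t - (J (J ?u) + ?u) - (J (B l (J a)) + B l a) + (J (B k (J b)) + B k b) - J (B k l) = J ?x + ?y"
        unfolding a' b' B B_minus using anti[of l "J a"] anti[of l a] by (simp add: J J_diff J_minus)
      ultimately have "J ?x + ?y \<in> S" by simp
      with S_swap show "J ?x + ?y \<in> S \<and> J ?y - ?x \<in> S" by blast
    qed
  next
    assume Z: ?Z
    show ?T
    proof (intro allI)
      fix a b
      \<comment> \<open>The pairs \<open>(a, - J a)\<close> and \<open>(b, - J b)\<close> stand for
        a - iJa and b - iJb. The second condition on their bracket is the negative of the torsion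
        expression.\<close>
      have "J a + - J a \<in> S" "J b + - J b \<in> S" using S0 by auto
      then have "J (B a (- J b) + B (- J a) b) - (B a b - B (- J a) (- J b)) \<in> S"
        using Z S_swap by blast
      from S_minus[OF this] show "J (B (J a) b) + J (B a (J b)) - B (J a) (J b) + B a b \<in> S"
        by (simp add: B_minus J J_minus J_diff algebra_simps)
    qed
  qed
qed

section \<open>Return from coordinates to \<open>Z_plus\<close>\<close>

context homogeneous_complex
begin

text \<open>The maps \<open>vec\<close> and v \<mapsto> v c0 are mutually inverse between
  \<open>'a\<close> and the Lie algebra, so quantifying over \<open>Z_plus\<close> amounts to
  quantifying over pairs in \<open>'a\<close>.\<close>

lemma is_nijenhuis_iff_Z_plus_closed:
  "is_nijenhuis Q \<J> \<longleftrightarrow> (\<forall>v\<in>Z_plus G M L J. \<forall>w\<in>Z_plus G M L J. lie_bracket_C G M v w \<in> Z_plus G M L J)"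
proof -
  let ?Z = "\<lambda>a a'. J0 a + a' \<in> \<kk>0 \<and> J0 a' - a \<in> \<kk>0"
  have bracket: "lie_bracket_C G M (v, v') (w, w') \<in> Z_plus G M L J \<longleftrightarrow>
      ?Z (frame_bracket (v c0) (w c0) - frame_bracket (v' c0) (w' c0)) (frame_bracket (v c0) (w' c0) + frame_bracket (v' c0) (w c0))"
    if "v \<in> T1" "v' \<in> T1" "w \<in> T1" "w' \<in> T1" for v v' w w'
    using that unfolding lie_bracket_C_def fst_conv snd_conv
    by (subst mem_Z_plus_iff) (simp_all add: tspace_add tspace_diff lie_bracket_tspace lie_bracket_coord)
  have Z_T1: "fst v \<in> T1" "snd v \<in> T1" if "v \<in> Z_plus G M L J" for v
    using that by (auto simp: Z_plus_def lie_alg_def)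
  have vec_Z: "(vec a, vec a') \<in> Z_plus G M L J \<longleftrightarrow> ?Z a a'" for a a'
    using mem_Z_plus_iff[OF vec_T1 vec_T1] by (simp add: vec_c0)
  have "is_nijenhuis Q \<J> \<longleftrightarrow> (\<forall>a a' b b'. J0 a + a' \<in> \<kk>0 \<longrightarrow> J0 a' - a \<in> \<kk>0 \<longrightarrow> J0 b + b' \<in> \<kk>0 \<longrightarrow> J0 b' - b \<in> \<kk>0 \<longrightarrow>
      ?Z (frame_bracket a b - frame_bracket a' b') (frame_bracket a b' + frame_bracket a' b))"
    unfolding is_nijenhuis_iff torsion0_def
    by (rule closed_iff_torsion_mem)
       (fact \<kk>0_add \<kk>0_diff \<kk>0_J0 \<kk>0_J0_sq frame_bracket_add frame_bracket_antisym \<kk>0_bracket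
         | simp add: blinfun.add_right)+
  also have "\<dots> \<longleftrightarrow> (\<forall>v\<in>Z_plus G M L J. \<forall>w\<in>Z_plus G M L J. lie_bracket_C G M v w \<in> Z_plus G M L J)"
  proof (intro iffI ballI allI impI)
    fix v w assume closed: "\<forall>a a' b b'. J0 a + a' \<in> \<kk>0 \<longrightarrow> J0 a' - a \<in> \<kk>0 \<longrightarrow> J0 b + b' \<in> \<kk>0 \<longrightarrow> J0 b' - b \<in> \<kk>0 \<longrightarrow>
      ?Z (frame_bracket a b - frame_bracket a' b') (frame_bracket a b' + frame_bracket a' b)"
      and v: "v \<in> Z_plus G M L J" and w: "w \<in> Z_plus G M L J"
    have "?Z (fst v c0) (snd v c0)" "?Z (fst w c0) (snd w c0)"
      using mem_Z_plus_iff[OF Z_T1[OF v]] mem_Z_plus_iff[OF Z_T1[OF w]] v w by simp_all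
    with closed bracket[OF Z_T1[OF v] Z_T1[OF w]] show "lie_bracket_C G M v w \<in> Z_plus G M L J" by simp
  next
    fix a a' b b'
    assume closed: "\<forall>v\<in>Z_plus G M L J. \<forall>w\<in>Z_plus G M L J. lie_bracket_C G M v w \<in> Z_plus G M L J"
      and "J0 a + a' \<in> \<kk>0" "J0 a' - a \<in> \<kk>0" "J0 b + b' \<in> \<kk>0" "J0 b' - b \<in> \<kk>0"
    then have "lie_bracket_C G M (vec a, vec a') (vec b, vec b') \<in> Z_plus G M L J"
      using vec_Z by blast
    then show "?Z (frame_bracket a b - frame_bracket a' b') (frame_bracket a b' + frame_bracket a' b)"
      unfolding bracket[OF vec_T1 vec_T1 vec_T1 vec_T1] by (simp add: vec_c0)
  qed
  finally show ?thesis .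
qed

end

theorem theorem4p7:
  fixes G :: "'g monoid"
    and M :: "('g, 'a::banach) mfd"
    and K :: "'g set"
    and L :: "('g, 'b::banach) mfd"
    and Q :: "('g set, 'e::banach) mfd"
    and J :: "('g, 'a) tvec \<Rightarrow> ('g, 'a) tvec"
  assumes "homogeneous_space G M K L Q"
    and "J \<in> admissible_complex G M K L"
  shows "is_nijenhuis Q (induced_structure G M K Q J) \<longleftrightarrow>
    (\<forall>v\<in>Z_plus G M L J. \<forall>w\<in>Z_plus G M L J. lie_bracket_C G M v w \<in> Z_plus G M L J)"
proof -
  have lie: "banach_lie_group G M" using assms(1) by (simp add: homogeneous_space_def)
  interpret group G using lie by (simp add: banach_lie_group_def)
  interpret banach_mfd M using lie by (simp add: banach_lie_group_def banach_mfd_def)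
  have "\<one>\<^bsub>G\<^esub> \<in> pts M" using lie by (simp add: banach_lie_group_def)
  then obtain c0 where c0: "c0 \<in> charts_at M \<one>\<^bsub>G\<^esub>" using chart_at_pt by blast
  interpret homogeneous_complex G M c0 K L Q J
    by unfold_locales (use lie c0 assms in auto)
  show ?thesis by (rule is_nijenhuis_iff_Z_plus_closed)
qed

end
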